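(* A stable submodule $\mathcal J\subset\mathcal P_a$, $\mathcal J\neq\{0\}$, is weakly localisable if and only if it contains a function $\varphi\not\equiv0$ such that $$\mathcal J(\varphi)\subset\mathcal J.$$
   Context: $\omega:[0,\infty)\to[0,\infty)$ is a non-decreasing continuous function such that: $t\mapsto\omega(e^t)$ is convex on $[0,\infty)$; $\omega(x)=o(x)$ and $\ln x=o(\omega(x))$ as $x\to\infty$; for every $\sigma>1$ there is $C>0$ with $\omega(x+y)\le\sigma(\omega(x)+\omega(y))+C$ for all $x,y\ge0$; $\int_1^\infty \omega(x)x^{-2}\,dx<\infty$. Fix $0<a\le+\infty$ and sequences $0<c_k\nearrow a$ with $c_k<a$, $0<r_k\nearrow1$ with $r_k<1$. $P_k$ is the Banach space of entire functions $\varphi$ with $\|\varphi\|_k=\sup_{z\in\mathbb C}|\varphi(z)|e^{-r_k\omega(|z|)-c_k|\mathrm{Im}\,z|}<\infty$, and $\mathcal P_a$ is the locally convex inductive limit of the $P_k$. $\mathcal P_a$ is a topological module over $\mathbb C[z]$; "submodule" means closed $\mathbb C[z]$-submodule. For a submodule $\mathcal J\neq\{0\}$ and $\lambda\in\mathbb C$ let $n_\lambda\ge0$ be the minimal multiplicity of vanishing at $\lambda$ of functions in $\mathcal J$. $\mathcal Z_{\mathcal J}$ is the set of points $\lambda$ with $n_\lambda\ge1$, counted with multiplicity $n_\lambda$. $\mathcal J$ is stable at $\lambda$ if $\varphi/(z-\lambda)\in\mathcal J$ whenever $\varphi\in\mathcal J$ vanishes at $\lambda$ with multiplicity greater than $n_\lambda$;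 $\mathcal J$ is stable if it is stable at every $\lambda\in\mathbb C$. For nonzero $\varphi\in\mathcal P_a$ let $h_\varphi(\theta)=\limsup_{r\to\infty}r^{-1}\ln|\varphi(re^{\mathrm i\theta})|$, $c_\varphi=-h_\varphi(-\pi/2)$, $d_\varphi=h_\varphi(\pi/2)$. The indicator segment of $\mathcal J\ne\{0\}$ is $[c_{\mathcal J};d_{\mathcal J}]\subset\overline{\mathbb R}$, $c_{\mathcal J}=\inf c_\varphi$, $d_{\mathcal J}=\sup d_\varphi$ over nonzero $\varphi\in\mathcal J$. A submodule $\mathcal J\ne\{0\}$ is weakly localisable if it is maximal among all submodules with the same zero set and the same indicator segment; equivalently, $\mathcal J$ contains every nonzero $\psi\in\mathcal P_a$ with $[c_\psi;d_\psi]\subset[c_{\mathcal J};d_{\mathcal J}]$ that vanishes on $\mathcal Z_{\mathcal J}$ (with multiplicities). For $\varphi\in\mathcal P_a$, $\mathcal J(\varphi)$ is the submodule of all $\psi\in\mathcal P_a$ of the form $\psi=\rho\varphi$, where $\rho$ is an entire function of minimal type with respect to order 1, i.e. for every $\varepsilon>0$ there is $C_\varepsilon$ with $|\rho(z)|\le C_\varepsilon e^{\varepsilon|z|}$ for all $z\in\mathbb C$. *)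

theory Defs
  imports "HOL-Complex_Analysis.Complex_Analysis" "HOL-Library.Landau_Symbols"
begin

definition admissible_weight :: "(real \<Rightarrow> real) \<Rightarrow> bool" where
  "admissible_weight \<omega> \<longleftrightarrow>
     (\<forall>x\<ge>0. \<omega> x \<ge> 0) \<and>
     mono_on {0..} \<omega> \<and>
     continuous_on {0..} \<omega> \<and>
     convex_on {0..} (\<lambda>t. \<omega> (exp t)) \<and>
     \<omega> \<in> o[at_top](\<lambda>x. x) \<and>
     ln \<in> o[at_top](\<omega>) \<and>
     (\<forall>\<sigma>>1. \<exists>C>0. \<forall>x\<ge>0. \<forall>y\<ge>0. \<omega> (x + y) \<le> \<sigma> * (\<omega> x + \<omega> y) + C) \<and>
     set_integrable lborel {1..} (\<lambda>x. \<omega> x / x\<^sup>2)"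

definition Pk_weighted ::
  "(real \<Rightarrow> real) \<Rightarrow> (nat \<Rightarrow> real) \<Rightarrow> (nat \<Rightarrow> real) \<Rightarrow> nat \<Rightarrow> (complex \<Rightarrow> complex) \<Rightarrow> complex \<Rightarrow> real" where
  "Pk_weighted \<omega> c r k \<phi> z = cmod (\<phi> z) * exp (- r k * \<omega> (cmod z) - c k * \<bar>Im z\<bar>)"

definition Pk ::
  "(real \<Rightarrow> real) \<Rightarrow> (nat \<Rightarrow> real) \<Rightarrow> (nat \<Rightarrow> real) \<Rightarrow> nat \<Rightarrow> (complex \<Rightarrow> complex) set" where
  "Pk \<omega> c r k = {\<phi>. \<phi> holomorphic_on UNIV \<and> bdd_above (range (Pk_weighted \<omega> c r k \<phi>))}"

definition Pk_norm ::
  "(real \<Rightarrow> real) \<Rightarrow> (nat \<Rightarrow> real) \<Rightarrow> (nat \<Rightarrow> real) \<Rightarrow> nat \<Rightarrow> (complex \<Rightarrow> complex) \<Rightarrow> real" where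
  "Pk_norm \<omega> c r k \<phi> = (SUP z. Pk_weighted \<omega> c r k \<phi> z)"

definition Pa ::
  "(real \<Rightarrow> real) \<Rightarrow> (nat \<Rightarrow> real) \<Rightarrow> (nat \<Rightarrow> real) \<Rightarrow> (complex \<Rightarrow> complex) set" where
  "Pa \<omega> c r = (\<Union>k. Pk \<omega> c r k)"

definition absolutely_convex :: "(complex \<Rightarrow> complex) set \<Rightarrow> bool" where
  "absolutely_convex U \<longleftrightarrow>
     (\<forall>f\<in>U. \<forall>g\<in>U. \<forall>\<alpha> \<beta>. cmod \<alpha> + cmod \<beta> \<le> 1 \<longrightarrow> (\<lambda>z. \<alpha> * f z + \<beta> * g z) \<in> U)"

text \<open>
  The standard base of neighbourhoods of zero of the locally convex inductive limit: the absolutely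
  convex sets whose trace on every step is a neighbourhood of zero in the norm topology of that step.
\<close>

definition Pa_zero_nhd ::
  "(real \<Rightarrow> real) \<Rightarrow> (nat \<Rightarrow> real) \<Rightarrow> (nat \<Rightarrow> real) \<Rightarrow> (complex \<Rightarrow> complex) set \<Rightarrow> bool" where
  "Pa_zero_nhd \<omega> c r U \<longleftrightarrow>
     U \<subseteq> Pa \<omega> c r \<and> absolutely_convex U \<and>
     (\<forall>k. \<exists>\<epsilon>>0. {f \<in> Pk \<omega> c r k. Pk_norm \<omega> c r k f < \<epsilon>} \<subseteq> U)"

definition Pa_open ::
  "(real \<Rightarrow> real) \<Rightarrow> (nat \<Rightarrow> real) \<Rightarrow> (nat \<Rightarrow> real) \<Rightarrow> (complex \<Rightarrow> complex) set \<Rightarrow> bool" where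
  "Pa_open \<omega> c r S \<longleftrightarrow>
     S \<subseteq> Pa \<omega> c r \<and>
     (\<forall>f\<in>S. \<exists>U. Pa_zero_nhd \<omega> c r U \<and> (\<forall>u\<in>U. (\<lambda>z. f z + u z) \<in> S))"

definition Pa_topology ::
  "(real \<Rightarrow> real) \<Rightarrow> (nat \<Rightarrow> real) \<Rightarrow> (nat \<Rightarrow> real) \<Rightarrow> (complex \<Rightarrow> complex) topology" where
  "Pa_topology \<omega> c r = topology (Pa_open \<omega> c r)"

lemma Pa_zero_nhd_Int:
  assumes "Pa_zero_nhd \<omega> c r U" "Pa_zero_nhd \<omega> c r V"
  shows "Pa_zero_nhd \<omega> c r (U \<inter> V)"
proof -
  have "\<exists>\<epsilon>>0. {f \<in> Pk \<omega> c r k. Pk_norm \<omega> c r k f < \<epsilon>} \<subseteq> U \<inter> V" for k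
  proof -
    obtain d e where d: "d > 0" "{f \<in> Pk \<omega> c r k. Pk_norm \<omega> c r k f < d} \<subseteq> U"
      and e: "e > 0" "{f \<in> Pk \<omega> c r k. Pk_norm \<omega> c r k f < e} \<subseteq> V"
      using assms unfolding Pa_zero_nhd_def by meson
    show ?thesis
      by (rule exI[of _ "min d e"]) (use d e in auto)
  qed
  moreover have "absolutely_convex (U \<inter> V)"
    using assms unfolding Pa_zero_nhd_def absolutely_convex_def by simp
  ultimately show ?thesis
    using assms unfolding Pa_zero_nhd_def by blast
qed

lemma istopology_Pa_open: "istopology (Pa_open \<omega> c r)"
  unfolding istopology_def
proof safe
  fix S T assume S: "Pa_open \<omega> c r S" and T: "Pa_open \<omega> c r T"
  have "\<exists>U. Pa_zero_nhd \<omega> c r U \<and> (\<forall>u\<in>U. (\<lambda>z. f z + u z) \<in> S \<inter> T)"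
    if f: "f \<in> S \<inter> T" for f
  proof -
    obtain U where U: "Pa_zero_nhd \<omega> c r U" "\<forall>u\<in>U. (\<lambda>z. f z + u z) \<in> S"
      using S f unfolding Pa_open_def by auto
    obtain V where V: "Pa_zero_nhd \<omega> c r V" "\<forall>u\<in>V. (\<lambda>z. f z + u z) \<in> T"
      using T f unfolding Pa_open_def by auto
    show ?thesis
      using Pa_zero_nhd_Int[OF U(1) V(1)] U(2) V(2) by (intro exI[of _ "U \<inter> V"]) simp
  qed
  moreover have "S \<inter> T \<subseteq> Pa \<omega> c r"
    using S unfolding Pa_open_def by blast
  ultimately show "Pa_open \<omega> c r (S \<inter> T)"
    unfolding Pa_open_def by simp
next
  fix K assume K: "\<forall>S\<in>K. Pa_open \<omega> c r S"
  have "\<exists>U. Pa_zero_nhd \<omega> c r U \<and> (\<forall>u\<in>U. (\<lambda>z. f z + u z) \<in> \<Union>K)"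
    if SK: "S \<in> K" and fS: "f \<in> S" for f S
  proof -
    have "Pa_open \<omega> c r S"
      using K SK by blast
    then obtain U where U: "Pa_zero_nhd \<omega> c r U" "\<forall>u\<in>U. (\<lambda>z. f z + u z) \<in> S"
      using fS unfolding Pa_open_def by auto
    show ?thesis
      by (intro exI[of _ U] conjI ballI U(1) UnionI[OF SK]) (use U(2) in simp)
  qed
  then have "\<forall>f\<in>\<Union>K. \<exists>U. Pa_zero_nhd \<omega> c r U \<and> (\<forall>u\<in>U. (\<lambda>z. f z + u z) \<in> \<Union>K)"
    by (intro ballI) (erule UnionE)
  moreover have "\<Union>K \<subseteq> Pa \<omega> c r"
    using K unfolding Pa_open_def by (simp add: Union_least)
  ultimately show "Pa_open \<omega> c r (\<Union>K)"
    unfolding Pa_open_def by simp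
qed

lemma openin_Pa_topology: "openin (Pa_topology \<omega> c r) S \<longleftrightarrow> Pa_open \<omega> c r S"
  by (simp add: Pa_topology_def istopology_Pa_open)

lemma Pk_mono:
  assumes "\<forall>x\<ge>0. \<omega> x \<ge> 0" "incseq c" "incseq r" "k \<le> m"
  shows "Pk \<omega> c r k \<subseteq> Pk \<omega> c r m"
proof
  fix f assume f: "f \<in> Pk \<omega> c r k"
  then obtain B where B: "\<And>z. Pk_weighted \<omega> c r k f z \<le> B"
    unfolding Pk_def bdd_above_def by auto
  have "Pk_weighted \<omega> c r m f z \<le> B" for z
  proof -
    have "r k * \<omega> (cmod z) \<le> r m * \<omega> (cmod z)" "c k * \<bar>Im z\<bar> \<le> c m * \<bar>Im z\<bar>"
      using assms by (auto intro!: mult_right_mono simp: incseq_def)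
    then have "Pk_weighted \<omega> c r m f z \<le> Pk_weighted \<omega> c r k f z"
      unfolding Pk_weighted_def by (intro mult_left_mono) auto
    with B show ?thesis
      using order_trans by blast
  qed
  then show "f \<in> Pk \<omega> c r m"
    using f unfolding Pk_def bdd_above_def by auto
qed

lemma Pk_add:
  assumes "f \<in> Pk \<omega> c r k" "g \<in> Pk \<omega> c r k"
  shows "(\<lambda>z. f z + g z) \<in> Pk \<omega> c r k"
proof -
  obtain A B where A: "\<And>z. Pk_weighted \<omega> c r k f z \<le> A" and B: "\<And>z. Pk_weighted \<omega> c r k g z \<le> B"
    using assms unfolding Pk_def bdd_above_def by auto
  have "Pk_weighted \<omega> c r k (\<lambda>z. f z + g z) z \<le> A + B" for z
  proof -
    have "Pk_weighted \<omega> c r k (\<lambda>z. f z + g z) z \<le> Pk_weighted \<omega> c r k f z + Pk_weighted \<omega> c r k g z"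
      unfolding Pk_weighted_def distrib_right[symmetric]
      by (intro mult_right_mono norm_triangle_ineq) auto
    with A[of z] B[of z] show ?thesis by linarith
  qed
  then show ?thesis
    using assms unfolding Pk_def bdd_above_def by (auto intro!: holomorphic_intros)
qed

lemma Pa_add:
  assumes "\<forall>x\<ge>0. \<omega> x \<ge> 0" "incseq c" "incseq r"
    and "f \<in> Pa \<omega> c r" "g \<in> Pa \<omega> c r"
  shows "(\<lambda>z. f z + g z) \<in> Pa \<omega> c r"
proof -
  obtain k m where "f \<in> Pk \<omega> c r k" "g \<in> Pk \<omega> c r m"
    using assms(4,5) unfolding Pa_def by auto
  then have "f \<in> Pk \<omega> c r (max k m)" "g \<in> Pk \<omega> c r (max k m)"
    using Pk_mono[OF assms(1-3)] by (meson max.cobounded1 max.cobounded2 subsetD)+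
  then have "(\<lambda>z. f z + g z) \<in> Pk \<omega> c r (max k m)"
    by (rule Pk_add)
  then show ?thesis
    unfolding Pa_def by auto
qed

lemma zero_nhd_Pa:
  assumes "\<forall>x\<ge>0. \<omega> x \<ge> 0" "incseq c" "incseq r"
  shows "Pa_zero_nhd \<omega> c r (Pa \<omega> c r)"
proof -
  have scale: "(\<lambda>z. \<alpha> * f z) \<in> Pa \<omega> c r" if "f \<in> Pa \<omega> c r" for f \<alpha>
  proof -
    obtain k where k: "f \<in> Pk \<omega> c r k"
      using \<open>f \<in> Pa \<omega> c r\<close> unfolding Pa_def by auto
    then obtain A where A: "\<And>z. Pk_weighted \<omega> c r k f z \<le> A"
      unfolding Pk_def bdd_above_def by auto
    have "Pk_weighted \<omega> c r k (\<lambda>z. \<alpha> * f z) z \<le> cmod \<alpha> * A" for z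
      using mult_left_mono[OF A[of z], of "cmod \<alpha>"]
      by (simp add: Pk_weighted_def norm_mult mult.assoc)
    then have "(\<lambda>z. \<alpha> * f z) \<in> Pk \<omega> c r k"
      using k unfolding Pk_def bdd_above_def by (auto intro!: holomorphic_intros)
    then show ?thesis
      unfolding Pa_def by blast
  qed
  have "absolutely_convex (Pa \<omega> c r)"
    unfolding absolutely_convex_def using Pa_add[OF assms] scale by simp
  moreover have "{f \<in> Pk \<omega> c r k. Pk_norm \<omega> c r k f < 1} \<subseteq> Pa \<omega> c r" for k
    unfolding Pa_def by blast
  ultimately show ?thesis
    unfolding Pa_zero_nhd_def by (auto intro!: exI[of _ 1])
qed

lemma topspace_Pa_topology:
  assumes "\<forall>x\<ge>0. \<omega> x \<ge> 0" "incseq c" "incseq r"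
  shows "topspace (Pa_topology \<omega> c r) = Pa \<omega> c r"
proof -
  have "Pa_open \<omega> c r (Pa \<omega> c r)"
    unfolding Pa_open_def using zero_nhd_Pa[OF assms] Pa_add[OF assms]
    by (auto intro!: exI[of _ "Pa \<omega> c r"])
  then show ?thesis
    unfolding topspace_def openin_Pa_topology by (auto simp: Pa_open_def)
qed

definition closed_submodule ::
  "(real \<Rightarrow> real) \<Rightarrow> (nat \<Rightarrow> real) \<Rightarrow> (nat \<Rightarrow> real) \<Rightarrow> (complex \<Rightarrow> complex) set \<Rightarrow> bool" where
  "closed_submodule \<omega> c r J \<longleftrightarrow>
     (\<lambda>_. 0) \<in> J \<and>
     (\<forall>f\<in>J. \<forall>g\<in>J. (\<lambda>z. f z + g z) \<in> J) \<and>
     (\<forall>f\<in>J. \<forall>p :: complex poly. (\<lambda>z. poly p z * f z) \<in> J) \<and>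
     closedin (Pa_topology \<omega> c r) J"

definition vanishing_mult :: "(complex \<Rightarrow> complex) \<Rightarrow> complex \<Rightarrow> enat" where
  "vanishing_mult \<phi> w = (if \<phi> = (\<lambda>_. 0) then \<infinity> else enat (nat (zorder \<phi> w)))"

text \<open>
  The zero set with multiplicities is represented by the multiplicity function of its points.
  The zero function has multiplicity \<open>\<infinity>\<close>, so it does not influence the infimum.
\<close>

definition zero_set_mult :: "(complex \<Rightarrow> complex) set \<Rightarrow> complex \<Rightarrow> enat" where
  "zero_set_mult J w = (INF \<phi>\<in>J. vanishing_mult \<phi> w)"

text \<open>
  The entire function \<open>\<phi>(z) / (z - w)\<close>, for entire \<open>\<phi>\<close> with \<open>\<phi> w = 0\<close>: the value at \<open>w\<close> fills the
  removable singularity.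
\<close>

definition divide_zero :: "(complex \<Rightarrow> complex) \<Rightarrow> complex \<Rightarrow> complex \<Rightarrow> complex" where
  "divide_zero \<phi> w z = (if z = w then deriv \<phi> w else \<phi> z / (z - w))"

definition stable_at :: "(complex \<Rightarrow> complex) set \<Rightarrow> complex \<Rightarrow> bool" where
  "stable_at J w \<longleftrightarrow>
     (\<forall>\<phi>\<in>J. vanishing_mult \<phi> w > zero_set_mult J w \<longrightarrow> divide_zero \<phi> w \<in> J)"

definition stable :: "(complex \<Rightarrow> complex) set \<Rightarrow> bool" where
  "stable J \<longleftrightarrow> (\<forall>w. stable_at J w)"

text \<open>The library has \<open>ln 0 = 0\<close>, whereas the indicator requires the value \<open>-\<infinity>\<close>.\<close>

definition log_modulus :: "complex \<Rightarrow> ereal" where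
  "log_modulus w = (if w = 0 then -\<infinity> else ereal (ln (cmod w)))"

definition indicator_fun :: "(complex \<Rightarrow> complex) \<Rightarrow> real \<Rightarrow> ereal" where
  "indicator_fun \<phi> \<theta> =
     Limsup at_top (\<lambda>t::real. log_modulus (\<phi> (of_real t * exp (\<i> * of_real \<theta>))) / ereal t)"

definition ind_lower :: "(complex \<Rightarrow> complex) \<Rightarrow> ereal" where
  "ind_lower \<phi> = - indicator_fun \<phi> (- pi / 2)"

definition ind_upper :: "(complex \<Rightarrow> complex) \<Rightarrow> ereal" where
  "ind_upper \<phi> = indicator_fun \<phi> (pi / 2)"

definition indicator_segment :: "(complex \<Rightarrow> complex) set \<Rightarrow> ereal set" where
  "indicator_segment J =
     {(INF \<phi>\<in>J - {\<lambda>_. 0}. ind_lower \<phi>) .. (SUP \<phi>\<in>J - {\<lambda>_. 0}. ind_upper \<phi>)}"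

definition weakly_localisable ::
  "(real \<Rightarrow> real) \<Rightarrow> (nat \<Rightarrow> real) \<Rightarrow> (nat \<Rightarrow> real) \<Rightarrow> (complex \<Rightarrow> complex) set \<Rightarrow> bool" where
  "weakly_localisable \<omega> c r J \<longleftrightarrow>
     closed_submodule \<omega> c r J \<and> J \<noteq> {\<lambda>_. 0} \<and>
     (\<forall>J'. closed_submodule \<omega> c r J' \<and> J' \<noteq> {\<lambda>_. 0} \<and>
           zero_set_mult J' = zero_set_mult J \<and>
           indicator_segment J' = indicator_segment J \<and>
           J \<subseteq> J' \<longrightarrow> J' = J)"

definition minimal_type :: "(complex \<Rightarrow> complex) \<Rightarrow> bool" where
  "minimal_type \<rho> \<longleftrightarrow>
     \<rho> holomorphic_on UNIV \<and> (\<forall>\<epsilon>>0. \<exists>C. \<forall>z. cmod (\<rho> z) \<le> C * exp (\<epsilon> * cmod z))"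

definition multiplier_submodule ::
  "(real \<Rightarrow> real) \<Rightarrow> (nat \<Rightarrow> real) \<Rightarrow> (nat \<Rightarrow> real) \<Rightarrow> (complex \<Rightarrow> complex) \<Rightarrow> (complex \<Rightarrow> complex) set" where
  "multiplier_submodule \<omega> c r \<phi> =
     {\<psi> \<in> Pa \<omega> c r. \<exists>\<rho>. minimal_type \<rho> \<and> \<psi> = (\<lambda>z. \<rho> z * \<phi> z)}"

end

theory Submission
  imports Defs
begin

text \<open>
  If \<open>J\<close> is weakly localisable, it coincides with the set of all \<open>\<psi> \<in> P\<^sub>a\<close> whose zeros and indicators are
  controlled by those of \<open>J\<close>; this set is closed by Montel's theorem and the Phragmen-Lindelof principle, and
  multiplication by a function of minimal type does not leave it.

  Conversely, let \<open>\<J>(\<phi>) \<subseteq> J\<close>, let \<open>\<psi>\<close> belong to a submodule with the zeros and the indicator segment of \<open>J\<close>,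
  and let \<open>S\<close> be a continuous functional annihilating \<open>J\<close>. Stability makes
  \<open>E(\<lambda>) = S[(\<psi>(z) \<tau>(\<lambda>) - \<psi>(\<lambda>) \<tau>(z)) / (z - \<lambda>)] / \<tau>(\<lambda>)\<close> an entire function independent of \<open>\<tau> \<in> J\<close>, and
  \<open>\<bar>E \<tau>\<bar> \<le> C (\<parallel>\<psi>\<parallel> \<bar>\<tau>\<bar> + \<parallel>\<tau>\<parallel> \<bar>\<psi>\<bar>)\<close> with \<open>C\<close> independent of \<open>\<tau>\<close>. A Harnack inequality for quotients of bounded
  functions shows that \<open>E\<close> has minimal type. Hence \<open>E\<^sup>n \<phi> \<in> J\<close> for all \<open>n\<close>, the norms of these functions grow at most
  geometrically, so \<open>E\<close> is bounded and therefore constant. Comparing the constants for \<open>\<psi>\<close>, \<open>z \<psi>\<close> and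
  \<open>z\<^sup>2 \<psi>\<close> gives \<open>S \<psi> = 0\<close>.
\<close>

section \<open>Harnack inequalities for quotients of bounded holomorphic functions\<close>

text \<open>The growth of \<open>E\<close> is not known in advance: only the products
  \<open>E * \<tau>\<close> are controlled, and \<open>\<tau>\<close> may have zeros and irregular
  growth. Hence the Harnack estimate concerns a function \<open>f\<close> and a bounded
  \<open>g\<close> for which \<open>f * g\<close> is bounded too; one point where \<open>g\<close>
  is not small then bounds \<open>f\<close> everywhere, the zeros of \<open>g\<close> included. Such
  points on the imaginary axis are supplied by the limsup in the indicator. No single element of
  \<open>J\<close> need reach an end of the indicator segment. Since \<open>E\<close> does not
  depend on \<open>\<tau>\<close>, different elements may serve the two half-planes and the
  different values of \<epsilon>. Dividing by \<open>z - \<lambda>\<close> moves a function to a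
  larger step, which would ruin the iteration. The functional turns this loss into a constant, so
  the bound for \<open>E * \<tau>\<close> involves only norms of the step that contains
  \<open>\<tau>\<close> and \<open>\<psi>\<close>, and all \<open>E\<^sup>n \<phi>\<close> stay in
  one step. The neighbourhoods of the inductive limit are absolutely convex sets, so closedness is
  not sequential by definition. Compactness of the balls of each step reduces it to bounded
  pointwise limits.\<close>

text \<open>With \<open>g = exp h\<close>, the function \<open>- Re h\<close> is harmonic and
  nonnegative, and Harnack's inequality for it is the Schwarz lemma after a Cayley
  transform.\<close>

lemma harnack_nonvanishing:
  assumes hol: "g holomorphic_on ball 0 1"
    and nz: "\<And>z. cmod z < 1 \<Longrightarrow> g z \<noteq> 0"
    and le: "\<And>z. cmod z < 1 \<Longrightarrow> cmod (g z) \<le> 1"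
    and w: "cmod w < 1"
  shows "cmod (g 0) powr ((1 + cmod w) / (1 - cmod w)) \<le> cmod (g w)"
proof -
  obtain h where h: "h holomorphic_on ball 0 1" "\<And>z. z \<in> ball 0 1 \<Longrightarrow> g z = exp (h z)"
    using contractible_imp_holomorphic_log[OF hol convex_imp_contractible] nz
    by (metis convex_ball dist_0_norm mem_ball)
  define t where "t = cmod w"
  have t: "0 \<le> t" "t < 1" using w by (auto simp: t_def)
  have hle: "Re (h z) \<le> 0" if "cmod z < 1" for z
    using le[OF that] h(2)[of z] that by (simp add: norm_exp_eq_Re)
  \<comment> \<open>Shifting by \<open>\<eta>\<close> makes the real part strictly positive, so that
    the Cayley transform \<open>q\<close> centred at \<open>p 0\<close> is defined and maps into the
    open disc; \<open>\<eta>\<close> is sent to 0 at the end.\<close>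
  have key: "- Re (h w) \<le> (1 + t) / (1 - t) * (- Re (h 0)) + (1 + t) / (1 - t) * \<eta>" if \<eta>: "\<eta> > 0" for \<eta>
  proof -
    define p where "p z = of_real \<eta> - h z" for z
    have p: "Re (p z) > 0" if "cmod z < 1" for z
      using hle[OF that] \<eta> by (simp add: p_def)
    define q where "q z = (p z - p 0) / (p z + cnj (p 0))" for z
    have pos: "Re (p z + cnj (p 0)) > 0" if "cmod z < 1" for z
      using p[OF that] p[of 0] by simp
    have nz': "p z + cnj (p 0) \<noteq> 0" if "cmod z < 1" for z
      using pos[OF that] by force
    have holq: "q holomorphic_on ball 0 1"
      unfolding q_def p_def
      by (intro holomorphic_intros h) (use nz' in \<open>auto simp: p_def\<close>)
    have q1: "cmod (q z) < 1" if "cmod z < 1" for z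
    proof -
      have "(cmod (p z - p 0))\<^sup>2 < (cmod (p z + cnj (p 0)))\<^sup>2"
        unfolding cmod_power2 using p[OF that] p[of 0]
        by (simp add: power2_eq_square algebra_simps)
      then have "cmod (p z - p 0) < cmod (p z + cnj (p 0))"
        by (rule power2_less_imp_less) simp
      then show ?thesis
        using nz'[OF that] by (simp add: q_def norm_divide)
    qed
    have "cmod (q w) \<le> t"
      unfolding t_def by (rule Schwarz_Lemma(1)[OF holq]) (use q1 w in \<open>auto simp: q_def\<close>)
    then have "cmod (p w - p 0) \<le> t * cmod (p w + cnj (p 0))"
      using nz'[OF w] by (simp add: q_def norm_divide field_simps)
    then have "(cmod (p w - p 0))\<^sup>2 \<le> t\<^sup>2 * (cmod (p w + cnj (p 0)))\<^sup>2"
      by (metis norm_ge_zero power_mono power_mult_distrib)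
    then have "(Re (p w) - Re (p 0))\<^sup>2 + (Im (p w) - Im (p 0))\<^sup>2
        \<le> t\<^sup>2 * ((Re (p w) + Re (p 0))\<^sup>2 + (Im (p w) - Im (p 0))\<^sup>2)"
      unfolding cmod_power2 by simp
    moreover have "t\<^sup>2 * (Im (p w) - Im (p 0))\<^sup>2 \<le> 1 * (Im (p w) - Im (p 0))\<^sup>2"
      by (rule mult_right_mono) (use t in \<open>auto simp: power_le_one\<close>)
    ultimately have "(Re (p w) - Re (p 0))\<^sup>2 \<le> (t * (Re (p w) + Re (p 0)))\<^sup>2"
      unfolding power_mult_distrib[of t] distrib_left[of "t\<^sup>2"] by linarith
    then have "Re (p w) - Re (p 0) \<le> t * (Re (p w) + Re (p 0))"
      by (rule power2_le_imp_le) (use p[OF w] p[of 0] t in auto)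
    then have "Re (p w) \<le> (1 + t) / (1 - t) * Re (p 0)"
      using t by (simp add: field_simps)
    then have "\<eta> - Re (h w) \<le> (1 + t) / (1 - t) * (\<eta> - Re (h 0))"
      by (simp add: p_def)
    then show ?thesis using \<eta> by (simp add: right_diff_distrib)
  qed
  define K where "K = (1 + t) / (1 - t)"
  have K: "K > 0" using t by (simp add: K_def)
  have "- Re (h w) \<le> K * (- Re (h 0))"
  proof (rule field_le_epsilon)
    fix e :: real assume "e > 0"
    then show "- Re (h w) \<le> K * (- Re (h 0)) + e"
      using key[of "e / K"] K by (simp add: K_def[symmetric])
  qed
  then have "exp (K * Re (h 0)) \<le> exp (Re (h w))"
    by simp
  then show ?thesis
    using h(2)[of 0] h(2)[of w] w
    by (simp add: norm_exp_eq_Re powr_def K_def t_def mult.commute)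
qed

section \<open>Removal of zeros and the estimate in the disc\<close>

text \<open>The local factorisation near \<open>a\<close> and the plain quotient away from
  \<open>a\<close> agree on the overlap and glue to one function on all of \<open>S\<close>.\<close>

lemma holomorphic_factor_zero_global:
  assumes "f holomorphic_on S" "open S" "connected S" "a \<in> S" "\<exists>w\<in>S. f w \<noteq> 0"
  obtains h where "h holomorphic_on S" "h a \<noteq> 0"
    "\<And>z. z \<in> S \<Longrightarrow> f z = (z - a) ^ nat (zorder f a) * h z"
proof -
  define n where "n = nat (zorder f a)"
  define g where "g = zor_poly f a"
  obtain r where r: "r > 0" "cball a r \<subseteq> S" "g holomorphic_on cball a r"
    "\<And>w. w \<in> cball a r \<Longrightarrow> f w = g w * (w - a) ^ n \<and> g w \<noteq> 0"
    using zorder_exist_zero[OF assms] unfolding n_def g_def by blast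
  define h where "h z = (if z = a then g a else f z / (z - a) ^ n)" for z
  have "h holomorphic_on ball a r \<union> (S - {a})"
  proof (rule holomorphic_on_Un)
    have "g holomorphic_on ball a r"
      using r(3) by (rule holomorphic_on_subset) auto
    then show "h holomorphic_on ball a r"
      by (rule holomorphic_transform) (use r(4) in \<open>auto simp: h_def\<close>)
    have "(\<lambda>z. f z / (z - a) ^ n) holomorphic_on S - {a}"
      by (intro holomorphic_intros holomorphic_on_subset[OF assms(1)]) auto
    then show "h holomorphic_on S - {a}"
      by (rule holomorphic_transform) (auto simp: h_def)
  qed (use assms(2) in auto)
  then have "h holomorphic_on S"
    by (rule holomorphic_on_subset) (use r in auto)
  moreover have "h a \<noteq> 0"
    using r(1) r(4)[of a] by (simp add: h_def)
  moreover have "f z = (z - a) ^ n * h z" if "z \<in> S" for z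
    using r(1) r(4)[of a] by (auto simp: h_def)
  ultimately show ?thesis
    using that unfolding n_def by blast
qed

lemma maximum_modulus_ball:
  assumes "f holomorphic_on ball 0 R" "R > 1" "\<And>z. cmod z = 1 \<Longrightarrow> cmod (f z) \<le> B" "cmod w \<le> 1"
  shows "cmod (f w) \<le> B"
proof (rule maximum_modulus_frontier[of f "cball 0 1"])
  show "f holomorphic_on interior (cball 0 1)"
    by (rule holomorphic_on_subset[OF assms(1)]) (use assms(2) in auto)
  show "continuous_on (closure (cball 0 1)) f"
    by (intro holomorphic_on_imp_continuous_on holomorphic_on_subset[OF assms(1)])
      (use assms(2) in auto)
qed (use assms in auto)

text \<open>On the circle \<open>1 = z * cnj z\<close>, so the two factors are conjugate up to a
  unimodular factor.\<close>

lemma blaschke_norm_one: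
  assumes "cmod z = 1"
  shows "cmod (1 - cnj a * z) = cmod (z - a)"
proof -
  have "1 - cnj a * z = z * cnj (z - a)"
    using complex_norm_square[of z] assms by (simp add: algebra_simps)
  then show ?thesis
    using assms by (simp add: norm_mult del: complex_cnj_diff)
qed

text \<open>Zeros of \<open>g\<close> are divided out by Blaschke factors, which does not change the product bound on the
  circle and only increases \<open>\<bar>g 0\<bar>\<close>.\<close>

lemma harnack_quotient:
  assumes "f holomorphic_on ball 0 R" "g holomorphic_on ball 0 R" "R > 1"
    and "\<And>z. cmod z = 1 \<Longrightarrow> cmod (g z) \<le> 1"
    and "\<And>z. cmod z = 1 \<Longrightarrow> cmod (f z * g z) \<le> 1"
    and "g 0 \<noteq> 0" and w: "cmod w < 1"
  shows "cmod (f w) \<le> (1 / cmod (g 0)) powr ((1 + cmod w) / (1 - cmod w))"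
  using assms(2,4,5,6)
proof (induction "card {z \<in> ball 0 1. g z = 0}" arbitrary: g rule: less_induct)
  case (less g)
  show ?case
  proof (cases "\<exists>a\<in>ball 0 1. g a = 0")
    \<comment> \<open>Without zeros the product bound extends inside by the maximum principle, and
      the lower bound for \<open>g w\<close> is the nonvanishing case.\<close>
    case False
    have nz: "g z \<noteq> 0" if "cmod z < 1" for z
      using False that by auto
    have gle: "cmod (g z) \<le> 1" if "cmod z < 1" for z
      by (rule maximum_modulus_ball[OF less.prems(1) assms(3)]) (use less.prems that in auto)
    have "cmod (f w * g w) \<le> 1"
      by (rule maximum_modulus_ball[of "\<lambda>z. f z * g z", OF _ assms(3)])
        (use less.prems w assms in \<open>auto intro!: holomorphic_intros\<close>)
    then have fw: "cmod (f w) \<le> 1 / cmod (g w)"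
      using nz[OF w] by (simp add: norm_mult field_simps)
    have "cmod (g 0) powr ((1 + cmod w) / (1 - cmod w)) \<le> cmod (g w)"
      by (rule harnack_nonvanishing)
        (use nz gle w assms(3) in \<open>auto intro!: holomorphic_on_subset[OF less.prems(1)]\<close>)
    moreover have "cmod (g 0) powr ((1 + cmod w) / (1 - cmod w)) > 0"
      using less.prems by simp
    ultimately have "1 / cmod (g w) \<le> 1 / cmod (g 0) powr ((1 + cmod w) / (1 - cmod w))"
      by (intro divide_left_mono mult_pos_pos) auto
    with fw show ?thesis
      by (simp add: powr_divide)
  next
    case True
    then obtain a where a: "cmod a < 1" "g a = 0" by auto
    have R0: "(0::complex) \<in> ball 0 R" using assms(3) by simp
    obtain h where h: "h holomorphic_on ball 0 R" "h a \<noteq> 0"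
      "\<And>z. z \<in> ball 0 R \<Longrightarrow> g z = (z - a) ^ nat (zorder g a) * h z"
      by (rule holomorphic_factor_zero_global[OF less.prems(1), of a])
        (use a assms(3) R0 less.prems(4) in auto)
    define n where "n = nat (zorder g a)"
    \<comment> \<open>The whole power of \<open>z - a\<close> is exchanged at once, so
      \<open>a\<close> leaves the zero set and the induction on the number of distinct zeros
      proceeds.\<close>
    define k where "k z = h z * (1 - cnj a * z) ^ n" for z
    have a0: "a \<noteq> 0" using a less.prems by auto
    have g_h: "g z = (z - a) ^ n * h z" if "cmod z < R" for z
      using h(3)[of z] that by (simp add: n_def)
    have norm_k: "cmod (k z) = cmod (g z)" if "cmod z = 1" for z
      using g_h[of z] that assms(3) blaschke_norm_one[OF that, of a]
      by (simp add: k_def norm_mult norm_power)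
    have unit: "1 - cnj a * z \<noteq> 0" if "cmod z < 1" for z
    proof
      assume "1 - cnj a * z = 0"
      then have "cmod (cnj a * z) = 1" by (metis eq_iff_diff_eq_0 norm_one)
      moreover have "cmod (cnj a * z) \<le> cmod a * 1"
        unfolding norm_mult complex_mod_cnj by (rule mult_left_mono) (use that in auto)
      ultimately show False using a by simp
    qed
    have sub: "{z \<in> ball 0 1. k z = 0} \<subset> {z \<in> ball 0 1. g z = 0}"
    proof
      show "{z \<in> ball 0 1. k z = 0} \<subseteq> {z \<in> ball 0 1. g z = 0}"
        using g_h unit assms(3) by (auto simp: k_def)
      show "{z \<in> ball 0 1. k z = 0} \<noteq> {z \<in> ball 0 1. g z = 0}"
        using a h(2) unit[of a] by (auto simp: k_def set_eq_iff)
    qed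
    \<comment> \<open>\<open>g\<close> vanishes at \<open>a\<close> but not at 0. The closed unit
      disc is compact in the larger ball, so the zeros being counted are finite in number.\<close>
    have "\<not> g constant_on ball 0 R"
      using a less.prems(4) R0 assms(3) unfolding constant_on_def
      by (metis dist_0_norm less_trans mem_ball)
    then have "finite {z \<in> cball 0 1. g z = 0}"
      by (intro holomorphic_compact_finite_zeros[OF less.prems(1)]) (use assms(3) in auto)
    then have "finite {z \<in> ball 0 1. g z = 0}"
      by (rule finite_subset[rotated]) auto
    then have card: "card {z \<in> ball 0 1. k z = 0} < card {z \<in> ball 0 1. g z = 0}"
      using sub by (rule psubset_card_mono)
    have "cmod (g 0) = cmod a ^ n * cmod (k 0)"
      using g_h[of 0] assms(3) by (simp add: k_def norm_mult norm_power)
    moreover have "cmod a ^ n * cmod (k 0) \<le> 1 * cmod (k 0)"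
      by (intro mult_right_mono power_le_one) (use a in auto)
    ultimately have g_k: "cmod (g 0) \<le> cmod (k 0)" by simp
    have "cmod (f w) \<le> (1 / cmod (k 0)) powr ((1 + cmod w) / (1 - cmod w))"
    proof (rule less.hyps[OF card])
      show "k holomorphic_on ball 0 R"
        unfolding k_def by (intro holomorphic_intros h)
    qed (use less.prems norm_k g_k in \<open>auto simp: norm_mult\<close>)
    also have "\<dots> \<le> (1 / cmod (g 0)) powr ((1 + cmod w) / (1 - cmod w))"
    proof (intro powr_mono2 divide_left_mono mult_pos_pos)
      show "0 < cmod (g 0)" using less.prems by simp
      then show "0 < cmod (k 0)" using g_k by linarith
    qed (use g_k less.prems w in auto)
    finally show ?thesis .
  qed
qed

lemma harnack_quotient_disc:
  assumes "f holomorphic_on UNIV" "g holomorphic_on UNIV" "r > 0"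
    and "\<And>z. cmod (z - z0) = r \<Longrightarrow> cmod (g z) \<le> 1"
    and "\<And>z. cmod (z - z0) = r \<Longrightarrow> cmod (f z * g z) \<le> 1"
    and "g z0 \<noteq> 0" and "cmod (w - z0) < r"
  shows "cmod (f w) \<le> (1 / cmod (g z0)) powr ((r + cmod (w - z0)) / (r - cmod (w - z0)))"
proof -
  define T where "T = (\<lambda>\<zeta>. z0 + of_real r * \<zeta>)"
  have hT: "h \<circ> T holomorphic_on ball 0 2" if "h holomorphic_on UNIV" for h :: "complex \<Rightarrow> complex"
    by (rule holomorphic_on_compose_gen[OF _ that]) (auto simp: T_def intro!: holomorphic_intros)
  have "cmod ((f \<circ> T) ((w - z0) / of_real r)) \<le> (1 / cmod ((g \<circ> T) 0)) powr
     ((1 + cmod ((w - z0) / of_real r)) / (1 - cmod ((w - z0) / of_real r)))"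
    by (rule harnack_quotient[OF hT hT])
      (use assms in \<open>auto simp: T_def norm_mult norm_divide\<close>)
  moreover have "(1 + cmod ((w - z0) / of_real r)) / (1 - cmod ((w - z0) / of_real r))
      = (r + cmod (w - z0)) / (r - cmod (w - z0))"
    using assms by (simp add: norm_divide field_simps)
  ultimately show ?thesis
    using assms(3) by (simp add: T_def)
qed

text \<open>The half-plane is mapped to the disc by \<open>\<zeta> = (z - \<i> y) / (z + \<i> y)\<close>; applying the disc estimate on
  the circle of radius \<open>(1 + \<bar>\<zeta>\<bar>) / 2\<close> instead of the unit circle costs the factor 2 in the exponent.\<close>

lemma harnack_quotient_half_plane:
  assumes "f holomorphic_on {z. Im z > 0}" "g holomorphic_on {z. Im z > 0}"
    and gle: "\<And>z. Im z > 0 \<Longrightarrow> cmod (g z) \<le> 1"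
    and fgle: "\<And>z. Im z > 0 \<Longrightarrow> cmod (f z * g z) \<le> 1"
    and y: "y > 0" and g0: "g (\<i> * of_real y) \<noteq> 0" and w: "Im w > 0"
  shows "cmod (f w) \<le> (1 / cmod (g (\<i> * of_real y))) powr (2 * (cmod (w + \<i> * of_real y))\<^sup>2 / (y * Im w))"
proof -
  define \<zeta> where "\<zeta> = (w - \<i> * of_real y) / (w + \<i> * of_real y)"
  define t where "t = cmod \<zeta>"
  have wy: "w + \<i> * of_real y \<noteq> 0"
    using y w by (auto simp: complex_eq_iff)
  have wy2: "(cmod (w + \<i> * of_real y))\<^sup>2 = (cmod (w - \<i> * of_real y))\<^sup>2 + 4 * (y * Im w)"
    unfolding cmod_power2 by (simp add: power2_eq_square algebra_simps)
  have t2: "t\<^sup>2 = 1 - 4 * (y * Im w) / (cmod (w + \<i> * of_real y))\<^sup>2"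
  proof -
    have "(cmod (w - \<i> * of_real y))\<^sup>2 = (cmod (w + \<i> * of_real y))\<^sup>2 - 4 * (y * Im w)"
      using wy2 by simp
    then show ?thesis
      unfolding t_def \<zeta>_def norm_divide power_divide
      by (simp add: diff_divide_distrib wy del: diff_divide_eq_iff)
  qed
  have "t\<^sup>2 < 1\<^sup>2" using t2 wy y w by simp
  then have t1: "t < 1" by (rule power2_less_imp_less) simp
  have t0: "t \<ge> 0" by (simp add: t_def)
  \<comment> \<open>\<open>f\<close> and \<open>g\<close> are given on the open half-plane only. A
    radius strictly between \<open>t\<close> and 1 keeps the image under \<open>T\<close> of a
    neighbourhood of the closed disc inside it.\<close>
  define \<rho> where "\<rho> = (1 + t) / 2"
  have \<rho>: "0 < \<rho>" "\<rho> < 1" "t < \<rho>" using t0 t1 by (auto simp: \<rho>_def)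
  define T where "T = (\<lambda>z. \<i> * of_real y * (1 + of_real \<rho> * z) / (1 - of_real \<rho> * z))"
  have ne: "1 - of_real \<rho> * z \<noteq> 0" if "cmod z < 1 / \<rho>" for z :: complex
  proof
    assume "1 - of_real \<rho> * z = 0"
    then have "cmod (of_real \<rho> * z) = 1" by (metis eq_iff_diff_eq_0 norm_one)
    then show False using that \<rho> by (simp add: norm_mult field_simps)
  qed
  have ImT: "Im (T z) > 0" if "cmod z < 1 / \<rho>" for z
  proof -
    have "\<rho> * cmod z < 1" using that \<rho> by (simp add: field_simps)
    then have "cmod (of_real \<rho> * z) < 1" using \<rho> by (simp add: norm_mult)
    then have "(cmod (of_real \<rho> * z))\<^sup>2 < 1"
      by (simp add: power_less_one_iff abs_square_less_1)
    moreover have "Re ((1 + u) / (1 - u)) = (1 - (cmod u)\<^sup>2) / (cmod (1 - u))\<^sup>2" for u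
      unfolding cmod_power2 by (simp add: Re_divide power2_eq_square algebra_simps)
    ultimately have "Re ((1 + of_real \<rho> * z) / (1 - of_real \<rho> * z)) > 0"
      using ne[OF that] by simp
    moreover have "T z = \<i> * of_real y * ((1 + of_real \<rho> * z) / (1 - of_real \<rho> * z))"
      by (simp add: T_def)
    ultimately show ?thesis using y by (simp del: times_divide_eq_right)
  qed
  have hT: "h \<circ> T holomorphic_on ball 0 (1 / \<rho>)" if "h holomorphic_on {z. Im z > 0}" for h
    by (rule holomorphic_on_compose_gen[OF _ that])
      (use ne ImT in \<open>auto simp: T_def intro!: holomorphic_intros\<close>)
  have in_ball: "cmod z < 1 / \<rho>" if "cmod z = 1" for z :: complex
    using that \<rho> by simp
  have Tw: "T (\<zeta> / of_real \<rho>) = w"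
  proof -
    have "T (\<zeta> / of_real \<rho>) = \<i> * of_real y * (1 + \<zeta>) / (1 - \<zeta>)"
      using \<rho> by (simp add: T_def)
    also have "1 - \<zeta> = 2 * (\<i> * of_real y) / (w + \<i> * of_real y)"
      using wy by (simp add: \<zeta>_def field_simps)
    also have "1 + \<zeta> = 2 * w / (w + \<i> * of_real y)"
      using wy by (simp add: \<zeta>_def field_simps)
    finally show ?thesis
      using wy y by simp
  qed
  have s: "cmod (\<zeta> / of_real \<rho>) = t / \<rho>" using \<rho> by (simp add: norm_divide t_def)
  have g1: "cmod (g (\<i> * of_real y)) \<le> 1" using gle y by simp
  have "cmod ((f \<circ> T) (\<zeta> / of_real \<rho>)) \<le> (1 / cmod ((g \<circ> T) 0)) powr
     ((1 + cmod (\<zeta> / of_real \<rho>)) / (1 - cmod (\<zeta> / of_real \<rho>)))"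
  proof (rule harnack_quotient[OF hT[OF assms(1)] hT[OF assms(2)]])
    show "1 < 1 / \<rho>" using \<rho> by simp
    show "cmod ((g \<circ> T) z) \<le> 1" if "cmod z = 1" for z
      using gle ImT[OF in_ball[OF that]] by simp
    show "cmod ((f \<circ> T) z * (g \<circ> T) z) \<le> 1" if "cmod z = 1" for z
      using fgle ImT[OF in_ball[OF that]] by simp
    show "(g \<circ> T) 0 \<noteq> 0" using g0 by (simp add: T_def)
    show "cmod (\<zeta> / of_real \<rho>) < 1" using s \<rho> by simp
  qed
  then have "cmod (f w) \<le> (1 / cmod (g (\<i> * of_real y))) powr ((1 + t / \<rho>) / (1 - t / \<rho>))"
    unfolding s by (simp add: Tw) (simp add: T_def)
  also have "\<dots> \<le> (1 / cmod (g (\<i> * of_real y))) powr (2 * (cmod (w + \<i> * of_real y))\<^sup>2 / (y * Im w))"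
  proof (rule powr_mono)
    \<comment> \<open>Extending the fraction by \<open>1 + t\<close> produces
      \<open>1 - t\<^sup>2\<close>, which \<open>t2\<close> expresses through \<open>y\<close> and
      \<open>Im w\<close>.\<close>
    have "(1 + t / \<rho>) / (1 - t / \<rho>) = (1 + 3 * t) / (1 - t)"
    proof -
      have "1 + t / \<rho> = (1 + 3 * t) / (1 + t)" "1 - t / \<rho> = (1 - t) / (1 + t)"
        using t0 by (simp_all add: \<rho>_def field_simps)
      then show ?thesis using t0 by simp
    qed
    also have "\<dots> \<le> (2 * (1 + t)) / (1 - t)"
      using t0 t1 by (intro divide_right_mono) auto
    also have "\<dots> = (2 * (1 + t) * (1 + t)) / ((1 - t) * (1 + t))"
      using t0 by simp
    also have "\<dots> \<le> 8 / (1 - t\<^sup>2)"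
    proof -
      have "(1 + t) * (1 + t) \<le> 2 * 2" by (rule mult_mono) (use t0 t1 in auto)
      then have "2 * (1 + t) * (1 + t) \<le> 8" by (simp add: algebra_simps)
      moreover have "(1 - t) * (1 + t) = 1 - t\<^sup>2" by (simp add: power2_eq_square algebra_simps)
      moreover have "1 - t\<^sup>2 > 0" using \<open>t\<^sup>2 < 1\<^sup>2\<close> by simp
      ultimately show ?thesis
        by (metis (no_types, lifting) divide_right_mono less_imp_le)
    qed
    also have "\<dots> = 2 * (cmod (w + \<i> * of_real y))\<^sup>2 / (y * Im w)"
      unfolding t2 using wy y w by simp
    finally show "(1 + t / \<rho>) / (1 - t / \<rho>) \<le> 2 * (cmod (w + \<i> * of_real y))\<^sup>2 / (y * Im w)" .
    show "1 \<le> 1 / cmod (g (\<i> * of_real y))"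
      using g0 g1 by simp
  qed
  finally show ?thesis .
qed

section \<open>Phragmen-Lindelof principles\<close>

text \<open>The power 3/2 lies between order 1, which has to be damped, and order 2, which is
  critical for a right angle. On the sector its argument is at most 3 pi / 8, whose cosine exceeds
  1/5.\<close>

lemma Re_csqrt_cubed_sector:
  assumes "\<bar>Im z\<bar> \<le> Re z"
  shows "Re (csqrt z ^ 3) \<ge> cmod z * sqrt (cmod z) / 5"
proof (cases "z = 0")
  case False
  define a b where "a = Re (csqrt z)" and "b = Im (csqrt z)"
  have z: "Re z = a\<^sup>2 - b\<^sup>2" "Im z = 2 * a * b"
    using Re_power2[of "csqrt z"] Im_power2[of "csqrt z"] by (auto simp: a_def b_def)
  have a0: "a \<ge> 0" using csqrt_principal[of z] by (auto simp: a_def)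
  have "Re z > 0" using assms False by (auto simp: complex_eq_iff less_le)
  then have ab: "a\<^sup>2 - b\<^sup>2 > 0" using z by simp
  then have apos: "a > 0" using a0 by (cases "a = 0") auto
  have "(2 * a * b)\<^sup>2 \<le> (a\<^sup>2 - b\<^sup>2)\<^sup>2"
    using assms ab unfolding z by (metis abs_le_square_iff abs_of_pos)
  then have "(a\<^sup>2 - 5 * b\<^sup>2) * (a\<^sup>2 - b\<^sup>2) \<ge> 4 * (b\<^sup>2)\<^sup>2"
    by (simp add: power2_eq_square algebra_simps)
  moreover have "4 * (b\<^sup>2)\<^sup>2 \<ge> 0" by simp
  ultimately have "(a\<^sup>2 - 5 * b\<^sup>2) * (a\<^sup>2 - b\<^sup>2) \<ge> 0" by linarith
  \<comment> \<open>The argument of the root is at most pi / 8, and the square of tan (pi / 8) is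
    below 1/5.\<close>
  then have b5: "5 * b\<^sup>2 \<le> a\<^sup>2" using ab by (simp add: zero_le_mult_iff)
  define s where "s = cmod (csqrt z)"
  have s2: "s\<^sup>2 = a\<^sup>2 + b\<^sup>2" unfolding s_def a_def b_def by (rule cmod_power2)
  have "25 * b\<^sup>2 \<le> 11 * a\<^sup>2" using b5 zero_le_power2[of a] by linarith
  then have "s\<^sup>2 \<le> (6 / 5 * a)\<^sup>2"
    unfolding s2 by (simp add: power2_eq_square)
  then have "s \<le> 6 / 5 * a" by (rule power2_le_imp_le) (use apos in simp)
  then have sa: "5 / 6 * s \<le> a" by simp
  have "cmod z = s\<^sup>2" by (metis norm_power power2_csqrt s_def)
  moreover have "s \<ge> 0" by (simp add: s_def)
  ultimately have "cmod z * sqrt (cmod z) / 5 = s ^ 3 / 5"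
    by (simp add: power2_eq_square power3_eq_cube)
  also have "\<dots> \<le> 2 / 5 * (5 / 6 * s) ^ 3"
    using \<open>s \<ge> 0\<close> by (simp add: power_mult_distrib power3_eq_cube)
  also have "\<dots> \<le> 2 / 5 * a ^ 3"
    using sa \<open>s \<ge> 0\<close> by (intro mult_left_mono power_mono) auto
  also have "\<dots> \<le> a * (a\<^sup>2 - 3 * b\<^sup>2)"
  proof -
    have "a * (2 / 5 * a\<^sup>2) \<le> a * (a\<^sup>2 - 3 * b\<^sup>2)"
      using b5 apos by (intro mult_left_mono) auto
    then show ?thesis by (simp add: power2_eq_square power3_eq_cube)
  qed
  also have "\<dots> = Re (csqrt z ^ 3)"
    by (simp add: a_def b_def power2_eq_square power3_eq_cube algebra_simps)
  finally show ?thesis .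
qed auto

text \<open>The factor \<open>exp (- \<epsilon> * csqrt w ^ 3)\<close> defeats exponential growth on
  large arcs; the maximum principle on the truncated sector then applies, and
  \<open>\<epsilon>\<close> tends to 0.\<close>

lemma phragmen_lindelof_sector:
  assumes hol: "f holomorphic_on S" "open S" "{z. \<bar>Im z\<bar> \<le> Re z} \<subseteq> S"
    and growth: "\<And>z. \<bar>Im z\<bar> \<le> Re z \<Longrightarrow> cmod (f z) \<le> A * exp (B * cmod z)"
    and bnd: "\<And>z. \<bar>Im z\<bar> = Re z \<Longrightarrow> cmod (f z) \<le> M"
    and M: "M > 0" and z: "\<bar>Im z\<bar> \<le> Re z"
  shows "cmod (f z) \<le> M"
proof -
  have key: "cmod (f z) \<le> M * exp (\<epsilon> * cmod (csqrt z ^ 3))" if \<epsilon>: "\<epsilon> > 0" for \<epsilon>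
  proof -
    define F where "F w = f w * exp (- of_real \<epsilon> * csqrt w ^ 3)" for w
    have Fle: "cmod (F w) \<le> cmod (f w) * exp (- \<epsilon> * (cmod w * sqrt (cmod w) / 5))"
      if "\<bar>Im w\<bar> \<le> Re w" for w
    proof -
      have "cmod (F w) = cmod (f w) * exp (- \<epsilon> * Re (csqrt w ^ 3))"
        by (simp add: F_def norm_mult norm_exp_eq_Re)
      also have "\<dots> \<le> cmod (f w) * exp (- \<epsilon> * (cmod w * sqrt (cmod w) / 5))"
        using Re_csqrt_cubed_sector[OF that] \<epsilon> by (intro mult_left_mono) auto
      finally show ?thesis .
    qed
    have lim: "((\<lambda>R. A * exp (B * R) * exp (- \<epsilon> * (R * sqrt R / 5))) \<longlongrightarrow> 0) at_top"
    proof -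
      have "filterlim (\<lambda>R::real. sqrt R) at_top at_top"
        by (rule sqrt_at_top)
      then have "eventually (\<lambda>R. sqrt R \<ge> 5 * (B + 1) / \<epsilon>) at_top"
        by (simp add: filterlim_at_top)
      then have ev: "eventually (\<lambda>R. norm (A * exp (B * R) * exp (- \<epsilon> * (R * sqrt R / 5))) \<le> \<bar>A\<bar> * exp (- R)) at_top"
        using eventually_ge_at_top[of 0]
      proof eventually_elim
        case (elim R)
        then have "5 * (B + 1) \<le> \<epsilon> * sqrt R" using \<epsilon> by (simp add: field_simps)
        then have "R * (5 * (B + 1)) \<le> R * (\<epsilon> * sqrt R)" using elim by (intro mult_left_mono)
        then have "B * R - \<epsilon> * (R * sqrt R / 5) \<le> - R" by (simp add: algebra_simps)
        then have "exp (B * R + - \<epsilon> * (R * sqrt R / 5)) \<le> exp (- R)" by simp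
        then show ?case
          unfolding exp_add by (simp add: abs_mult mult.assoc mult_left_mono)
      qed
      have "((\<lambda>R::real. \<bar>A\<bar> * exp (- R)) \<longlongrightarrow> \<bar>A\<bar> * 0) at_top"
        by (intro tendsto_intros filterlim_compose[OF exp_at_bot] filterlim_uminus_at_bot_at_top)
      then show ?thesis
        by (intro Lim_null_comparison[OF ev]) simp
    qed
    then have "eventually (\<lambda>R. A * exp (B * R) * exp (- \<epsilon> * (R * sqrt R / 5)) < M) at_top"
      using M by (rule order_tendstoD)
    then have "eventually (\<lambda>R. A * exp (B * R) * exp (- \<epsilon> * (R * sqrt R / 5)) < M \<and> R > cmod z) at_top"
      using eventually_gt_at_top[of "cmod z"] by eventually_elim auto
    then obtain R where R: "A * exp (B * R) * exp (- \<epsilon> * (R * sqrt R / 5)) < M" "R > cmod z"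
      using eventually_happens'[OF trivial_limit_at_top_linorder] by blast
    define D where "D = {w. \<bar>Im w\<bar> \<le> Re w} \<inter> cball 0 R"
    have clD: "closed D" unfolding D_def
      by (intro closed_Int closed_cball closed_Collect_le continuous_intros)
    have holF: "F holomorphic_on interior D"
    proof -
      have "interior D \<subseteq> {w. \<bar>Im w\<bar> \<le> Re w} - {0}"
      proof
        fix w assume w: "w \<in> interior D"
        \<comment> \<open>Every ball around the apex contains negative reals, which lie outside the
          sector; hence the interior avoids the branch cut of \<open>csqrt\<close>.\<close>
        have "w \<noteq> 0"
        proof
          assume "w = 0"
          then obtain e where "e > 0" "ball 0 e \<subseteq> D"
            using w by (metis mem_interior)
          moreover have "of_real (- e / 2) \<in> ball (0::complex) e" using \<open>e > 0\<close> by simp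
          ultimately have "of_real (- e / 2) \<in> D" by blast
          then show False using \<open>e > 0\<close> by (simp add: D_def)
        qed
        then show "w \<in> {w. \<bar>Im w\<bar> \<le> Re w} - {0}"
          using interior_subset w by (auto simp: D_def)
      qed
      then have sub: "interior D \<subseteq> S" and "w \<in> interior D \<Longrightarrow> w \<notin> \<real>\<^sub>\<le>\<^sub>0" for w
        using hol(3) by (auto simp: complex_nonpos_Reals_iff complex_eq_iff)
      then show ?thesis
        unfolding F_def by (intro holomorphic_intros holomorphic_on_subset[OF hol(1)]) auto
    qed
    have "cmod (F z) \<le> M"
    proof (rule maximum_modulus_frontier[OF holF])
      \<comment> \<open>The apex lies on the branch cut, so continuity there comes from the modulus
        of the root instead.\<close>
      have "continuous (at w within D) csqrt" if "w \<in> D" for w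
      proof (cases "w = 0")
        case True
        have "((\<lambda>w. sqrt (cmod w)) \<longlongrightarrow> sqrt (cmod 0)) (at 0 within D)"
          by (intro tendsto_intros)
        moreover have "cmod (csqrt w) = sqrt (cmod w)" for w
          by (metis norm_ge_zero norm_power power2_csqrt real_sqrt_unique)
        ultimately have "((\<lambda>w. cmod (csqrt w)) \<longlongrightarrow> 0) (at 0 within D)"
          by simp
        then show ?thesis
          unfolding True continuous_within by (simp add: tendsto_norm_zero_cancel)
      next
        case False
        then show ?thesis using that
          by (intro continuous_within_csqrt)
            (auto simp: D_def complex_nonpos_Reals_iff complex_eq_iff)
      qed
      then have "continuous_on D csqrt"
        by (simp add: continuous_on_eq_continuous_within)
      moreover have "D \<subseteq> S" using hol(3) by (auto simp: D_def)
      then have "continuous_on D f"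
        by (rule continuous_on_subset[OF holomorphic_on_imp_continuous_on[OF hol(1)]])
      ultimately show "continuous_on (closure D) F"
        unfolding closure_closed[OF clD] F_def by (intro continuous_intros)
      show "bounded D" unfolding D_def by (rule bounded_subset[OF bounded_cball]) auto
      show "z \<in> D" using z R by (simp add: D_def)
      fix w assume w: "w \<in> frontier D"
      then have wD: "\<bar>Im w\<bar> \<le> Re w" "cmod w \<le> R"
        using frontier_subset_closed[OF clD] by (auto simp: D_def)
      show "cmod (F w) \<le> M"
      proof (cases "cmod w = R")
        case True
        have "cmod (F w) \<le> (A * exp (B * R)) * exp (- \<epsilon> * (R * sqrt R / 5))"
          by (rule order.trans[OF Fle[OF wD(1)]]) (use growth[OF wD(1)] True in auto)
        then show ?thesis using R(1) by linarith
      next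
        case False
        have "\<bar>Im w\<bar> = Re w"
        proof (rule ccontr)
          assume "\<bar>Im w\<bar> \<noteq> Re w"
          define U where "U = {w. \<bar>Im w\<bar> < Re w} \<inter> ball 0 R"
          have "open U" unfolding U_def
            by (intro open_Int open_ball open_Collect_less continuous_intros)
          moreover have "U \<subseteq> D" by (auto simp: U_def D_def)
          ultimately have "U \<subseteq> interior D" by (simp add: interior_maximal)
          moreover have "w \<in> U" using \<open>\<bar>Im w\<bar> \<noteq> Re w\<close> False wD by (auto simp: U_def)
          ultimately show False using w by (auto simp: frontier_def)
        qed
        have "cmod (f w) * exp (- \<epsilon> * (cmod w * sqrt (cmod w) / 5)) \<le> cmod (f w) * 1"
          by (rule mult_left_mono) (use \<epsilon> in auto)
        then have "cmod (F w) \<le> cmod (f w)" using Fle[OF wD(1)] by simp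
        then show ?thesis using bnd[OF \<open>\<bar>Im w\<bar> = Re w\<close>] by simp
      qed
    qed
    then have "cmod (f z) * exp (- \<epsilon> * Re (csqrt z ^ 3)) \<le> M"
      by (simp add: F_def norm_mult norm_exp_eq_Re)
    then have "cmod (f z) \<le> M * exp (\<epsilon> * Re (csqrt z ^ 3))"
      by (simp add: exp_minus field_simps)
    also have "\<dots> \<le> M * exp (\<epsilon> * cmod (csqrt z ^ 3))"
      using M \<epsilon> complex_Re_le_cmod[of "csqrt z ^ 3"] by (intro mult_left_mono) (auto simp: mult_left_mono)
    finally show ?thesis .
  qed
  have "((\<lambda>\<epsilon>. M * exp (\<epsilon> * cmod (csqrt z ^ 3))) \<longlongrightarrow> M * exp (0 * cmod (csqrt z ^ 3))) (at_right 0)"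
    by (intro tendsto_intros)
  then show ?thesis
    by (intro tendsto_lowerbound[OF _ _ trivial_limit_at_right_real])
      (auto simp: eventually_at_right_less intro!: eventually_mono[OF eventually_at_right_less] key)
qed

text \<open>Order 1 is critical for a half-plane, so exponential growth alone is not enough. The
  bound on the imaginary axis makes each quadrant a sector of right angle and yields boundedness by
  the larger of \<open>M\<close> and \<open>C\<close>; a second argument for bounded functions then
  removes \<open>C\<close>.\<close>

lemma phragmen_lindelof_half_plane:
  assumes hol: "f holomorphic_on S" "open S" "{z. Im z \<ge> 0} \<subseteq> S"
    and growth: "\<And>z. Im z \<ge> 0 \<Longrightarrow> cmod (f z) \<le> A * exp (B * cmod z)"
    and real: "\<And>x. cmod (f (of_real x)) \<le> M"
    and imag: "\<And>y. y \<ge> 0 \<Longrightarrow> cmod (f (\<i> * of_real y)) \<le> C"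
    and M: "M > 0" and z: "Im z \<ge> 0"
  shows "cmod (f z) \<le> M"
proof -
  define C' where "C' = max M C"
  define \<kappa> where "\<kappa> = 1 / sqrt 2"
  have \<kappa>: "\<kappa> > 0" "2 * \<kappa>\<^sup>2 = 1" by (auto simp: \<kappa>_def power_divide)
  have quadrant: "cmod (f z) \<le> C'" if z: "Im z \<ge> 0" for z
  proof -
    define \<sigma> :: real where "\<sigma> = (if Re z \<ge> 0 then 1 else - 1)"
    define e where "e = of_real \<kappa> * (of_real \<sigma> + \<i>)"
      \<comment> \<open>The rotation by \<open>e\<close> maps the sector onto the first or the second quadrant.\<close>
    have \<sigma>: "\<sigma> = 1 \<or> \<sigma> = -1" by (auto simp: \<sigma>_def)
    have ne: "cmod e = 1"
    proof -
      have "(cmod e)\<^sup>2 = 1" using \<sigma> \<kappa>(2) unfolding cmod_power2 by (auto simp: e_def power_mult_distrib)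
      then show ?thesis by (metis abs_norm_cancel power2_eq_1_iff abs_1 abs_minus_cancel)
    qed
    have ReT: "Re (e * w) = \<kappa> * (\<sigma> * Re w - Im w)" and ImT: "Im (e * w) = \<kappa> * (Re w + \<sigma> * Im w)" for w
      by (auto simp: e_def algebra_simps)
    have up: "Im (e * w) \<ge> 0" if "\<bar>Im w\<bar> \<le> Re w" for w
      unfolding ImT using that \<sigma> \<kappa> by auto
    have e0: "e \<noteq> 0" using ne by auto
    have "cmod ((f \<circ> (\<lambda>w. e * w)) (z / e)) \<le> C'"
    proof (rule phragmen_lindelof_sector[of "f \<circ> (\<lambda>w. e * w)" "(\<lambda>w. e * w) -` S" A B])
      show "open ((\<lambda>w. e * w) -` S)"
        by (intro open_vimage hol continuous_intros)
      show "f \<circ> (\<lambda>w. e * w) holomorphic_on (\<lambda>w. e * w) -` S"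
        by (rule holomorphic_on_compose_gen[OF _ hol(1)]) (auto intro!: holomorphic_intros)
      show "{z. \<bar>Im z\<bar> \<le> Re z} \<subseteq> (\<lambda>w. e * w) -` S"
        using up hol(3) by (auto simp del: times_complex.sel)
      show "cmod ((f \<circ> (\<lambda>w. e * w)) w) \<le> A * exp (B * cmod w)" if "\<bar>Im w\<bar> \<le> Re w" for w
        using growth[OF up[OF that]] ne by (simp add: norm_mult)
      show "cmod ((f \<circ> (\<lambda>w. e * w)) w) \<le> C'" if "\<bar>Im w\<bar> = Re w" for w
      proof (cases "Re (e * w) = 0")
        case True
        then have "e * w = \<i> * of_real (Im (e * w))" by (simp add: complex_eq_iff)
        then show ?thesis using imag[OF up[of w]] that by (auto simp: C'_def)
      next
        case False
        then have "Im (e * w) = 0" using that \<sigma> \<kappa> unfolding ReT ImT by (auto simp: abs_if split: if_splits)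
        then have "e * w = of_real (Re (e * w))" by (simp add: complex_eq_iff)
        then show ?thesis using real[of "Re (e * w)"] by (auto simp: C'_def)
      qed
      show "C' > 0" using M by (simp add: C'_def)
      have "z / e = z * cnj e"
        using complex_norm_square[of e] ne e0 by (simp add: field_simps)
      then have "Re (z / e) = \<kappa> * (\<sigma> * Re z + Im z)" "Im (z / e) = \<kappa> * (\<sigma> * Im z - Re z)"
        by (simp_all only:) (auto simp: e_def algebra_simps)
      then show "\<bar>Im (z / e)\<bar> \<le> Re (z / e)"
        using z \<kappa> by (auto simp: \<sigma>_def abs_mult)
    qed
    then show ?thesis using e0 by simp
  qed
  have C': "C' > 0" using M by (simp add: C'_def)
  have key: "cmod (f z) \<le> M * cmod (1 - \<i> * of_real \<epsilon> * z)" if \<epsilon>: "\<epsilon> > 0" for \<epsilon>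
  proof -
    \<comment> \<open>The denominator has modulus at least 1 in the upper half-plane and grows
      linearly, so a bounded numerator becomes small on large arcs.\<close>
    define F where "F w = f w / (1 - \<i> * of_real \<epsilon> * w)" for w
    have den: "cmod (1 - \<i> * of_real \<epsilon> * w) \<ge> 1" "cmod (1 - \<i> * of_real \<epsilon> * w) \<ge> \<epsilon> * cmod w" 
      "1 - \<i> * of_real \<epsilon> * w \<noteq> 0" if "Im w \<ge> 0" for w
    proof -
      have "Re (1 - \<i> * of_real \<epsilon> * w) = 1 + \<epsilon> * Im w" by simp
      then have "Re (1 - \<i> * of_real \<epsilon> * w) \<ge> 1" using that \<epsilon> by simp
      then show 1: "cmod (1 - \<i> * of_real \<epsilon> * w) \<ge> 1" using complex_Re_le_cmod order.trans by blast
      then show "1 - \<i> * of_real \<epsilon> * w \<noteq> 0" by auto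
      have "(\<epsilon> * cmod w)\<^sup>2 \<le> (cmod (1 - \<i> * of_real \<epsilon> * w))\<^sup>2"
        unfolding power_mult_distrib cmod_power2 using that \<epsilon>
        by (simp add: power2_eq_square algebra_simps)
      then show "cmod (1 - \<i> * of_real \<epsilon> * w) \<ge> \<epsilon> * cmod w"
        by (rule power2_le_imp_le) simp
    qed
    define R where "R = max (cmod z) (C' / (\<epsilon> * M)) + 1"
    have R: "R > cmod z" "R > C' / (\<epsilon> * M)" by (auto simp: R_def)
    define D where "D = {w. Im w \<ge> 0} \<inter> cball 0 R"
    have clD: "closed D" unfolding D_def
      by (intro closed_Int closed_cball closed_Collect_le continuous_intros)
    have D: "D \<subseteq> S" using hol(3) by (auto simp: D_def)
    have denD: "1 - \<i> * of_real \<epsilon> * w \<noteq> 0" if "w \<in> D" for w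
      using den(3) that by (simp add: D_def)
    have "cmod (F z) \<le> M"
    proof (rule maximum_modulus_frontier[of F D])
      have "interior D \<subseteq> D" by (rule interior_subset)
      then show "F holomorphic_on interior D"
        unfolding F_def using D denD
        by (intro holomorphic_intros holomorphic_on_subset[OF hol(1)]) auto
      show "continuous_on (closure D) F"
        unfolding closure_closed[OF clD] F_def
        by (intro continuous_intros continuous_on_subset[OF holomorphic_on_imp_continuous_on[OF hol(1)]])
          (use D denD in auto)
      show "bounded D" unfolding D_def by (rule bounded_subset[OF bounded_cball]) auto
      show "z \<in> D" using z R by (simp add: D_def)
      fix w assume w: "w \<in> frontier D"
      then have wD: "Im w \<ge> 0" "cmod w \<le> R"
        using frontier_subset_closed[OF clD] by (auto simp: D_def)
      show "cmod (F w) \<le> M"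
      proof (cases "cmod w = R")
        case True
        have "C' < R * (\<epsilon> * M)" using R(2) \<epsilon> M by (simp add: field_simps)
        moreover have "R * (\<epsilon> * M) \<le> M * cmod (1 - \<i> * of_real \<epsilon> * w)"
          using mult_left_mono[OF den(2)[OF wD(1)], of M] M True by (simp add: mult_ac)
        ultimately have "cmod (f w) \<le> M * cmod (1 - \<i> * of_real \<epsilon> * w)"
          using quadrant[OF wD(1)] by linarith
        then show ?thesis using den(1)[OF wD(1)] M
          by (simp add: F_def norm_divide divide_le_eq)
      next
        case False
        have "Im w = 0"
        proof (rule ccontr)
          assume "Im w \<noteq> 0"
          define U where "U = {w. 0 < Im w} \<inter> ball 0 R"
          have "open U" unfolding U_def
            by (intro open_Int open_ball open_Collect_less continuous_intros)
          moreover have "U \<subseteq> D" by (auto simp: U_def D_def)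
          ultimately have "U \<subseteq> interior D" by (simp add: interior_maximal)
          moreover have "w \<in> U" using \<open>Im w \<noteq> 0\<close> False wD by (auto simp: U_def)
          ultimately show False using w by (auto simp: frontier_def)
        qed
        then have "cmod (f w) \<le> M" using real[of "Re w"] by (simp add: complex_is_Real_iff)
        also have "\<dots> \<le> M * cmod (1 - \<i> * of_real \<epsilon> * w)"
          using den(1)[OF wD(1)] M by simp
        finally show ?thesis using den(1)[OF wD(1)] M
          by (simp add: F_def norm_divide divide_le_eq)
      qed
    qed
    then show ?thesis using den(1)[OF z] den(3)[OF z] by (simp add: F_def norm_divide divide_le_eq)
  qed
  have "((\<lambda>\<epsilon>. M * cmod (1 - \<i> * of_real \<epsilon> * z)) \<longlongrightarrow> M * cmod (1 - \<i> * of_real 0 * z)) (at_right 0)"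
    by (intro tendsto_intros)
  then show ?thesis
    by (intro tendsto_lowerbound[OF _ _ trivial_limit_at_right_real])
      (auto intro!: eventually_mono[OF eventually_at_right_less] key)
qed

section \<open>The weight and its analytic majorant\<close>

locale weight_space =
  fixes \<omega> :: "real \<Rightarrow> real" and c r :: "nat \<Rightarrow> real"
  assumes weight: "admissible_weight \<omega>"
    and inc_c: "incseq c" and c_pos: "\<And>k. 0 < c k"
    and inc_r: "incseq r" and r_pos: "\<And>k. 0 < r k" and r_less: "\<And>k. r k < 1"
    and r_lim: "r \<longlonglongrightarrow> 1"
begin

section \<open>Elementary consequences of the conditions on the weight\<close>

lemma weight_nonneg: "x \<ge> 0 \<Longrightarrow> \<omega> x \<ge> 0"
  using weight by (simp add: admissible_weight_def)

lemma weight_mono: "0 \<le> x \<Longrightarrow> x \<le> y \<Longrightarrow> \<omega> x \<le> \<omega> y"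
  using weight by (auto simp: admissible_weight_def mono_on_def)

lemma weight_subadd:
  assumes "\<sigma> > 1"
  obtains C where "C > 0" "\<And>x y. x \<ge> 0 \<Longrightarrow> y \<ge> 0 \<Longrightarrow> \<omega> (x + y) \<le> \<sigma> * (\<omega> x + \<omega> y) + C"
proof -
  have "\<forall>\<sigma>>1. \<exists>C>0. \<forall>x\<ge>0. \<forall>y\<ge>0. \<omega> (x + y) \<le> \<sigma> * (\<omega> x + \<omega> y) + C"
    using weight by (simp add: admissible_weight_def)
  with assms obtain C where "C > 0" "\<forall>x\<ge>0. \<forall>y\<ge>0. \<omega> (x + y) \<le> \<sigma> * (\<omega> x + \<omega> y) + C"
    by meson
  then show ?thesis using that by simp
qed

lemma weight_small:
  assumes "\<epsilon> > 0"
  obtains C where "C \<ge> 0" "\<And>x. x \<ge> 0 \<Longrightarrow> \<omega> x \<le> \<epsilon> * x + C"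
proof -
  have "\<omega> \<in> o(\<lambda>x. x)" using weight by (simp add: admissible_weight_def)
  then have "eventually (\<lambda>x. norm (\<omega> x) \<le> \<epsilon> * norm x) at_top"
    using assms by (rule landau_o.smallD)
  then obtain N where N: "\<And>x. x \<ge> N \<Longrightarrow> norm (\<omega> x) \<le> \<epsilon> * norm x"
    unfolding eventually_at_top_linorder by auto
  have "\<omega> x \<le> \<epsilon> * x + \<omega> (max 0 N)" if "x \<ge> 0" for x
  proof (cases "x \<ge> N")
    case True
    then show ?thesis using N[of x] that weight_nonneg[of "max 0 N"] by simp
  next
    case False
    then have "\<omega> x \<le> \<omega> (max 0 N)" using that by (intro weight_mono) auto
    moreover have "\<epsilon> * x \<ge> 0" using assms that by simp
    ultimately show ?thesis by simp
  qed
  then show ?thesis using that[of "\<omega> (max 0 N)"] weight_nonneg[of "max 0 N"] by simp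
qed

text \<open>This is where \<open>ln\<close> being negligible against \<open>\<omega>\<close> enters:
  polynomial factors cost an arbitrarily small share of the weight.\<close>

lemma power_le_exp_weight:
  assumes "\<epsilon> > 0"
  obtains C where "C \<ge> 0" "\<And>x. x \<ge> 0 \<Longrightarrow> x ^ n \<le> C * exp (\<epsilon> * \<omega> x)"
proof -
  have "ln \<in> o(\<omega>)" using weight by (simp add: admissible_weight_def)
  \<comment> \<open>Dividing by \<open>n + 1\<close> rather than \<open>n\<close> covers
    \<open>n = 0\<close>.\<close>
  then have "eventually (\<lambda>x. norm (ln x) \<le> (\<epsilon> / (n + 1)) * norm (\<omega> x)) at_top"
    by (rule landau_o.smallD) (use assms in simp)
  then obtain N where N: "\<And>x. x \<ge> N \<Longrightarrow> norm (ln x) \<le> (\<epsilon> / (n + 1)) * norm (\<omega> x)"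
    unfolding eventually_at_top_linorder by auto
  define M where "M = max 1 N"
  have "x ^ n \<le> M ^ n * exp (\<epsilon> * \<omega> x)" if "x \<ge> 0" for x
  proof (cases "x \<ge> M")
    case True
    then have x: "x \<ge> N" "x \<ge> 1" by (auto simp: M_def)
    have "real n * ln x \<le> real n * ((\<epsilon> / (n + 1)) * \<omega> x)"
      using N[OF x(1)] weight_nonneg[OF that] x(2) by (intro mult_left_mono) auto
    also have "\<dots> = (real n / (n + 1)) * (\<epsilon> * \<omega> x)"
      by simp
    also have "\<dots> \<le> 1 * (\<epsilon> * \<omega> x)"
      using weight_nonneg[OF that] assms by (intro mult_right_mono) auto
    finally have "exp (real n * ln x) \<le> exp (\<epsilon> * \<omega> x)" by simp
    then have "x ^ n \<le> exp (\<epsilon> * \<omega> x)" using x by (simp add: exp_of_nat_mult)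
    also have "\<dots> \<le> M ^ n * exp (\<epsilon> * \<omega> x)"
      by (simp add: M_def one_le_power)
    finally show ?thesis .
  next
    case False
    then have "x ^ n \<le> M ^ n" using that by (intro power_mono) auto
    moreover have "M ^ n * 1 \<le> M ^ n * exp (\<epsilon> * \<omega> x)"
      using weight_nonneg[OF that] assms by (intro mult_left_mono) (auto simp: M_def)
    ultimately show ?thesis by simp
  qed
  moreover have "M ^ n \<ge> 0" by (simp add: M_def)
  ultimately show ?thesis using that by blast
qed

section \<open>The dyadic series for the majorant\<close>

lemma summable_weight_dyadic: "summable (\<lambda>k. \<omega> (2 ^ (k + 1)) / 2 ^ k)"
proof -
  define f where "f = (\<lambda>x. \<omega> x / x\<^sup>2)"
  have int: "set_integrable lborel {1..} f"
    using weight by (simp add: admissible_weight_def f_def)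
  have intI: "set_integrable lborel {a..<b} f" if "a \<ge> 1" for a b
    by (rule set_integrable_subset[OF int]) (use that in auto)
  \<comment> \<open>On a dyadic block this takes the smallest numerator and the largest denominator
    of the integrand.\<close>
  define a where "a k = \<omega> (2 ^ k) / (2 ^ (k + 1))\<^sup>2" for k :: nat
  have f_nonneg: "f x \<ge> 0" if "x \<ge> 1" for x
    using weight_nonneg[of x] that by (simp add: f_def)
  have piece: "a k * 2 ^ k \<le> (LBINT x:{2 ^ k..<2 ^ (k + 1)}. f x)" for k
  proof -
    have "(LBINT x:{2 ^ k..<2 ^ (k + 1)::real}. a k) \<le> (LBINT x:{2 ^ k..<2 ^ (k + 1)}. f x)"
    proof (rule set_integral_mono)
      show "set_integrable lborel {2 ^ k..<2 ^ (k + 1)::real} (\<lambda>x. a k)"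
        by (simp add: set_integrable_def)
      show "set_integrable lborel {2 ^ k..<2 ^ (k + 1)} f"
        by (rule intI) simp
      fix x :: real assume x: "x \<in> {2 ^ k..<2 ^ (k + 1)}"
      have x1: "x \<ge> 1" using x one_le_power[of "2::real" k] by (simp del: one_le_power)
      have "\<omega> (2 ^ k) \<le> \<omega> x" using x by (intro weight_mono) auto
      then show "a k \<le> f x"
        unfolding a_def f_def using x x1 weight_nonneg[of "2 ^ k"]
        by (intro frac_le power_mono) auto
    qed
    moreover have "(LBINT x:{2 ^ k..<2 ^ (k + 1)::real}. a k) = a k * 2 ^ k"
      by (subst set_integral_const) (auto simp: mult.commute)
    ultimately show ?thesis by simp
  qed
  have sum_le: "(\<Sum>k<n. a k * 2 ^ k) \<le> (LBINT x:{1..<2 ^ n}. f x)" for n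
  proof (induction n)
    case 0
    then show ?case by (simp add: set_lebesgue_integral_def)
  next
    case (Suc n)
    have "{1..<2 ^ Suc n} = {1..<2 ^ n} \<union> {2 ^ n..<2 ^ (n + 1)::real}"
      using one_le_power[of "2::real" n] by (auto simp del: one_le_power)
    then have "(LBINT x:{1..<2 ^ Suc n}. f x) = (LBINT x:{1..<2 ^ n}. f x) + (LBINT x:{2 ^ n..<2 ^ (n + 1)}. f x)"
      by (simp only:) (rule set_integral_Un, auto intro!: intI)
    then show ?case using Suc piece[of n] by simp
  qed
  have bound: "(LBINT x:{1..<2 ^ n}. f x) \<le> (LBINT x:{1..}. f x)" for n :: nat
    unfolding set_lebesgue_integral_def
    by (rule integral_mono)
      (use intI[of 1 "2 ^ n"] int f_nonneg in \<open>auto simp: set_integrable_def split: split_indicator\<close>)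
  have nonneg: "a k * 2 ^ k \<ge> 0" for k
    using weight_nonneg[of "2 ^ k"] by (simp add: a_def)
  have "summable (\<lambda>k. a k * 2 ^ k)"
    by (rule bounded_imp_summable[of _ "LBINT x:{1..}. f x"])
      (use nonneg order.trans[OF sum_le bound] in \<open>simp_all only: lessThan_Suc_atMost[symmetric]\<close>)
  \<comment> \<open>The majorant needs the weight at the upper end of a block, hence the shifted
    index; the factor 8 compensates for the shift in the powers of 2.\<close>
  then have "summable (\<lambda>k. 8 * (a (Suc k) * 2 ^ Suc k))"
    by (intro summable_mult) (subst summable_Suc_iff[of "\<lambda>k. a k * 2 ^ k"])
  moreover have "8 * (a (Suc k) * 2 ^ Suc k) = \<omega> (2 ^ (k + 1)) / 2 ^ k" for k
    by (simp add: a_def power2_eq_square field_simps)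
  ultimately show ?thesis by (simp only:)
qed

definition majorant_term :: "nat \<Rightarrow> complex \<Rightarrow> complex" where
  "majorant_term k z = of_real (2 * \<omega> (2 ^ (k + 1))) * (- \<i> * z / (2 ^ k - \<i> * z))"

text \<open>Each fraction \<open>w / (2\<^sup>k + w)\<close> with \<open>w = - \<i> z\<close> has non-negative real part in the upper half-plane, and
  real part at least \<open>1/2\<close> once \<open>\<bar>z\<bar> \<ge> 2\<^sup>k\<close>; the non-quasianalyticity of the weight makes the series
  converge and \<open>o(\<bar>z\<bar>)\<close>.\<close>

definition majorant :: "complex \<Rightarrow> complex" where
  "majorant z = (\<Sum>k. majorant_term k z)"

text \<open>The strip below the real axis is kept so that the majorant is holomorphic on an open
  neighbourhood of the closed half-plane, as the Phragmen-Lindelof principle requires.\<close>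

lemma majorant_denominator:
  assumes "Im z > - 1 / 2"
  shows "cmod (2 ^ k - \<i> * z) \<ge> 2 ^ k / 2"
proof -
  have "(1::real) \<le> 2 ^ k" by simp
  moreover have "Re (2 ^ k - \<i> * z) = 2 ^ k + Im z"
    using Re_complex_of_real[of "2 ^ k"] by simp
  ultimately have "Re (2 ^ k - \<i> * z) \<ge> 2 ^ k / 2" using assms by linarith
  then show ?thesis using complex_Re_le_cmod order.trans by blast
qed

lemma majorant_term_le:
  assumes "Im z > - 1 / 2"
  shows "cmod (majorant_term k z) \<le> 4 * cmod z * (\<omega> (2 ^ (k + 1)) / 2 ^ k)"
proof -
  have "cmod z / cmod (2 ^ k - \<i> * z) \<le> cmod z / (2 ^ k / 2)"
  proof (rule divide_left_mono)
    show "2 ^ k / 2 \<le> cmod (2 ^ k - \<i> * z)" by (rule majorant_denominator[OF assms])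
    moreover have "(0::real) < 2 ^ k / 2" by simp
    ultimately show "0 < cmod (2 ^ k - \<i> * z) * (2 ^ k / 2)" by (intro mult_pos_pos) linarith+
  qed simp
  then have "2 * \<omega> (2 ^ (k + 1)) * (cmod z / cmod (2 ^ k - \<i> * z)) \<le> 2 * \<omega> (2 ^ (k + 1)) * (cmod z / (2 ^ k / 2))"
    using weight_nonneg[of "2 ^ (k + 1)"] by (intro mult_left_mono) auto
  then show ?thesis
    using weight_nonneg[of "2 ^ (k + 1)"] by (simp add: majorant_term_def norm_mult norm_divide mult_ac)
qed

lemma summable_norm_majorant_term:
  assumes "Im z > - 1 / 2"
  shows "summable (\<lambda>k. cmod (majorant_term k z))"
  by (rule summable_comparison_test'[OF summable_mult[OF summable_weight_dyadic]])
    (use majorant_term_le[OF assms] in simp)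

lemma holomorphic_majorant: "majorant holomorphic_on {z. Im z > - 1 / 2}"
proof (rule holomorphic_uniform_sequence)
  let ?S = "{z. Im z > - 1 / 2}"
  show op: "open ?S" by (intro open_Collect_less continuous_intros)
  show "(\<lambda>z. \<Sum>k<n. majorant_term k z) holomorphic_on ?S" for n
    unfolding majorant_term_def
  proof (intro holomorphic_intros)
    fix k z assume "z \<in> ?S"
    then have "cmod (2 ^ k - \<i> * z) \<ge> 2 ^ k / 2" by (intro majorant_denominator) auto
    moreover have "(2 ^ k / 2 :: real) > 0" by simp
    ultimately show "2 ^ k - \<i> * z \<noteq> 0" by (metis norm_zero not_less)
  qed
  fix x assume "x \<in> ?S"
  then obtain d where d: "d > 0" "cball x d \<subseteq> ?S"
    using op by (auto simp: open_contains_cball)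
  have "uniform_limit (cball x d) (\<lambda>n z. \<Sum>k<n. majorant_term k z) (\<lambda>z. suminf (\<lambda>k. majorant_term k z)) sequentially"
  proof (rule Weierstrass_m_test)
    show "summable (\<lambda>k. 4 * (cmod x + d) * (\<omega> (2 ^ (k + 1)) / 2 ^ k))"
      by (intro summable_mult summable_weight_dyadic)
    fix k z assume z: "z \<in> cball x d"
    then have "cmod (majorant_term k z) \<le> 4 * cmod z * (\<omega> (2 ^ (k + 1)) / 2 ^ k)"
      using d(2) by (intro majorant_term_le) auto
    also have "\<dots> \<le> 4 * (cmod x + d) * (\<omega> (2 ^ (k + 1)) / 2 ^ k)"
    proof (intro mult_right_mono mult_left_mono)
      show "cmod z \<le> cmod x + d"
        using z norm_triangle_ineq2[of z x] by (simp add: dist_norm norm_minus_commute)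
    qed (use weight_nonneg[of "2 ^ (k + 1)"] in auto)
    finally show "cmod (majorant_term k z) \<le> 4 * (cmod x + d) * (\<omega> (2 ^ (k + 1)) / 2 ^ k)" .
  qed
  then show "\<exists>d>0. cball x d \<subseteq> ?S \<and> uniform_limit (cball x d) (\<lambda>n z. \<Sum>k<n. majorant_term k z) majorant sequentially"
    using d unfolding majorant_def by blast
qed

lemma Re_majorant_fraction:
  fixes s :: real
  assumes "Im z \<ge> 0" "s > 0"
  shows "Re (- \<i> * z / (of_real s - \<i> * z)) \<ge> 0"
    and "cmod z \<ge> s \<Longrightarrow> Re (- \<i> * z / (of_real s - \<i> * z)) \<ge> 1 / 2"
proof -
  define D where "D = (s + Im z)\<^sup>2 + (Re z)\<^sup>2"
  have D: "D > 0" using assms by (simp add: D_def add_pos_nonneg)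
  have eq: "Re (- \<i> * z / (of_real s - \<i> * z)) = (s * Im z + (cmod z)\<^sup>2) / D"
    unfolding cmod_power2
    by (simp add: Re_divide D_def power2_eq_square add_divide_distrib diff_divide_distrib algebra_simps)
  show "Re (- \<i> * z / (of_real s - \<i> * z)) \<ge> 0"
    unfolding eq using D assms by (intro divide_nonneg_pos) auto
  assume "cmod z \<ge> s"
  then have "s\<^sup>2 \<le> (cmod z)\<^sup>2" using assms by (intro power_mono) auto
  then have "D \<le> 2 * (s * Im z + (cmod z)\<^sup>2)"
    unfolding cmod_power2 by (simp add: D_def power2_eq_square algebra_simps)
  then show "Re (- \<i> * z / (of_real s - \<i> * z)) \<ge> 1 / 2"
    unfolding eq using D by (simp add: field_simps)
qed

lemma Re_majorant:
  assumes "Im z \<ge> 0"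
  shows "Re (majorant z) \<ge> 0" and "\<omega> (cmod z) \<le> Re (majorant z) + \<omega> 1"
proof -
  have sm: "summable (\<lambda>k. majorant_term k z)"
    by (rule summable_norm_cancel[OF summable_norm_majorant_term]) (use assms in simp)
  have smr: "summable (\<lambda>k. Re (majorant_term k z))" by (rule summable_Re[OF sm])
  have eq: "Re (majorant z) = (\<Sum>k. Re (majorant_term k z))"
    unfolding majorant_def by (rule Re_suminf[OF sm])
  have term_eq: "Re (majorant_term k z) = 2 * \<omega> (2 ^ (k + 1)) * Re (- \<i> * z / (of_real (2 ^ k) - \<i> * z))" for k
  proof -
    have "majorant_term k z = of_real (2 * \<omega> (2 ^ (k + 1))) * (- \<i> * z / (of_real (2 ^ k) - \<i> * z))"
      by (simp add: majorant_term_def)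
    then have "Re (majorant_term k z) = Re (of_real (2 * \<omega> (2 ^ (k + 1))) * (- \<i> * z / (of_real (2 ^ k) - \<i> * z)))"
      by (rule arg_cong)
    also have "\<dots> = 2 * \<omega> (2 ^ (k + 1)) * Re (- \<i> * z / (of_real (2 ^ k) - \<i> * z))"
      unfolding times_complex.sel(1)[of "of_real _"] Re_complex_of_real Im_complex_of_real by simp
    finally show ?thesis .
  qed
  have nn: "Re (majorant_term k z) \<ge> 0" for k
    unfolding term_eq by (intro mult_nonneg_nonneg Re_majorant_fraction) (use weight_nonneg assms in auto)
  show 0: "Re (majorant z) \<ge> 0" unfolding eq by (intro suminf_nonneg smr nn)
  show "\<omega> (cmod z) \<le> Re (majorant z) + \<omega> 1"
  proof (cases "cmod z \<ge> 1")
    case True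
    obtain k where k: "2 ^ k \<le> cmod z" "cmod z < 2 ^ (k + 1)"
    proof -
      define P where "P = (\<lambda>n::nat. cmod z < 2 ^ n)"
      have "\<exists>n. P n" unfolding P_def by (rule real_arch_pow) simp
      then have "P (LEAST n. P n)" by (rule LeastI_ex)
      moreover have "\<not> P 0" using True by (simp add: P_def)
      ultimately obtain m where m: "(LEAST n. P n) = Suc m" by (cases "LEAST n. P n") auto
      then have "\<not> P m" using not_less_Least[of m P] by simp
      with \<open>P (LEAST n. P n)\<close> m show ?thesis using that[of m] by (simp add: P_def)
    qed
    \<comment> \<open>One term suffices: its fraction has real part at least 1/2, which cancels the
      2 in the coefficient, and all other terms have nonnegative real part.\<close>
    have "\<omega> (cmod z) \<le> \<omega> (2 ^ (k + 1))" using k by (intro weight_mono) auto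
    also have "\<dots> = 2 * \<omega> (2 ^ (k + 1)) * (1 / 2)" by simp
    also have "\<dots> \<le> Re (majorant_term k z)"
      unfolding term_eq by (intro mult_left_mono Re_majorant_fraction) (use k assms weight_nonneg in auto)
    also have "\<dots> = (\<Sum>j\<in>{k}. Re (majorant_term j z))" by simp
    also have "\<dots> \<le> Re (majorant z)"
      unfolding eq by (rule sum_le_suminf) (use smr nn in auto)
    finally show ?thesis using weight_nonneg[of 1] by simp
  next
    case False
    then have "\<omega> (cmod z) \<le> \<omega> 1" by (intro weight_mono) auto
    then show ?thesis using 0 by simp
  qed
qed

text \<open>A tail of the dyadic series contributes a small multiple of \<open>cmod z\<close>. Each
  term of the remaining finite head is bounded, because
  \<open>cmod z \<le> cmod (2 ^ k - \<i> * z)\<close> in the upper half-plane.\<close>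

lemma Re_majorant_small:
  assumes "\<epsilon> > 0"
  obtains C where "C \<ge> 0" "\<And>z. Im z \<ge> 0 \<Longrightarrow> Re (majorant z) \<le> \<epsilon> * cmod z + C"
proof -
  define b where "b k = \<omega> (2 ^ (k + 1)) / 2 ^ k" for k :: nat
  have sb: "summable b" unfolding b_def by (rule summable_weight_dyadic)
  have bnn: "b k \<ge> 0" for k using weight_nonneg[of "2 ^ (k + 1)"] by (simp add: b_def)
  have "(\<lambda>N. suminf (\<lambda>k. b (k + N))) \<longlonglongrightarrow> 0"
    by (rule suminf_exist_split2[OF sb])
  then have "eventually (\<lambda>N. suminf (\<lambda>k. b (k + N)) < \<epsilon> / 4) sequentially"
    by (rule order_tendstoD) (use assms in simp)
  then obtain N where N: "suminf (\<lambda>k. b (k + N)) < \<epsilon> / 4"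
    unfolding eventually_sequentially by blast
  define C where "C = (\<Sum>k<N. 2 * \<omega> (2 ^ (k + 1)))"
  have C0: "C \<ge> 0" unfolding C_def using weight_nonneg by (intro sum_nonneg) simp
  have "Re (majorant z) \<le> \<epsilon> * cmod z + C" if z: "Im z \<ge> 0" for z
  proof -
    have sn: "summable (\<lambda>k. cmod (majorant_term k z))"
      by (rule summable_norm_majorant_term) (use z in simp)
    have "Re (majorant z) \<le> cmod (majorant z)" by (rule complex_Re_le_cmod)
    also have "\<dots> \<le> (\<Sum>k. cmod (majorant_term k z))"
      unfolding majorant_def by (rule summable_norm[OF sn])
    also have "\<dots> = (\<Sum>k. cmod (majorant_term (k + N) z)) + (\<Sum>k<N. cmod (majorant_term k z))"
      by (rule suminf_split_initial_segment[OF sn])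
    also have "(\<Sum>k. cmod (majorant_term (k + N) z)) \<le> (\<Sum>k. 4 * cmod z * b (k + N))"
    proof (rule suminf_le)
      show "cmod (majorant_term (k + N) z) \<le> 4 * cmod z * b (k + N)" for k
        unfolding b_def by (rule majorant_term_le) (use z in simp)
      show "summable (\<lambda>k. cmod (majorant_term (k + N) z))"
        by (rule summable_ignore_initial_segment[OF sn])
      show "summable (\<lambda>k. 4 * cmod z * b (k + N))"
        by (intro summable_mult summable_ignore_initial_segment[OF sb])
    qed
    also have "(\<Sum>k. 4 * cmod z * b (k + N)) = 4 * cmod z * (\<Sum>k. b (k + N))"
      by (rule suminf_mult[OF summable_ignore_initial_segment[OF sb]])
    also have "\<dots> \<le> 4 * cmod z * (\<epsilon> / 4)"
      using N by (intro mult_left_mono) auto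
    also have "(\<Sum>k<N. cmod (majorant_term k z)) \<le> C"
      unfolding C_def
    proof (rule sum_mono)
      fix k
      have "cmod z \<le> cmod (2 ^ k - \<i> * z)"
      proof (rule power2_le_imp_le)
        have "2 ^ k - \<i> * z = Complex (2 ^ k + Im z) (- Re z)"
          by (simp add: complex_eq_iff Re_power_real)
        then have "(cmod (2 ^ k - \<i> * z))\<^sup>2 = (2 ^ k + Im z)\<^sup>2 + (Re z)\<^sup>2"
          by (simp add: cmod_power2)
        moreover have "(Im z)\<^sup>2 \<le> (2 ^ k + Im z)\<^sup>2" using z by (intro power_mono) auto
        ultimately show "(cmod z)\<^sup>2 \<le> (cmod (2 ^ k - \<i> * z))\<^sup>2" by (simp add: cmod_power2)
      qed simp
      then have "cmod z / cmod (2 ^ k - \<i> * z) \<le> 1"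
        by (simp add: divide_le_eq_1)
      then have "2 * \<omega> (2 ^ (k + 1)) * (cmod z / cmod (2 ^ k - \<i> * z)) \<le> 2 * \<omega> (2 ^ (k + 1)) * 1"
        using weight_nonneg[of "2 ^ (k + 1)"] by (intro mult_left_mono) auto
      then show "cmod (majorant_term k z) \<le> 2 * \<omega> (2 ^ (k + 1))"
        using weight_nonneg[of "2 ^ (k + 1)"] by (simp add: majorant_term_def norm_mult norm_divide mult_ac)
    qed
    finally show ?thesis by (simp add: mult_ac)
  qed
  then show ?thesis using that C0 by blast
qed

end

section \<open>The Hahn-Banach theorem for complex-valued functions\<close>

definition complex_subspace :: "('x \<Rightarrow> complex) set \<Rightarrow> bool" where
  "complex_subspace V \<longleftrightarrow> (\<lambda>_. 0) \<in> V \<and> (\<forall>f\<in>V. \<forall>g\<in>V. (\<lambda>z. f z + g z) \<in> V) \<and>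
     (\<forall>f\<in>V. \<forall>\<alpha>. (\<lambda>z. \<alpha> * f z) \<in> V)"

definition sublinear_on :: "('x \<Rightarrow> complex) set \<Rightarrow> (('x \<Rightarrow> complex) \<Rightarrow> real) \<Rightarrow> bool" where
  "sublinear_on V p \<longleftrightarrow> (\<forall>f\<in>V. \<forall>g\<in>V. p (\<lambda>z. f z + g z) \<le> p f + p g) \<and>
     (\<forall>f\<in>V. \<forall>t\<ge>0. p (\<lambda>z. of_real t * f z) = t * p f)"

lemma complex_subspaceD:
  assumes "complex_subspace V"
  shows "(\<lambda>_. 0) \<in> V" "f \<in> V \<Longrightarrow> g \<in> V \<Longrightarrow> (\<lambda>z. f z + g z) \<in> V"
    "f \<in> V \<Longrightarrow> (\<lambda>z. \<alpha> * f z) \<in> V" "f \<in> V \<Longrightarrow> (\<lambda>z. - f z) \<in> V"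
proof -
  have *: "\<forall>f\<in>V. \<forall>\<alpha>. (\<lambda>z. \<alpha> * f z) \<in> V" using assms by (simp add: complex_subspace_def)
  show "(\<lambda>z. - f z) \<in> V" if "f \<in> V"
    using *[rule_format, OF that, of "- 1"] by simp
qed (use assms in \<open>auto simp: complex_subspace_def\<close>)

lemma sublinear_onD:
  assumes "sublinear_on V p"
  shows "f \<in> V \<Longrightarrow> g \<in> V \<Longrightarrow> p (\<lambda>z. f z + g z) \<le> p f + p g"
    "f \<in> V \<Longrightarrow> t \<ge> 0 \<Longrightarrow> p (\<lambda>z. of_real t * f z) = t * p f"
  using assms by (auto simp: sublinear_on_def)

lemma sublinear_on_zero:
  assumes "complex_subspace V" "sublinear_on V p"
  shows "p (\<lambda>_. 0) = 0"
  using sublinear_onD(2)[OF assms(2) complex_subspaceD(1)[OF assms(1)], of 0] by simp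

lemma sublinear_on_lower:
  assumes V: "complex_subspace V" and p: "sublinear_on V p" and f: "f \<in> V"
  shows "- p (\<lambda>z. - f z) \<le> p f"
proof -
  have "p (\<lambda>z. f z + - f z) \<le> p f + p (\<lambda>z. - f z)"
    using sublinear_onD(1)[OF p f complex_subspaceD(4)[OF V f]] .
  then show ?thesis using sublinear_on_zero[OF V p] by simp
qed

text \<open>\<open>q\<close> is the infimum over \<open>t \<ge> 0\<close> of
  \<open>p (f + t y) - t * p y\<close>; \<open>t = 0\<close> and \<open>t = 1\<close> give the two
  upper bounds. The second bound serves twice: at general \<open>f\<close> it forces a minimal
  functional to be additive, and at \<open>- y\<close> it yields a functional that is large at
  \<open>y\<close>.\<close>

lemma sublinear_sharpen:
  assumes V: "complex_subspace V" and p: "sublinear_on V p" and y: "y \<in> V"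
  obtains q where "sublinear_on V q" "\<And>f. f \<in> V \<Longrightarrow> q f \<le> p f"
    "\<And>f. f \<in> V \<Longrightarrow> q f \<le> p (\<lambda>z. f z + y z) - p y"
proof -
  define h where "h f t = p (\<lambda>z. f z + of_real t * y z) - t * p y" for f t
  define q where "q f = (INF t\<in>{0..}. h f t)" for f
  have mem: "(\<lambda>z. f z + of_real t * y z) \<in> V" if "f \<in> V" for f t
    using complex_subspaceD[OF V] y that by simp
  have lower: "- p (\<lambda>z. - f z) \<le> h f t" if f: "f \<in> V" and t: "t \<ge> 0" for f t
  proof -
    have "p (\<lambda>z. (f z + of_real t * y z) + - f z) \<le> p (\<lambda>z. f z + of_real t * y z) + p (\<lambda>z. - f z)"
      by (rule sublinear_onD(1)[OF p mem[OF f] complex_subspaceD(4)[OF V f]])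
    then show ?thesis using sublinear_onD(2)[OF p y t] by (simp add: h_def)
  qed
  have bdd: "bdd_below (h f ` {0..})" if "f \<in> V" for f
    by (rule bdd_belowI2[where m = "- p (\<lambda>z. - f z)"]) (use lower[OF that] in auto)
  have q_le: "q f \<le> h f t" if "f \<in> V" "t \<ge> 0" for f t
    unfolding q_def by (rule cINF_lower[OF bdd]) (use that in auto)
  have q_ge: "b \<le> q f" if "\<And>t. t \<ge> 0 \<Longrightarrow> b \<le> h f t" for f b
    unfolding q_def by (rule cINF_greatest) (use that in auto)
  have add: "q (\<lambda>z. f z + g z) \<le> q f + q g" if f: "f \<in> V" and g: "g \<in> V" for f g
  proof -
    have fg: "(\<lambda>z. f z + g z) \<in> V" using complex_subspaceD[OF V] f g by simp
    have "q (\<lambda>z. f z + g z) - h f t \<le> q g" if t: "t \<ge> 0" for t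
    proof (rule q_ge)
      fix s :: real assume s: "s \<ge> 0"
      have "q (\<lambda>z. f z + g z) \<le> h (\<lambda>z. f z + g z) (t + s)"
        by (rule q_le[OF fg]) (use s t in simp)
      also have "\<dots> = p (\<lambda>z. (f z + of_real t * y z) + (g z + of_real s * y z)) - (t + s) * p y"
        by (simp add: h_def algebra_simps)
      also have "\<dots> \<le> h f t + h g s"
        using sublinear_onD(1)[OF p mem[OF f, of t] mem[OF g, of s]] by (simp add: h_def algebra_simps)
      finally show "q (\<lambda>z. f z + g z) - h f t \<le> h g s" by simp
    qed
    then have "q (\<lambda>z. f z + g z) - q g \<le> q f"
      by (intro q_ge) (simp add: algebra_simps)
    then show ?thesis by simp
  qed
  have scale: "q (\<lambda>z. of_real s * f z) \<le> s * q f" if f: "f \<in> V" and s: "s > 0" for f s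
  proof -
    have "q (\<lambda>z. of_real s * f z) / s \<le> q f"
    proof (rule q_ge)
      fix t :: real assume t: "t \<ge> 0"
      have "q (\<lambda>z. of_real s * f z) \<le> h (\<lambda>z. of_real s * f z) (s * t)"
        by (rule q_le) (use complex_subspaceD[OF V] f s t in auto)
      also have "\<dots> = p (\<lambda>z. of_real s * (f z + of_real t * y z)) - s * t * p y"
        by (simp add: h_def algebra_simps)
      also have "\<dots> = s * h f t"
        by (subst sublinear_onD(2)[OF p mem[OF f]]) (use s in \<open>auto simp: h_def algebra_simps\<close>)
      finally show "q (\<lambda>z. of_real s * f z) / s \<le> h f t" using s by (simp add: field_simps)
    qed
    then show ?thesis using s by (simp add: field_simps)
  qed
  have scale_eq: "q (\<lambda>z. of_real s * f z) = s * q f" if f: "f \<in> V" and s: "s \<ge> 0" for f s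
  proof (cases "s = 0")
    case True
    have z: "h (\<lambda>_. 0) t = 0" if "t \<ge> 0" for t
      using sublinear_onD(2)[OF p y that] by (simp add: h_def)
    have "q (\<lambda>_. 0) \<le> 0" using q_le[OF complex_subspaceD(1)[OF V], of 0] z[of 0] by simp
    moreover have "0 \<le> q (\<lambda>_. 0)" by (rule q_ge) (simp add: z)
    ultimately show ?thesis using True by simp
  next
    case False
    then have s: "s > 0" using s by simp
    have "q (\<lambda>z. of_real (1 / s) * (of_real s * f z)) \<le> (1 / s) * q (\<lambda>z. of_real s * f z)"
      by (rule scale) (use complex_subspaceD[OF V] f s in auto)
    then have "s * q f \<le> q (\<lambda>z. of_real s * f z)"
      using s by (simp add: field_simps)
    with scale[OF f s] show ?thesis by simp
  qed
  show ?thesis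
  proof (rule that)
    show "sublinear_on V q" unfolding sublinear_on_def using add scale_eq by simp
    show "q f \<le> p f" if "f \<in> V" for f using q_le[OF that, of 0] by (simp add: h_def)
    show "q f \<le> p (\<lambda>z. f z + y z) - p y" if "f \<in> V" for f
      using q_le[OF that, of 1] by (simp add: h_def)
  qed
qed

text \<open>A minimal sublinear functional cannot be sharpened, hence it is additive.\<close>

lemma minimal_sublinear:
  assumes V: "complex_subspace V" and p: "sublinear_on V p"
  obtains m where "sublinear_on V m" "\<And>f. f \<in> V \<Longrightarrow> m f \<le> p f"
    "\<And>f g. f \<in> V \<Longrightarrow> g \<in> V \<Longrightarrow> m (\<lambda>z. f z + g z) = m f + m g"
proof -
  \<comment> \<open>Setting the functionals to 0 off \<open>V\<close> makes maximality a statement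
    about equality of functions.\<close>
  define Q where "Q = {q. sublinear_on V q \<and> (\<forall>f\<in>V. q f \<le> p f) \<and> (\<forall>f. f \<notin> V \<longrightarrow> q f = 0)}"
  \<comment> \<open>The order is reversed, so a maximal element in Zorn's lemma is a minimal
    functional and chains are bounded by their pointwise infimum.\<close>
  define P where "P = (\<lambda>q q' :: ('a \<Rightarrow> complex) \<Rightarrow> real. \<forall>f. q' f \<le> q f)"
  have restrict: "(\<lambda>f. if f \<in> V then q f else 0) \<in> Q"
    if "sublinear_on V q" "\<And>f. f \<in> V \<Longrightarrow> q f \<le> p f" for q
    using that complex_subspaceD[OF V] by (simp add: Q_def sublinear_on_def)
  have "\<exists>m\<in>Q. \<forall>a\<in>Q. P m a \<longrightarrow> a = m"
  proof (rule predicate_Zorn)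
    show "partial_order_on Q (relation_of P Q)"
      by (rule partial_order_on_relation_ofI)
        (auto simp: P_def intro: order.trans intro!: ext order.antisym)
    fix C assume C: "C \<in> Chains (relation_of P Q)"
    show "\<exists>u\<in>Q. \<forall>a\<in>C. P a u"
    proof (cases "C = {}")
      case True
      then show ?thesis using restrict[OF p] by blast
    next
      case False
      have CQ: "q \<in> Q" if "q \<in> C" for q
        using C that unfolding Chains_def relation_of_def by auto
      have tot: "P q q' \<or> P q' q" if "q \<in> C" "q' \<in> C" for q q'
        using C that unfolding Chains_def relation_of_def by auto
      define u where "u f = (INF q\<in>C. q f)" for f
      have sub: "sublinear_on V q" if "q \<in> C" for q using CQ[OF that] by (simp add: Q_def)
      have lower: "- p (\<lambda>z. - f z) \<le> q f" if q: "q \<in> C" and f: "f \<in> V" for q f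
        using sublinear_on_lower[OF V sub[OF q] f] CQ[OF q] complex_subspaceD(4)[OF V f]
        unfolding Q_def by fastforce
      have u_le: "u f \<le> q f" if "q \<in> C" "f \<in> V" for q f
        unfolding u_def by (rule cINF_lower[OF bdd_belowI2[where m = "- p (\<lambda>z. - f z)"]])
          (use lower that in auto)
      have u_ge: "b \<le> u f" if "\<And>q. q \<in> C \<Longrightarrow> b \<le> q f" for b f
        unfolding u_def by (rule cINF_greatest[OF False that])
      have "sublinear_on V u"
        unfolding sublinear_on_def
      proof (intro conjI ballI allI impI)
        fix f g assume f: "f \<in> V" and g: "g \<in> V"
        have uu: "u (\<lambda>z. f z + g z) \<le> q f + q' g" if q: "q \<in> C" and q': "q' \<in> C" for q q'
        proof -
          have fg: "(\<lambda>z. f z + g z) \<in> V" by (rule complex_subspaceD(2)[OF V f g])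
          \<comment> \<open>The smaller of \<open>q\<close> and \<open>q'\<close> in the chain
            serves for both arguments, which is what makes the infimum subadditive.\<close>
          obtain q'' where q'': "q'' \<in> C" "q'' f \<le> q f" "q'' g \<le> q' g"
            using tot[OF q q'] q q' unfolding P_def by blast
          have "u (\<lambda>z. f z + g z) \<le> q'' f + q'' g"
            using u_le[OF q''(1) fg] sublinear_onD(1)[OF sub[OF q''(1)] f g] by linarith
          then show ?thesis using q'' by linarith
        qed
        have "u (\<lambda>z. f z + g z) - q f \<le> u g" if "q \<in> C" for q
        proof (rule u_ge)
          fix q' assume "q' \<in> C"
          from uu[OF that this] show "u (\<lambda>z. f z + g z) - q f \<le> q' g" by simp
        qed
        then have "u (\<lambda>z. f z + g z) - u g \<le> u f"
          by (intro u_ge) (simp add: algebra_simps)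
        then show "u (\<lambda>z. f z + g z) \<le> u f + u g" by simp
      next
        fix f and t :: real assume f: "f \<in> V" and t: "t \<ge> 0"
        have le: "u (\<lambda>z. of_real t * f z) \<le> t * u f" if f: "f \<in> V" and t: "t > 0" for f t
        proof -
          have "u (\<lambda>z. of_real t * f z) / t \<le> u f"
          proof (rule u_ge)
            fix q assume q: "q \<in> C"
            have "u (\<lambda>z. of_real t * f z) \<le> t * q f"
              using u_le[OF q complex_subspaceD(3)[OF V f]] sublinear_onD(2)[OF sub[OF q] f] t
              by (metis less_imp_le)
            then show "u (\<lambda>z. of_real t * f z) / t \<le> q f" using t by (simp add: field_simps)
          qed
          then show ?thesis using t by (simp add: field_simps)
        qed
        show "u (\<lambda>z. of_real t * f z) = t * u f"
        proof (cases "t = 0")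
          case True
          have "u (\<lambda>_. 0) = (INF q\<in>C. (0::real))"
            unfolding u_def by (rule INF_cong) (use sublinear_on_zero[OF V sub] in auto)
          then show ?thesis using True False by simp
        next
          case False
          then have t: "t > 0" using t by simp
          have "u (\<lambda>z. of_real (1 / t) * (of_real t * f z)) \<le> (1 / t) * u (\<lambda>z. of_real t * f z)"
            by (rule le) (use complex_subspaceD[OF V] f t in auto)
          then have "t * u f \<le> u (\<lambda>z. of_real t * f z)" using t by (simp add: field_simps)
          with le[OF f t] show ?thesis by simp
        qed
      qed
      moreover have "u f \<le> p f" if "f \<in> V" for f
      proof -
        obtain q where q: "q \<in> C" using False by blast
        then have "q f \<le> p f" using CQ[OF q] that by (auto simp: Q_def)
        then show ?thesis using u_le[OF q that] by simp
      qed
      ultimately have "(\<lambda>f. if f \<in> V then u f else 0) \<in> Q" by (rule restrict)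
      moreover have "P q (\<lambda>f. if f \<in> V then u f else 0)" if "q \<in> C" for q
        using u_le[OF that] CQ[OF that] by (auto simp: P_def Q_def)
      ultimately show ?thesis by blast
    qed
  qed
  then obtain m where m: "m \<in> Q" "\<And>a. a \<in> Q \<Longrightarrow> P m a \<Longrightarrow> a = m" by blast
  have sub: "sublinear_on V m" using m(1) by (simp add: Q_def)
  have "m (\<lambda>z. f z + y z) = m f + m y" if f: "f \<in> V" and y: "y \<in> V" for f y
  proof -
    obtain q where q: "sublinear_on V q" "\<And>f. f \<in> V \<Longrightarrow> q f \<le> m f"
      "\<And>f. f \<in> V \<Longrightarrow> q f \<le> m (\<lambda>z. f z + y z) - m y"
      using sublinear_sharpen[OF V sub y] by blast
    have "(\<lambda>f. if f \<in> V then q f else 0) \<in> Q"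
      using q m(1) by (intro restrict) (auto simp: Q_def intro: order.trans)
    moreover have "P m (\<lambda>f. if f \<in> V then q f else 0)"
      using q(2) m(1) by (auto simp: P_def Q_def)
    ultimately have "(\<lambda>f. if f \<in> V then q f else 0) = m" by (rule m(2))
    from fun_cong[OF this, of f] have "m f = q f" using f by simp
    then show ?thesis
      using q(3)[OF f] sublinear_onD(1)[OF sub f y] by simp
  qed
  moreover have "m f \<le> p f" if "f \<in> V" for f using m(1) that by (auto simp: Q_def)
  ultimately show ?thesis using that[OF sub] by blast
qed

text \<open>Sharpening at \<open>y\<close> precedes the choice of a minimal functional, so that
  \<open>m (- y) \<le> q (- y) \<le> - p y\<close>; additivity turns this into the lower bound at
  \<open>y\<close>.\<close>

lemma hahn_banach_seminorm:
  assumes V: "complex_subspace V" and p: "sublinear_on V p"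
    and circ: "\<And>f \<alpha>. f \<in> V \<Longrightarrow> cmod \<alpha> = 1 \<Longrightarrow> p (\<lambda>z. \<alpha> * f z) = p f"
    and y: "y \<in> V"
  obtains S where "\<And>f g. f \<in> V \<Longrightarrow> g \<in> V \<Longrightarrow> S (\<lambda>z. f z + g z) = S f + S g"
    "\<And>f \<alpha>. f \<in> V \<Longrightarrow> S (\<lambda>z. \<alpha> * f z) = \<alpha> * S f"
    "\<And>f. f \<in> V \<Longrightarrow> cmod (S f) \<le> p f" "Re (S y) \<ge> p y"
proof -
  obtain q where q: "sublinear_on V q" "\<And>f. f \<in> V \<Longrightarrow> q f \<le> p f"
    "\<And>f. f \<in> V \<Longrightarrow> q f \<le> p (\<lambda>z. f z + y z) - p y"
    using sublinear_sharpen[OF V p y] by blast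
  obtain m where m: "sublinear_on V m" "\<And>f. f \<in> V \<Longrightarrow> m f \<le> q f"
    "\<And>f g. f \<in> V \<Longrightarrow> g \<in> V \<Longrightarrow> m (\<lambda>z. f z + g z) = m f + m g"
    using minimal_sublinear[OF V q(1)] by blast
  note Vs = complex_subspaceD[OF V]
  have neg: "m (\<lambda>z. - f z) = - m f" if "f \<in> V" for f
    using m(3)[OF that Vs(4)[OF that]] sublinear_on_zero[OF V m(1)] by simp
  have homR: "m (\<lambda>z. of_real t * f z) = t * m f" if f: "f \<in> V" for f t
  proof (cases "t \<ge> 0")
    case True
    then show ?thesis by (rule sublinear_onD(2)[OF m(1) f])
  next
    case False
    then have "m (\<lambda>z. of_real (- t) * f z) = - t * m f"
      by (intro sublinear_onD(2)[OF m(1) f]) simp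
    moreover have "m (\<lambda>z. of_real (- t) * f z) = - m (\<lambda>z. of_real t * f z)"
      using neg[OF Vs(3)[OF f]] by simp
    ultimately show ?thesis by simp
  qed
  \<comment> \<open>The standard complexification of a real-linear functional with prescribed real
    part.\<close>
  define S where "S f = Complex (m f) (- m (\<lambda>z. \<i> * f z))" for f
  have add: "S (\<lambda>z. f z + g z) = S f + S g" if f: "f \<in> V" and g: "g \<in> V" for f g
    using m(3)[OF f g] m(3)[OF Vs(3)[OF f] Vs(3)[OF g]]
    by (simp add: S_def complex_eq_iff distrib_left)
  have scale: "S (\<lambda>z. \<alpha> * f z) = \<alpha> * S f" if f: "f \<in> V" for f \<alpha>
  proof -
    have lin: "m (\<lambda>z. \<beta> * f z) = Re \<beta> * m f + Im \<beta> * m (\<lambda>z. \<i> * f z)" for \<beta>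
    proof -
      have "(\<lambda>z. \<beta> * f z) = (\<lambda>z. of_real (Re \<beta>) * f z + of_real (Im \<beta>) * (\<i> * f z))"
        by (rule ext) (simp add: complex_eq_iff)
      then show ?thesis
        using m(3)[OF Vs(3)[OF f] Vs(3)[OF Vs(3)[OF f]]] homR[OF f] homR[OF Vs(3)[OF f]] by simp
    qed
    show ?thesis
      using lin[of \<alpha>] lin[of "\<i> * \<alpha>"] by (simp add: S_def complex_eq_iff mult.assoc)
  qed
  have bound: "cmod (S f) \<le> p f" if f: "f \<in> V" for f
  proof -
    obtain \<alpha> where \<alpha>: "cmod \<alpha> = 1" "\<alpha> * S f = of_real (cmod (S f))"
    proof (cases "S f = 0")
      case False
      then show ?thesis
        by (intro that[of "cnj (S f) / of_real (cmod (S f))"])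
          (auto simp: norm_divide complex_norm_square[symmetric] power2_eq_square mult.commute)
    qed (use that[of 1] in auto)
    have "cmod (S f) = Re (S (\<lambda>z. \<alpha> * f z))" using scale[OF f] \<alpha> by simp
    also have "\<dots> = m (\<lambda>z. \<alpha> * f z)" by (simp add: S_def)
    also have "\<dots> \<le> p (\<lambda>z. \<alpha> * f z)" using m(2) q(2) Vs(3)[OF f] order.trans by blast
    finally show ?thesis using circ[OF f \<alpha>(1)] by simp
  qed
  have "m (\<lambda>z. - y z) \<le> - p y"
    using m(2)[OF Vs(4)[OF y]] q(3)[OF Vs(4)[OF y]] sublinear_on_zero[OF V p] by simp
  then have "Re (S y) \<ge> p y" using neg[OF y] by (simp add: S_def)
  then show ?thesis using that add scale bound by blast
qed

section \<open>The inductive limit topology\<close>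

context weight_space
begin

section \<open>Balls of the steps and their compactness\<close>

text \<open>The closed ball of radius \<open>M\<close> in step \<open>k\<close>. An explicit radius
  instead of a supremum is monotone in \<open>k\<close> and \<open>M\<close> and passes directly to
  pointwise limits.\<close>

definition wbound :: "nat \<Rightarrow> real \<Rightarrow> (complex \<Rightarrow> complex) \<Rightarrow> bool" where
  "wbound k M f \<longleftrightarrow> f holomorphic_on UNIV \<and>
     (\<forall>z. cmod (f z) \<le> M * exp (r k * \<omega> (cmod z) + c k * \<bar>Im z\<bar>))"

lemma wboundD:
  assumes "wbound k M f"
  shows "f holomorphic_on UNIV" "cmod (f z) \<le> M * exp (r k * \<omega> (cmod z) + c k * \<bar>Im z\<bar>)"
  using assms by (auto simp: wbound_def)

lemma Pk_weighted_le_iff: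
  "Pk_weighted \<omega> c r k f z \<le> M \<longleftrightarrow> cmod (f z) \<le> M * exp (r k * \<omega> (cmod z) + c k * \<bar>Im z\<bar>)"
proof -
  have "- r k * \<omega> (cmod z) - c k * \<bar>Im z\<bar> = - (r k * \<omega> (cmod z) + c k * \<bar>Im z\<bar>)" by simp
  then show ?thesis
    unfolding Pk_weighted_def by (simp only: exp_minus) (simp add: field_simps)
qed

lemma wbound_iff: "wbound k M f \<longleftrightarrow> f holomorphic_on UNIV \<and> (\<forall>z. Pk_weighted \<omega> c r k f z \<le> M)"
  by (simp add: wbound_def Pk_weighted_le_iff)

lemma Pk_iff: "f \<in> Pk \<omega> c r k \<longleftrightarrow> (\<exists>M. wbound k M f)"
  by (auto simp: Pk_def wbound_iff bdd_above_def)

lemma Pa_iff: "f \<in> Pa \<omega> c r \<longleftrightarrow> (\<exists>k M. wbound k M f)"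
  by (auto simp: Pa_def Pk_iff)

lemma Pk_norm_le: "wbound k M f \<Longrightarrow> Pk_norm \<omega> c r k f \<le> M"
  unfolding Pk_norm_def by (rule cSUP_least) (auto simp: wbound_iff)

lemma wbound_Pk_norm: "f \<in> Pk \<omega> c r k \<Longrightarrow> wbound k (Pk_norm \<omega> c r k f) f"
  unfolding wbound_iff Pk_norm_def Pk_def by (auto intro: cSUP_upper)

lemma wbound_nonneg: "wbound k M f \<Longrightarrow> M \<ge> 0"
proof -
  assume "wbound k M f"
  then have "0 \<le> M * exp (r k * \<omega> (cmod 0) + c k * \<bar>Im 0\<bar>)"
    using wboundD(2)[of k M f 0] norm_ge_zero order.trans by blast
  then show ?thesis by (simp add: zero_le_mult_iff)
qed

lemma wbound_mono:
  assumes "wbound k M f" "k \<le> m" "M \<le> N"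
  shows "wbound m N f"
proof -
  have "cmod (f z) \<le> N * exp (r m * \<omega> (cmod z) + c m * \<bar>Im z\<bar>)" for z
  proof -
    have "r k * \<omega> (cmod z) + c k * \<bar>Im z\<bar> \<le> r m * \<omega> (cmod z) + c m * \<bar>Im z\<bar>"
      using inc_r inc_c weight_nonneg[of "cmod z"] assms(2)
      by (intro add_mono mult_right_mono) (auto simp: incseq_def)
    then have "M * exp (r k * \<omega> (cmod z) + c k * \<bar>Im z\<bar>) \<le> N * exp (r m * \<omega> (cmod z) + c m * \<bar>Im z\<bar>)"
      using assms wbound_nonneg[OF assms(1)] by (intro mult_mono) auto
    then show ?thesis using wboundD(2)[OF assms(1), of z] by linarith
  qed
  then show ?thesis using assms by (auto simp: wbound_def)
qed

lemma wbound_add: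
  assumes "wbound k M f" "wbound k N g"
  shows "wbound k (M + N) (\<lambda>z. f z + g z)"
  unfolding wbound_def
proof (intro conjI allI)
  fix z
  show "cmod (f z + g z) \<le> (M + N) * exp (r k * \<omega> (cmod z) + c k * \<bar>Im z\<bar>)"
    using norm_triangle_ineq[of "f z" "g z"] wboundD(2)[OF assms(1), of z] wboundD(2)[OF assms(2), of z]
    unfolding distrib_right by linarith
qed (use assms in \<open>auto simp: wbound_def intro!: holomorphic_intros\<close>)

lemma wbound_scale:
  assumes "wbound k M f"
  shows "wbound k (cmod \<alpha> * M) (\<lambda>z. \<alpha> * f z)"
  unfolding wbound_def
proof (intro conjI allI)
  fix z
  show "cmod (\<alpha> * f z) \<le> cmod \<alpha> * M * exp (r k * \<omega> (cmod z) + c k * \<bar>Im z\<bar>)"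
    using mult_left_mono[OF wboundD(2)[OF assms, of z], of "cmod \<alpha>"] by (simp add: norm_mult mult.assoc)
qed (use assms in \<open>auto simp: wbound_def intro!: holomorphic_intros\<close>)

lemma wbound_zero: "M \<ge> 0 \<Longrightarrow> wbound k M (\<lambda>_. 0)"
  by (simp add: wbound_def)

lemma wbound_limit:
  assumes "\<And>n. wbound k M (F n)" "f holomorphic_on UNIV" "\<And>z. (\<lambda>n. F n z) \<longlonglongrightarrow> f z"
  shows "wbound k M f"
  unfolding wbound_def
proof (intro conjI allI assms(2))
  fix z
  show "cmod (f z) \<le> M * exp (r k * \<omega> (cmod z) + c k * \<bar>Im z\<bar>)"
    by (rule LIMSEQ_le_const2[OF tendsto_norm[OF assms(3)]]) (use wboundD(2)[OF assms(1)] in auto)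
qed

lemma wbound_montel:
  assumes F: "\<And>n. wbound k M (F n)"
  obtains g s where "wbound k M g" "strict_mono (s :: nat \<Rightarrow> nat)" "\<And>z. (\<lambda>n. F (s n) z) \<longlonglongrightarrow> g z"
proof (rule Montel[of UNIV "range F" F])
  show "\<And>h. h \<in> range F \<Longrightarrow> h holomorphic_on UNIV" using wboundD(1)[OF F] by auto
  fix K :: "complex set" assume K: "compact K"
  then have "bounded K" by (rule compact_imp_bounded)
  then obtain R where R: "R > 0" "\<And>z. z \<in> K \<Longrightarrow> cmod z \<le> R"
    unfolding bounded_pos by auto
  have "cmod (F n z) \<le> M * exp (r k * \<omega> R + c k * R)" if z: "z \<in> K" for n z
  proof -
    have "r k * \<omega> (cmod z) + c k * \<bar>Im z\<bar> \<le> r k * \<omega> R + c k * R"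
      using r_pos[of k] c_pos[of k] order.trans[OF abs_Im_le_cmod R(2)[OF z]]
      by (intro add_mono mult_left_mono weight_mono R(2)[OF z]) auto
    then have "M * exp (r k * \<omega> (cmod z) + c k * \<bar>Im z\<bar>) \<le> M * exp (r k * \<omega> R + c k * R)"
      using wbound_nonneg[OF F[of 0]] by (intro mult_left_mono) auto
    then show ?thesis using wboundD(2)[OF F[of n], of z] by linarith
  qed
  then show "\<exists>B. \<forall>h\<in>range F. \<forall>z\<in>K. cmod (h z) \<le> B" by blast
next
  fix g s assume "g holomorphic_on UNIV" "strict_mono (s::nat\<Rightarrow>nat)" "\<And>x. x \<in> UNIV \<Longrightarrow> (\<lambda>n. F (s n) x) \<longlonglongrightarrow> g x"
  then show thesis using wbound_limit[of k M "\<lambda>n. F (s n)" g] F that[of g s] by auto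
qed auto

lemma complex_subspace_Pa: "complex_subspace (Pa \<omega> c r)"
  unfolding complex_subspace_def
proof (intro conjI ballI allI)
  show "(\<lambda>_. 0) \<in> Pa \<omega> c r" unfolding Pa_iff using wbound_zero[of 0] by blast
  show "(\<lambda>z. f z + g z) \<in> Pa \<omega> c r" if "f \<in> Pa \<omega> c r" "g \<in> Pa \<omega> c r" for f g
    by (rule Pa_add) (use that weight_nonneg inc_c inc_r in auto)
  show "(\<lambda>z. \<alpha> * f z) \<in> Pa \<omega> c r" if "f \<in> Pa \<omega> c r" for f \<alpha>
    using that wbound_scale unfolding Pa_iff by blast
qed

lemma topspace_Pa: "topspace (Pa_topology \<omega> c r) = Pa \<omega> c r"
  by (rule topspace_Pa_topology) (use weight_nonneg inc_c inc_r in auto)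

text \<open>The bounded sets of every step are compact for pointwise convergence by Montel's theorem, so a
  neighbourhood avoiding \<open>J\<close> can be built one step at a time.\<close>

lemma closedin_if_bounded_limits:
  assumes J: "J \<subseteq> Pa \<omega> c r"
    and lim: "\<And>k M F f. (\<And>n. F n \<in> J) \<Longrightarrow> (\<And>n. wbound k M (F n)) \<Longrightarrow> (\<And>z. (\<lambda>n. F n z) \<longlonglongrightarrow> f z) \<Longrightarrow> f \<in> J"
  shows "closedin (Pa_topology \<omega> c r) J"
  unfolding closedin_def topspace_Pa openin_Pa_topology Pa_open_def
proof (intro conjI J ballI)
  show "Pa \<omega> c r - J \<subseteq> Pa \<omega> c r" by blast
  fix f assume f: "f \<in> Pa \<omega> c r - J"
  then obtain m N where fb: "wbound m N f" by (auto simp: Pa_iff)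
  \<comment> \<open>Sequential compactness for pointwise convergence, the property preserved when a
    ball of the next step is added.\<close>
  define seqc where "seqc K \<longleftrightarrow> (\<forall>F :: nat \<Rightarrow> complex \<Rightarrow> complex. (\<forall>n. F n \<in> K) \<longrightarrow>
     (\<exists>g\<in>K. \<exists>s. strict_mono (s :: nat \<Rightarrow> nat) \<and> (\<forall>z. (\<lambda>n. F (s n) z) \<longlonglongrightarrow> g z)))" for K
  define good where "good K \<longleftrightarrow> (\<lambda>_. 0) \<in> K \<and> absolutely_convex K \<and> seqc K \<and>
     (\<exists>k M. \<forall>g\<in>K. wbound k M g) \<and> (\<forall>g\<in>K. (\<lambda>z. f z + g z) \<notin> J)" for K
  define step where "step n K K' \<longleftrightarrow> K \<subseteq> K' \<and> (\<exists>e>0. Collect (wbound n e) \<subseteq> K')" for n K K'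
  have "good {\<lambda>_. 0}"
    using f wbound_zero[of 0] strict_mono_id
    by (auto simp: good_def seqc_def absolutely_convex_def id_def intro!: exI[of _ "\<lambda>n. n"])
  moreover have "\<exists>K'. good K' \<and> step n K K'" if K: "good K" for n K
  proof -
    obtain k M where KM: "\<And>g. g \<in> K \<Longrightarrow> wbound k M g" using K by (auto simp: good_def)
    define K' where "K' e = {\<lambda>z. g z + b z | g b. g \<in> K \<and> wbound n e b}" for e
    define q where "q = max (max k n) m"
    have bK: "wbound q (M + e) (\<lambda>z. g z + b z)" if "g \<in> K" "wbound n e b" for g b e
      using wbound_add[OF wbound_mono[OF KM[OF that(1)], of q M] wbound_mono[OF that(2), of q e]] by (simp add: q_def)
    \<comment> \<open>If every radius failed, elements of radius \<open>1 / Suc j\<close> would tend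
      to 0 while their companions in \<open>K\<close> have a convergent subsequence. The limit would
      put \<open>f\<close> plus an element of \<open>K\<close> into \<open>J\<close>, against the
      invariant.\<close>
    have "\<exists>e>0. \<forall>g\<in>K' e. (\<lambda>z. f z + g z) \<notin> J"
    proof (rule ccontr)
      assume "\<not> ?thesis"
      then have "\<exists>g b. g \<in> K \<and> wbound n (1 / Suc j) b \<and> (\<lambda>z. f z + (g z + b z)) \<in> J" for j :: nat
        by (fastforce simp: K'_def dest: spec[of _ "1 / real (Suc j)"])
      then obtain g b where gb: "\<And>j. g j \<in> K" "\<And>j. wbound n (1 / Suc j) (b j)"
        "\<And>j. (\<lambda>z. f z + (g j z + b j z)) \<in> J"
        by metis
      obtain h s where h: "h \<in> K" "strict_mono (s :: nat \<Rightarrow> nat)" "\<And>z. (\<lambda>j. g (s j) z) \<longlonglongrightarrow> h z"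
        using K gb(1) unfolding good_def seqc_def by blast
      have b0: "(\<lambda>j. b (s j) z) \<longlonglongrightarrow> 0" for z
      proof -
        have "(\<lambda>j. (1 / Suc j) * exp (r n * \<omega> (cmod z) + c n * \<bar>Im z\<bar>)) \<longlonglongrightarrow> 0"
          using tendsto_mult_left_zero[OF LIMSEQ_inverse_real_of_nat] by (simp add: inverse_eq_divide)
        then have "(\<lambda>j. b j z) \<longlonglongrightarrow> 0"
          by (rule Lim_null_comparison[rotated]) (use wboundD(2)[OF gb(2)] in auto)
        then show ?thesis using LIMSEQ_subseq_LIMSEQ[OF _ h(2)] by (force simp: o_def)
      qed
      have "(\<lambda>z. f z + h z) \<in> J"
      proof (rule lim)
        show "(\<lambda>z. f z + (g (s j) z + b (s j) z)) \<in> J" for j by (rule gb(3))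
        have "wbound n 1 (b (s j))" for j
          by (rule wbound_mono[OF gb(2)[of "s j"]]) auto
        then have "wbound q (N + (M + 1)) (\<lambda>z. f z + (g (s j) z + b (s j) z))" for j
          by (intro wbound_add bK gb wbound_mono[OF fb]) (auto simp: q_def)
        then show "wbound q (N + (M + 1)) (\<lambda>z. f z + (g (s j) z + b (s j) z))" for j .
        fix z
        have "(\<lambda>j. f z + (g (s j) z + b (s j) z)) \<longlonglongrightarrow> f z + (h z + 0)"
          by (intro tendsto_intros h b0)
        then show "(\<lambda>j. f z + (g (s j) z + b (s j) z)) \<longlonglongrightarrow> f z + h z" by simp
      qed
      then show False using K h(1) by (simp add: good_def)
    qed
    then obtain e where e: "e > 0" "\<And>g. g \<in> K' e \<Longrightarrow> (\<lambda>z. f z + g z) \<notin> J" by blast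
    have K0: "(\<lambda>_. 0) \<in> K" using K by (simp add: good_def)
    have KK': "K \<subseteq> K' e"
    proof
      fix g assume "g \<in> K"
      then show "g \<in> K' e" unfolding K'_def
        using wbound_zero[of e n] e(1) by (intro CollectI exI[of _ g] exI[of _ "\<lambda>_. 0"]) auto
    qed
    have BK': "Collect (wbound n e) \<subseteq> K' e"
      using K0 by (force simp: K'_def)
    have "absolutely_convex (K' e)"
      unfolding absolutely_convex_def
    proof (intro ballI allI impI)
      fix u v and \<alpha> \<beta> :: complex assume u: "u \<in> K' e" and v: "v \<in> K' e" and ab: "cmod \<alpha> + cmod \<beta> \<le> 1"
      obtain g b where gb: "u = (\<lambda>z. g z + b z)" "g \<in> K" "wbound n e b" using u by (auto simp: K'_def)
      obtain g' b' where gb': "v = (\<lambda>z. g' z + b' z)" "g' \<in> K" "wbound n e b'" using v by (auto simp: K'_def)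
      have "(\<lambda>z. \<alpha> * g z + \<beta> * g' z) \<in> K"
        using K gb gb' ab by (auto simp: good_def absolutely_convex_def)
      moreover have "wbound n (cmod \<alpha> * e + cmod \<beta> * e) (\<lambda>z. \<alpha> * b z + \<beta> * b' z)"
        by (intro wbound_add wbound_scale gb gb')
      then have "wbound n e (\<lambda>z. \<alpha> * b z + \<beta> * b' z)"
        by (rule wbound_mono) (use mult_right_mono[OF ab, of e] e in \<open>auto simp: distrib_right\<close>)
      moreover have "(\<lambda>z. \<alpha> * u z + \<beta> * v z) = (\<lambda>z. (\<alpha> * g z + \<beta> * g' z) + (\<alpha> * b z + \<beta> * b' z))"
        by (simp add: gb gb' algebra_simps)
      ultimately show "(\<lambda>z. \<alpha> * u z + \<beta> * v z) \<in> K' e" unfolding K'_def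
        by (intro CollectI exI[of _ "\<lambda>z. \<alpha> * g z + \<beta> * g' z"] exI[of _ "\<lambda>z. \<alpha> * b z + \<beta> * b' z"]) simp
    qed
    moreover have "seqc (K' e)"
      unfolding seqc_def
    proof (intro allI impI)
      fix F :: "nat \<Rightarrow> complex \<Rightarrow> complex" assume "\<forall>n. F n \<in> K' e"
      then have "\<forall>j. \<exists>g b. F j = (\<lambda>z. g z + b z) \<and> g \<in> K \<and> wbound n e b" by (auto simp: K'_def)
      then obtain g b where gb: "\<And>j. F j = (\<lambda>z. g j z + b j z)" "\<And>j. g j \<in> K" "\<And>j. wbound n e (b j)"
        by metis
      obtain h s where h: "h \<in> K" "strict_mono (s :: nat \<Rightarrow> nat)" "\<And>z. (\<lambda>j. g (s j) z) \<longlonglongrightarrow> h z"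
        using K gb(2) unfolding good_def seqc_def by blast
      obtain b' t where b': "wbound n e b'" "strict_mono (t :: nat \<Rightarrow> nat)" "\<And>z. (\<lambda>j. b (s (t j)) z) \<longlonglongrightarrow> b' z"
        using wbound_montel[of n e "\<lambda>j. b (s j)"] gb(3) by blast
      have "(\<lambda>j. F ((s \<circ> t) j) z) \<longlonglongrightarrow> h z + b' z" for z
        unfolding gb(1) using LIMSEQ_subseq_LIMSEQ[OF h(3)[of z] b'(2)] b'(3)[of z]
        by (auto simp: o_def intro!: tendsto_intros)
      moreover have "(\<lambda>z. h z + b' z) \<in> K' e" using h b' by (auto simp: K'_def)
      ultimately show "\<exists>g\<in>K' e. \<exists>s. strict_mono (s :: nat \<Rightarrow> nat) \<and> (\<forall>z. (\<lambda>n. F (s n) z) \<longlonglongrightarrow> g z)"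
        using strict_mono_o[OF h(2) b'(2)]
        by (intro bexI[of _ "\<lambda>z. h z + b' z"] exI[of _ "s \<circ> t"]) auto
    qed
    moreover have "\<exists>k M. \<forall>g\<in>K' e. wbound k M g"
      by (intro exI[of _ q] exI[of _ "M + e"]) (auto simp: K'_def intro: bK)
    ultimately have "good (K' e)" using e K0 KK' by (auto simp: good_def)
    then show ?thesis using KK' BK' e by (auto simp: step_def)
  qed
  \<comment> \<open>Each stage absorbs a ball of one more step, so the union of the increasing
    sequence is a neighbourhood of zero.\<close>
  ultimately obtain K where K: "\<And>n. good (K n)" "\<And>n. step n (K n) (K (Suc n))"
    using dependent_nat_choice[of "\<lambda>_. good" step] by blast
  have incK: "K i \<subseteq> K j" if "i \<le> j" for i j
    by (rule lift_Suc_mono_le[OF _ that]) (use K(2) in \<open>auto simp: step_def\<close>)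
  define U where "U = (\<Union>n. K n)"
  have "Pa_zero_nhd \<omega> c r U"
    unfolding Pa_zero_nhd_def
  proof (intro conjI allI)
    show "U \<subseteq> Pa \<omega> c r"
    proof
      fix g assume "g \<in> U"
      then obtain n where "g \<in> K n" by (auto simp: U_def)
      moreover have "\<exists>k M. \<forall>g\<in>K n. wbound k M g" using K(1)[of n] unfolding good_def by blast
      ultimately show "g \<in> Pa \<omega> c r" unfolding Pa_iff by blast
    qed
    show "absolutely_convex U"
      unfolding absolutely_convex_def
    proof (intro ballI allI impI)
      fix u v and \<alpha> \<beta> :: complex assume "u \<in> U" "v \<in> U" and ab: "cmod \<alpha> + cmod \<beta> \<le> 1"
      then obtain i j where "u \<in> K i" "v \<in> K j" by (auto simp: U_def)
      then have "u \<in> K (max i j)" "v \<in> K (max i j)"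
        using incK[of i "max i j"] incK[of j "max i j"] by auto
      then have "(\<lambda>z. \<alpha> * u z + \<beta> * v z) \<in> K (max i j)"
        using K(1)[of "max i j"] ab by (auto simp: good_def absolutely_convex_def)
      then show "(\<lambda>z. \<alpha> * u z + \<beta> * v z) \<in> U" by (auto simp: U_def)
    qed
    fix k
    obtain e where e: "e > 0" "Collect (wbound k e) \<subseteq> K (Suc k)" using K(2)[of k] by (auto simp: step_def)
    have "{g \<in> Pk \<omega> c r k. Pk_norm \<omega> c r k g < e} \<subseteq> U"
    proof safe
      fix g assume g: "g \<in> Pk \<omega> c r k" "Pk_norm \<omega> c r k g < e"
      have "wbound k e g" by (rule wbound_mono[OF wbound_Pk_norm[OF g(1)]]) (use g in auto)
      then show "g \<in> U" using e by (auto simp: U_def)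
    qed
    then show "\<exists>\<epsilon>>0. {g \<in> Pk \<omega> c r k. Pk_norm \<omega> c r k g < \<epsilon>} \<subseteq> U" using e(1) by blast
  qed
  moreover have "(\<lambda>z. f z + u z) \<in> Pa \<omega> c r - J" if u: "u \<in> U" for u
  proof -
    obtain n where n: "u \<in> K n" using u by (auto simp: U_def)
    moreover have "\<exists>k M. \<forall>g\<in>K n. wbound k M g" using K(1)[of n] unfolding good_def by blast
    ultimately have "u \<in> Pa \<omega> c r" unfolding Pa_iff by blast
    then have "(\<lambda>z. f z + u z) \<in> Pa \<omega> c r"
      using f complex_subspaceD(2)[OF complex_subspace_Pa] by blast
    then show ?thesis using K(1)[of n] n by (auto simp: good_def)
  qed
  ultimately show "\<exists>U. Pa_zero_nhd \<omega> c r U \<and> (\<forall>u\<in>U. (\<lambda>z. f z + u z) \<in> Pa \<omega> c r - J)" by blast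
qed

section \<open>Separation by a continuous functional\<close>

lemma closed_submodule_subspace:
  assumes "closed_submodule \<omega> c r J"
  shows "complex_subspace J" "J \<subseteq> Pa \<omega> c r"
proof -
  have "(\<lambda>z. \<alpha> * f z) \<in> J" if "f \<in> J" for f \<alpha>
  proof -
    have "(\<lambda>z. poly [:\<alpha>:] z * f z) \<in> J"
      using assms that unfolding closed_submodule_def by blast
    then show ?thesis by simp
  qed
  then show "complex_subspace J" using assms by (simp add: closed_submodule_def complex_subspace_def)
  show "J \<subseteq> Pa \<omega> c r"
    using assms closedin_subset topspace_Pa unfolding closed_submodule_def by metis
qed

text \<open>The functional is dominated by the Minkowski functional of \<open>J + U\<close>, where
  \<open>\<psi> + U\<close> avoids \<open>J\<close>. This seminorm vanishes on \<open>J\<close>, is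
  at least 1 at \<open>\<psi>\<close>, and is bounded by a multiple of the norm on every step
  because \<open>U\<close> contains a ball of every step.\<close>

lemma closed_submodule_separation:
  assumes J: "closed_submodule \<omega> c r J" and \<psi>: "\<psi> \<in> Pa \<omega> c r" "\<psi> \<notin> J"
  obtains S where "\<And>f g. f \<in> Pa \<omega> c r \<Longrightarrow> g \<in> Pa \<omega> c r \<Longrightarrow> S (\<lambda>z. f z + g z) = S f + S g"
    "\<And>f \<alpha>. f \<in> Pa \<omega> c r \<Longrightarrow> S (\<lambda>z. \<alpha> * f z) = \<alpha> * S f"
    "\<And>f. f \<in> J \<Longrightarrow> S f = 0" "S \<psi> \<noteq> 0"
    "\<And>k. \<exists>C\<ge>0. \<forall>M f. wbound k M f \<longrightarrow> cmod (S f) \<le> C * M"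
proof -
  let ?V = "Pa \<omega> c r"
  note V = complex_subspace_Pa
  note Vs = complex_subspaceD[OF V]
  note Js = complex_subspaceD[OF closed_submodule_subspace(1)[OF J]]
  note JV = closed_submodule_subspace(2)[OF J]
  have "Pa_open \<omega> c r (?V - J)"
    using J unfolding closed_submodule_def closedin_def topspace_Pa openin_Pa_topology by blast
  then obtain U where U: "Pa_zero_nhd \<omega> c r U" "\<And>u. u \<in> U \<Longrightarrow> (\<lambda>z. \<psi> z + u z) \<notin> J"
    using \<psi> unfolding Pa_open_def by blast
  have UV: "U \<subseteq> ?V" and Uconv: "absolutely_convex U" using U by (auto simp: Pa_zero_nhd_def)
  have ball: "\<exists>e>0. \<forall>M f. wbound k M f \<longrightarrow> M < e \<longrightarrow> f \<in> U" for k
  proof -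
    obtain e where e: "e > 0" "{f \<in> Pk \<omega> c r k. Pk_norm \<omega> c r k f < e} \<subseteq> U"
      using U(1) unfolding Pa_zero_nhd_def by blast
    have "f \<in> U" if "wbound k M f" "M < e" for M f
      using e(2) that Pk_norm_le[OF that(1)] by (force simp: Pk_iff)
    then show ?thesis using e(1) by blast
  qed
  have U0: "(\<lambda>_. 0) \<in> U" using ball[of 0] wbound_zero[of 0] by blast
  have Uscale: "(\<lambda>z. \<alpha> * f z) \<in> U" if "f \<in> U" "cmod \<alpha> \<le> 1" for f \<alpha>
    using Uconv that unfolding absolutely_convex_def
    by (drule_tac bspec[of _ _ f], blast) (drule_tac bspec[of _ _ f], blast, drule_tac spec[of _ \<alpha>], drule_tac spec[of _ 0], simp)
  define T where "T f = {t. t > 0 \<and> (\<exists>j\<in>J. \<exists>u\<in>U. f = (\<lambda>z. j z + of_real t * u z))}" for f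
  define p where "p f = Inf (T f)" for f
  have TI: "t \<in> T f" if "t > 0" "j \<in> J" "u \<in> U" "\<And>z. f z = j z + of_real t * u z" for t f j u
    using that by (auto simp: T_def)
  have Tball: "\<exists>e>0. \<forall>M f. wbound k M f \<longrightarrow> M > 0 \<longrightarrow> 2 * M / e \<in> T f" for k
  proof -
    obtain e where e: "e > 0" "\<And>M f. wbound k M f \<Longrightarrow> M < e \<Longrightarrow> f \<in> U" using ball[of k] by blast
    have "2 * M / e \<in> T f" if f: "wbound k M f" and M: "M > 0" for M f
    proof (rule TI)
      show "2 * M / e > 0" using e M by simp
      show "(\<lambda>_. 0) \<in> J" by (rule Js(1))
      show "(\<lambda>z. of_real (e / (2 * M)) * f z) \<in> U"
        by (rule e(2)[OF wbound_scale[OF f]]) (use e M in \<open>simp add: norm_divide norm_mult\<close>)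
      show "f z = 0 + of_real (2 * M / e) * (of_real (e / (2 * M)) * f z)" for z
        using e M by simp
    qed
    then show ?thesis using e by blast
  qed
  have Tne: "T f \<noteq> {}" if f: "f \<in> ?V" for f
  proof -
    obtain k M where "wbound k M f" using f by (auto simp: Pa_iff)
    then have "wbound k (max M 1) f" by (rule wbound_mono) auto
    then show ?thesis using Tball[of k] by fastforce
  qed
  have Tbdd: "bdd_below (T f)" for f by (rule bdd_belowI[of _ 0]) (auto simp: T_def)
  have p_le: "p f \<le> t" if "t \<in> T f" for f t unfolding p_def by (rule cInf_lower[OF that Tbdd])
  have p_ge: "b \<le> p f" if "f \<in> ?V" "\<And>t. t \<in> T f \<Longrightarrow> b \<le> t" for f b
    unfolding p_def by (rule cInf_greatest[OF Tne]) (use that in auto)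
  have Tscale: "cmod \<alpha> * t \<in> T (\<lambda>z. \<alpha> * f z)" if t: "t \<in> T f" and \<alpha>: "\<alpha> \<noteq> 0" for \<alpha> :: complex and t f
  proof -
    obtain j u where ju: "t > 0" "j \<in> J" "u \<in> U" "f = (\<lambda>z. j z + of_real t * u z)" using t by (auto simp: T_def)
    show ?thesis
    proof (rule TI)
      show "cmod \<alpha> * t > 0" using ju \<alpha> by simp
      show "(\<lambda>z. \<alpha> * j z) \<in> J" by (rule Js(3)[OF ju(2)])
      show "(\<lambda>z. (\<alpha> / of_real (cmod \<alpha>)) * u z) \<in> U" by (rule Uscale[OF ju(3)]) (simp add: norm_divide)
      show "\<alpha> * f z = \<alpha> * j z + of_real (cmod \<alpha> * t) * (\<alpha> / of_real (cmod \<alpha>) * u z)" for z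
        using \<alpha> by (simp add: ju(4) algebra_simps)
    qed
  qed
  have pscale_le: "p (\<lambda>z. \<alpha> * f z) \<le> cmod \<alpha> * p f" if f: "f \<in> ?V" and \<alpha>: "\<alpha> \<noteq> 0" for f and \<alpha> :: complex
  proof -
    have "p (\<lambda>z. \<alpha> * f z) / cmod \<alpha> \<le> p f"
      by (rule p_ge[OF f]) (use p_le[OF Tscale[OF _ \<alpha>]] \<alpha> in \<open>simp add: field_simps\<close>)
    then show ?thesis using \<alpha> by (simp add: field_simps)
  qed
  have pscale: "p (\<lambda>z. \<alpha> * f z) = cmod \<alpha> * p f" if f: "f \<in> ?V" and \<alpha>: "\<alpha> \<noteq> 0" for f and \<alpha> :: complex
  proof -
    have "p (\<lambda>z. (1 / \<alpha>) * (\<alpha> * f z)) \<le> cmod (1 / \<alpha>) * p (\<lambda>z. \<alpha> * f z)"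
      by (rule pscale_le[OF Vs(3)[OF f]]) (use \<alpha> in simp)
    then have "cmod \<alpha> * p f \<le> p (\<lambda>z. \<alpha> * f z)" using \<alpha> by (simp add: norm_divide field_simps)
    with pscale_le[OF f \<alpha>] show ?thesis by simp
  qed
  have p_nonneg: "p f \<ge> 0" if "f \<in> ?V" for f by (rule p_ge[OF that]) (auto simp: T_def)
  have pJ: "p f = 0" if f: "f \<in> J" for f
  proof -
    have "p f \<le> e" if "e > 0" for e
      by (rule p_le[OF TI[OF that f U0]]) simp
    then have "p f \<le> 0" by (meson dense_ge)
    then show ?thesis using p_nonneg f JV by force
  qed
  have padd: "p (\<lambda>z. f z + g z) \<le> p f + p g" if f: "f \<in> ?V" and g: "g \<in> ?V" for f g
  proof -
    have pp: "p (\<lambda>z. f z + g z) \<le> t + t'" if t: "t \<in> T f" and t': "t' \<in> T g" for t t'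
    proof -
      obtain j u where ju: "t > 0" "j \<in> J" "u \<in> U" "f = (\<lambda>z. j z + of_real t * u z)" using t by (auto simp: T_def)
      obtain j' u' where ju': "t' > 0" "j' \<in> J" "u' \<in> U" "g = (\<lambda>z. j' z + of_real t' * u' z)" using t' by (auto simp: T_def)
      define \<alpha> \<beta> where "\<alpha> = (of_real (t / (t + t')) :: complex)" and "\<beta> = (of_real (t' / (t + t')) :: complex)"
      show ?thesis
      proof (rule p_le, rule TI)
        show "t + t' > 0" using ju ju' by simp
        show "(\<lambda>z. j z + j' z) \<in> J" by (rule Js(2)[OF ju(2) ju'(2)])
        have "cmod \<alpha> + cmod \<beta> \<le> 1"
          unfolding \<alpha>_def \<beta>_def norm_of_real using ju(1) ju'(1) by (simp add: add_divide_distrib[symmetric])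
        then show "(\<lambda>z. \<alpha> * u z + \<beta> * u' z) \<in> U"
          using Uconv ju(3) ju'(3) unfolding absolutely_convex_def by blast
        have "of_real (t + t') * \<alpha> = of_real t" "of_real (t + t') * \<beta> = of_real t'"
          unfolding \<alpha>_def \<beta>_def of_real_mult[symmetric] using ju(1) ju'(1) by auto
        then show "f z + g z = (j z + j' z) + of_real (t + t') * (\<alpha> * u z + \<beta> * u' z)" for z
          unfolding distrib_left mult.assoc[symmetric] by (simp add: ju(4) ju'(4))
      qed
    qed
    have "p (\<lambda>z. f z + g z) - t \<le> p g" if "t \<in> T f" for t
    proof (rule p_ge[OF g])
      fix t' assume "t' \<in> T g"
      from pp[OF that this] show "p (\<lambda>z. f z + g z) - t \<le> t'" by simp
    qed
    then have "p (\<lambda>z. f z + g z) - p g \<le> p f"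
      by (intro p_ge[OF f]) (simp add: algebra_simps)
    then show ?thesis by simp
  qed
  have p0: "p (\<lambda>_. 0) = 0" by (rule pJ[OF Js(1)])
  have sub: "sublinear_on ?V p"
    unfolding sublinear_on_def
  proof (intro conjI ballI allI impI padd)
    fix f and t :: real assume "f \<in> ?V" "t \<ge> 0"
    then show "p (\<lambda>z. of_real t * f z) = t * p f"
      using pscale[of f "of_real t"] p0 by (cases "t = 0") auto
  qed
  \<comment> \<open>A representation \<open>\<psi> = j + t u\<close> with \<open>t < 1\<close> would
    give \<open>\<psi> - t u \<in> J\<close>, although \<open>- t u\<close> belongs to
    \<open>U\<close>.\<close>
  have p\<psi>: "p \<psi> \<ge> 1"
  proof (rule p_ge[OF \<psi>(1)], rule ccontr)
    fix t assume t: "t \<in> T \<psi>" "\<not> 1 \<le> t"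
    obtain j u where ju: "t > 0" "j \<in> J" "u \<in> U" "\<psi> = (\<lambda>z. j z + of_real t * u z)" using t by (auto simp: T_def)
    have "(\<lambda>z. - of_real t * u z) \<in> U" by (rule Uscale[OF ju(3)]) (use t ju(1) in simp)
    then have "(\<lambda>z. \<psi> z + - of_real t * u z) \<notin> J" by (rule U(2))
    then show False using ju by simp
  qed
  obtain S where S: "\<And>f g. f \<in> ?V \<Longrightarrow> g \<in> ?V \<Longrightarrow> S (\<lambda>z. f z + g z) = S f + S g"
    "\<And>f \<alpha>. f \<in> ?V \<Longrightarrow> S (\<lambda>z. \<alpha> * f z) = \<alpha> * S f"
    "\<And>f. f \<in> ?V \<Longrightarrow> cmod (S f) \<le> p f" "Re (S \<psi>) \<ge> p \<psi>"
  proof (rule hahn_banach_seminorm[OF V sub _ \<psi>(1)])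
    show "p (\<lambda>z. \<alpha> * f z) = p f" if "f \<in> ?V" "cmod \<alpha> = 1" for f and \<alpha> :: complex
    proof -
      have "\<alpha> \<noteq> 0" using that(2) by auto
      then show ?thesis using pscale[OF that(1)] that(2) by simp
    qed
  qed blast
  show ?thesis
  proof (rule that[of S])
    show "S f = 0" if "f \<in> J" for f using S(3)[of f] pJ[OF that] that JV by auto
    show "S \<psi> \<noteq> 0" using S(4) p\<psi> by auto
    fix k
    obtain e where e: "e > 0" "\<And>M f. wbound k M f \<Longrightarrow> M > 0 \<Longrightarrow> 2 * M / e \<in> T f" using Tball[of k] by blast
    have "cmod (S f) \<le> 2 / e * M" if f: "wbound k M f" for M f
    \<comment> \<open>Members of \<open>T\<close> are positive, so the zero radius needs its own
      argument.\<close>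
    proof (cases "M = 0")
      case True
      then have "f = (\<lambda>_. 0)" using wboundD(2)[OF f] by auto
      then have "S f = 0" using S(2)[OF Vs(1), of 0] by simp
      then show ?thesis using True by simp
    next
      case False
      then have "M > 0" using wbound_nonneg[OF f] by simp
      moreover have "f \<in> ?V" using f by (auto simp: Pa_iff)
      ultimately show ?thesis using S(3)[of f] p_le[OF e(2)[OF f]] by simp
    qed
    then show "\<exists>C\<ge>0. \<forall>M f. wbound k M f \<longrightarrow> cmod (S f) \<le> C * M"
      using e(1) by (intro exI[of _ "2 / e"]) auto
  qed (use S in auto)
qed

end

section \<open>Indicators, multiplicities and spectral hulls\<close>

lemma log_modulus_less_iff:
  assumes "t > 0"
  shows "log_modulus w / ereal t < ereal y \<longleftrightarrow> cmod w < exp (y * t)"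
proof (cases "w = 0")
  case False
  then have "log_modulus w / ereal t < ereal y \<longleftrightarrow> ln (cmod w) < y * t"
    using assms by (simp add: log_modulus_def field_simps)
  also have "\<dots> \<longleftrightarrow> cmod w < exp (y * t)"
    using False by (metis exp_less_cancel_iff exp_ln zero_less_norm_iff)
  finally show ?thesis .
qed (use assms in \<open>simp add: log_modulus_def\<close>)

lemma exp_i_half_pi:
  "exp (\<i> * of_real (pi / 2)) = \<i>" "exp (\<i> * of_real (- pi / 2)) = - \<i>"
proof -
  show 1: "exp (\<i> * of_real (pi / 2)) = \<i>" by (metis cis_conv_exp cis_pi_half)
  have "exp (\<i> * of_real (- pi / 2)) = inverse (exp (\<i> * of_real (pi / 2)))"
    by (simp add: exp_minus[symmetric])
  then show "exp (\<i> * of_real (- pi / 2)) = - \<i>" unfolding 1 by simp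
qed

text \<open>Reflection \<open>z \<mapsto> - z\<close> reduces every statement on the lower
  half-plane to the upper one.\<close>

lemma indicator_fun_lower: "indicator_fun f (- pi / 2) = indicator_fun (\<lambda>z. f (- z)) (pi / 2)"
  unfolding indicator_fun_def exp_i_half_pi by simp

lemma indicator_fun_upper_le_iff:
  "indicator_fun f (pi / 2) \<le> d \<longleftrightarrow>
     (\<forall>D. d < ereal D \<longrightarrow> eventually (\<lambda>t. cmod (f (of_real t * \<i>)) \<le> exp (D * t)) at_top)"
proof
  assume le: "indicator_fun f (pi / 2) \<le> d"
  show "\<forall>D. d < ereal D \<longrightarrow> eventually (\<lambda>t. cmod (f (of_real t * \<i>)) \<le> exp (D * t)) at_top"
  proof (intro allI impI)
    fix D assume "d < ereal D"
    then have "eventually (\<lambda>t. log_modulus (f (of_real t * \<i>)) / ereal t < ereal D) at_top"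
      using le unfolding indicator_fun_def exp_i_half_pi Limsup_le_iff by blast
    then show "eventually (\<lambda>t. cmod (f (of_real t * \<i>)) \<le> exp (D * t)) at_top"
      using eventually_gt_at_top[of 0] by eventually_elim (simp add: log_modulus_less_iff)
  qed
next
  assume ev: "\<forall>D. d < ereal D \<longrightarrow> eventually (\<lambda>t. cmod (f (of_real t * \<i>)) \<le> exp (D * t)) at_top"
  show "indicator_fun f (pi / 2) \<le> d"
    unfolding indicator_fun_def exp_i_half_pi Limsup_le_iff
  proof (intro allI impI)
    fix y assume "d < y"
    \<comment> \<open>Two intermediate values are used because the eventual bound is weak and the
      limsup criterion is strict: \<open>D\<close> carries the first and \<open>E\<close> the
      second.\<close>
    then obtain E where E: "d < ereal E" "ereal E < y" using ereal_dense2 by blast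
    obtain D where D: "d < ereal D" "ereal D < ereal E" using ereal_dense2[OF E(1)] by blast
    have "eventually (\<lambda>t. cmod (f (of_real t * \<i>)) \<le> exp (D * t)) at_top" using ev D(1) by blast
    then show "eventually (\<lambda>t. log_modulus (f (of_real t * \<i>)) / ereal t < y) at_top"
      using eventually_gt_at_top[of 0]
    proof eventually_elim
      case (elim t)
      then have "cmod (f (of_real t * \<i>)) < exp (E * t)"
        using D(2) by (intro le_less_trans[OF elim(1)]) simp
      then have "log_modulus (f (of_real t * \<i>)) / ereal t < ereal E"
        using elim log_modulus_less_iff by blast
      then show ?case using E(2) by simp
    qed
  qed
qed

lemma indicator_fun_upper_leI:
  assumes "\<And>D. d < ereal D \<Longrightarrow> \<exists>C. \<forall>t\<ge>0. cmod (f (of_real t * \<i>)) \<le> C * exp (D * t)"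
  shows "indicator_fun f (pi / 2) \<le> d"
  unfolding indicator_fun_upper_le_iff
proof (intro allI impI)
  fix E assume "d < ereal E"
  then obtain D where D: "d < ereal D" "D < E" using ereal_dense2 by (metis ereal_less(2) ereal_less_eq(3) less_ereal.simps(1))
  obtain C where C: "\<And>t. t \<ge> 0 \<Longrightarrow> cmod (f (of_real t * \<i>)) \<le> C * exp (D * t)" using assms[OF D(1)] by blast
  show "eventually (\<lambda>t. cmod (f (of_real t * \<i>)) \<le> exp (E * t)) at_top"
    using eventually_ge_at_top[of 0] eventually_ge_at_top[of "\<bar>C\<bar> / (E - D)"]
  proof eventually_elim
    case (elim t)
    have "\<bar>C\<bar> \<le> (E - D) * t" using elim D by (simp add: field_simps)
    also have "\<dots> \<le> exp ((E - D) * t)" using exp_ge_add_one_self[of "(E - D) * t"] by linarith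
    finally have "C \<le> exp ((E - D) * t)" by linarith
    then have "C * exp (D * t) \<le> exp ((E - D) * t) * exp (D * t)" by (intro mult_right_mono) auto
    also have "\<dots> = exp (E * t)" by (simp add: exp_add[symmetric] algebra_simps)
    finally show ?case using C[OF elim(1)] by linarith
  qed
qed

lemma indicator_fun_upper_leD:
  assumes le: "indicator_fun f (pi / 2) \<le> d" and f: "f holomorphic_on UNIV" and D: "d < ereal D"
  obtains C where "C > 0" "\<And>t. t \<ge> 0 \<Longrightarrow> cmod (f (of_real t * \<i>)) \<le> C * exp (D * t)"
proof -
  obtain T where T: "\<And>t. t \<ge> T \<Longrightarrow> cmod (f (of_real t * \<i>)) \<le> exp (D * t)"
    using le D unfolding indicator_fun_upper_le_iff eventually_at_top_linorder by blast
  have "continuous_on {0..T} (\<lambda>t. cmod (f (of_real t * \<i>)) / exp (D * t))"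
    by (intro continuous_intros continuous_on_compose2[OF holomorphic_on_imp_continuous_on[OF f]]) auto
  then have "bounded ((\<lambda>t. cmod (f (of_real t * \<i>)) / exp (D * t)) ` {0..T})"
    by (intro compact_imp_bounded compact_continuous_image) auto
  then obtain B where B: "\<And>t. 0 \<le> t \<Longrightarrow> t \<le> T \<Longrightarrow> cmod (f (of_real t * \<i>)) / exp (D * t) \<le> B"
    unfolding bounded_iff by fastforce
  have "cmod (f (of_real t * \<i>)) \<le> max B 1 * exp (D * t)" if "t \<ge> 0" for t
  proof (cases "t \<le> T")
    case True
    then have "cmod (f (of_real t * \<i>)) \<le> B * exp (D * t)" using B[OF that] by (simp add: field_simps)
    also have "\<dots> \<le> max B 1 * exp (D * t)" by (intro mult_right_mono) auto
    finally show ?thesis .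
  next
    case False
    then have "cmod (f (of_real t * \<i>)) \<le> 1 * exp (D * t)" using T[of t] by simp
    also have "\<dots> \<le> max B 1 * exp (D * t)" by (intro mult_right_mono) auto
    finally show ?thesis .
  qed
  then show ?thesis using that[of "max B 1"] by simp
qed

lemma minimal_type_mult_indicator:
  assumes "minimal_type \<rho>" "f holomorphic_on UNIV" "indicator_fun f (pi / 2) \<le> d"
  shows "indicator_fun (\<lambda>z. \<rho> z * f z) (pi / 2) \<le> d"
proof (rule indicator_fun_upper_leI)
  fix E assume "d < ereal E"
  then obtain D where D: "d < ereal D" "D < E" using ereal_dense2 by (metis ereal_less(2) ereal_less_eq(3) less_ereal.simps(1))
  obtain C where C: "C > 0" "\<And>t. t \<ge> 0 \<Longrightarrow> cmod (f (of_real t * \<i>)) \<le> C * exp (D * t)"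
    using indicator_fun_upper_leD[OF assms(3,2) D(1)] by blast
  obtain B where B: "\<And>z. cmod (\<rho> z) \<le> B * exp ((E - D) * cmod z)"
    using assms(1) D(2) unfolding minimal_type_def by (metis diff_gt_0_iff_gt)
  have "cmod (\<rho> (of_real t * \<i>) * f (of_real t * \<i>)) \<le> B * C * exp (E * t)" if "t \<ge> 0" for t
  proof -
    have "cmod (\<rho> (of_real t * \<i>)) \<le> B * exp ((E - D) * t)" using B[of "of_real t * \<i>"] that by (simp add: norm_mult)
    then have "cmod (\<rho> (of_real t * \<i>) * f (of_real t * \<i>)) \<le> (B * exp ((E - D) * t)) * (C * exp (D * t))"
      unfolding norm_mult using C(2)[OF that] by (intro mult_mono) (auto intro: order.trans[OF norm_ge_zero])
    also have "\<dots> = B * C * (exp ((E - D) * t) * exp (D * t))" by simp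
    also have "\<dots> = B * C * exp (E * t)" by (simp add: exp_add[symmetric] algebra_simps)
    finally show ?thesis .
  qed
  then show "\<exists>C. \<forall>t\<ge>0. cmod (\<rho> (of_real t * \<i>) * f (of_real t * \<i>)) \<le> C * exp (E * t)" by blast
qed

lemma minimal_type_reflect:
  assumes "minimal_type \<rho>"
  shows "minimal_type (\<lambda>z. \<rho> (- z))"
  unfolding minimal_type_def
proof (intro conjI allI impI)
  have "\<rho> \<circ> uminus holomorphic_on UNIV"
    by (rule holomorphic_on_compose_gen[of _ _ _ UNIV])
      (use assms in \<open>auto simp: minimal_type_def intro!: holomorphic_intros\<close>)
  then show "(\<lambda>z. \<rho> (- z)) holomorphic_on UNIV" by (simp add: o_def)
  fix \<epsilon> :: real assume "\<epsilon> > 0"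
  then obtain C where "\<And>z. cmod (\<rho> z) \<le> C * exp (\<epsilon> * cmod z)"
    using assms unfolding minimal_type_def by blast
  then have "\<forall>z. cmod (\<rho> (- z)) \<le> C * exp (\<epsilon> * cmod z)" by (metis norm_minus_cancel)
  then show "\<exists>C. \<forall>z. cmod (\<rho> (- z)) \<le> C * exp (\<epsilon> * cmod z)" by blast
qed

section \<open>Multiplicities as local estimates\<close>

lemma maximum_modulus_unit_ball:
  assumes "f holomorphic_on UNIV" "\<And>z. cmod (z - w) = 1 \<Longrightarrow> cmod (f z) \<le> B" "cmod (z - w) \<le> 1"
  shows "cmod (f z) \<le> B"
proof -
  have "cmod ((f \<circ> (\<lambda>u. w + u)) (z - w)) \<le> B"
  proof (rule maximum_modulus_ball[of "f \<circ> (\<lambda>u. w + u)" 2])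
    show "f \<circ> (\<lambda>u. w + u) holomorphic_on ball 0 2"
      by (rule holomorphic_on_compose_gen[OF _ assms(1)]) (auto intro!: holomorphic_intros)
  qed (use assms in auto)
  then show ?thesis by simp
qed

lemma vanishing_mult_factor:
  assumes f: "f holomorphic_on UNIV" "f \<noteq> (\<lambda>_. 0)"
  obtains h where "h holomorphic_on UNIV" "h w \<noteq> 0"
    "\<And>z. f z = (z - w) ^ nat (zorder f w) * h z" "vanishing_mult f w = enat (nat (zorder f w))"
proof -
  obtain h where h: "h holomorphic_on UNIV" "h w \<noteq> 0"
    "\<And>z. z \<in> UNIV \<Longrightarrow> f z = (z - w) ^ nat (zorder f w) * h z"
    by (rule holomorphic_factor_zero_global[OF f(1), of w]) (use f(2) in auto)
  then show ?thesis using that[of h] f(2) by (simp add: vanishing_mult_def)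
qed

text \<open>Schwarz-type argument: dividing by \<open>(z - w) ^ n\<close> does not change the
  modulus on the unit circle about \<open>w\<close>. The constant depends only on values on that
  circle, so it is uniform over a bounded family.\<close>

lemma vanishing_mult_bound:
  assumes f: "f holomorphic_on UNIV" and n: "enat n \<le> vanishing_mult f w"
    and B: "\<And>z. cmod (z - w) = 1 \<Longrightarrow> cmod (f z) \<le> B" and z: "cmod (z - w) \<le> 1"
  shows "cmod (f z) \<le> B * cmod (z - w) ^ n"
proof (cases "f = (\<lambda>_. 0)")
  case True
  have "0 \<le> B" by (rule order.trans[OF norm_ge_zero B[of "w + 1"]]) simp
  then show ?thesis using True by simp
next
  case False
  obtain h where h: "h holomorphic_on UNIV" "h w \<noteq> 0"
    "\<And>z. f z = (z - w) ^ nat (zorder f w) * h z" "vanishing_mult f w = enat (nat (zorder f w))"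
    using vanishing_mult_factor[OF f False] by blast
  define m where "m = nat (zorder f w)"
  have nm: "n \<le> m" using n h(4) by (simp add: m_def)
  define g where "g z = (z - w) ^ (m - n) * h z" for z
  have fg: "f z = (z - w) ^ n * g z" for z
    unfolding h(3) m_def[symmetric] g_def using nm by (simp add: power_add[symmetric] mult.assoc[symmetric])
  have "cmod (g z) \<le> B"
  proof (rule maximum_modulus_unit_ball[OF _ _ z])
    show "g holomorphic_on UNIV" unfolding g_def by (intro holomorphic_intros h)
    show "cmod (g z) \<le> B" if "cmod (z - w) = 1" for z
      using B[OF that] that by (simp add: fg norm_mult norm_power)
  qed
  then show ?thesis
    unfolding fg norm_mult norm_power by (simp add: mult.commute mult_right_mono)
qed

text \<open>Converse of the previous bound. Together they replace multiplicities by an inequality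
  that survives sums, products and pointwise limits.\<close>

lemma le_vanishing_multI:
  assumes f: "f holomorphic_on UNIV"
    and C: "\<And>z. cmod (z - w) \<le> 1 \<Longrightarrow> cmod (f z) \<le> C * cmod (z - w) ^ n"
  shows "enat n \<le> vanishing_mult f w"
proof (cases "f = (\<lambda>_. 0)")
  case False
  obtain h where h: "h holomorphic_on UNIV" "h w \<noteq> 0"
    "\<And>z. f z = (z - w) ^ nat (zorder f w) * h z" "vanishing_mult f w = enat (nat (zorder f w))"
    using vanishing_mult_factor[OF f False] by blast
  define m where "m = nat (zorder f w)"
  have "n \<le> m"
  proof (rule ccontr)
    assume "\<not> n \<le> m"
    then have mn: "n = m + (n - m)" "n - m > 0" by auto
    have bnd: "cmod (h z) \<le> C * cmod (z - w) ^ (n - m)" if "cmod (z - w) \<le> 1" "z \<noteq> w" for z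
    proof -
      have "cmod (z - w) ^ m * cmod (h z) \<le> cmod (z - w) ^ m * (C * cmod (z - w) ^ (n - m))"
        using C[OF that(1)] mn(1) by (simp add: h(3) m_def[symmetric] norm_mult norm_power power_add[symmetric] mult.left_commute)
      then show ?thesis using that(2) by (simp add: mult_le_cancel_left)
    qed
    have "((\<lambda>z. C * cmod (z - w) ^ (n - m)) \<longlongrightarrow> C * cmod (w - w) ^ (n - m)) (at w)"
      by (intro tendsto_intros)
    then have lim0: "((\<lambda>z. C * cmod (z - w) ^ (n - m)) \<longlongrightarrow> 0) (at w)" using mn by (simp add: power_0_left)
    have "eventually (\<lambda>z. norm (h z) \<le> C * cmod (z - w) ^ (n - m)) (at w)"
      unfolding eventually_at by (rule exI[of _ 1]) (auto simp: dist_norm intro!: bnd)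
    then have "(h \<longlongrightarrow> 0) (at w)" by (rule Lim_null_comparison[OF _ lim0])
    moreover have "(h \<longlongrightarrow> h w) (at w)"
      using holomorphic_on_imp_continuous_on[OF h(1)] by (simp add: continuous_on_def)
    ultimately show False using h(2) by (metis LIM_unique)
  qed
  then show ?thesis using h(4) by (simp add: m_def)
qed (simp add: vanishing_mult_def)

lemma holomorphic_bounded_sphere:
  assumes "f holomorphic_on UNIV"
  obtains B where "\<And>z. cmod (z - w) \<le> 1 \<Longrightarrow> cmod (f z) \<le> B"
proof -
  have "bounded (f ` cball w 1)"
    by (intro compact_imp_bounded compact_continuous_image
        continuous_on_subset[OF holomorphic_on_imp_continuous_on[OF assms]]) auto
  then obtain B where "\<forall>x\<in>f ` cball w 1. cmod x \<le> B" unfolding bounded_iff by blast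
  then show ?thesis using that[of B] by (simp add: dist_norm norm_minus_commute)
qed

lemma vanishing_mult_add:
  assumes f: "f holomorphic_on UNIV" and g: "g holomorphic_on UNIV"
    and n: "enat n \<le> vanishing_mult f w" "enat n \<le> vanishing_mult g w"
  shows "enat n \<le> vanishing_mult (\<lambda>z. f z + g z) w"
proof -
  obtain A where A: "\<And>z. cmod (z - w) \<le> 1 \<Longrightarrow> cmod (f z) \<le> A" using holomorphic_bounded_sphere[OF f] by blast
  obtain B where B: "\<And>z. cmod (z - w) \<le> 1 \<Longrightarrow> cmod (g z) \<le> B" using holomorphic_bounded_sphere[OF g] by blast
  show ?thesis
  proof (rule le_vanishing_multI)
    show "(\<lambda>z. f z + g z) holomorphic_on UNIV" by (intro holomorphic_intros f g)
    fix z assume z: "cmod (z - w) \<le> 1"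
    have "cmod (f z) \<le> A * cmod (z - w) ^ n" by (rule vanishing_mult_bound[OF f n(1) _ z]) (use A in auto)
    moreover have "cmod (g z) \<le> B * cmod (z - w) ^ n" by (rule vanishing_mult_bound[OF g n(2) _ z]) (use B in auto)
    ultimately show "cmod (f z + g z) \<le> (A + B) * cmod (z - w) ^ n"
      using norm_triangle_ineq[of "f z" "g z"] by (simp add: distrib_right)
  qed
qed

lemma vanishing_mult_mult:
  assumes f: "f holomorphic_on UNIV" and g: "g holomorphic_on UNIV" and n: "enat n \<le> vanishing_mult f w"
  shows "enat n \<le> vanishing_mult (\<lambda>z. g z * f z) w"
proof -
  obtain A where A: "\<And>z. cmod (z - w) \<le> 1 \<Longrightarrow> cmod (f z) \<le> A" using holomorphic_bounded_sphere[OF f] by blast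
  obtain B where B: "\<And>z. cmod (z - w) \<le> 1 \<Longrightarrow> cmod (g z) \<le> B" using holomorphic_bounded_sphere[OF g] by blast
  show ?thesis
  proof (rule le_vanishing_multI)
    show "(\<lambda>z. g z * f z) holomorphic_on UNIV" by (intro holomorphic_intros f g)
    fix z assume z: "cmod (z - w) \<le> 1"
    have "cmod (f z) \<le> A * cmod (z - w) ^ n" by (rule vanishing_mult_bound[OF f n _ z]) (use A in auto)
    then have "cmod (g z) * cmod (f z) \<le> B * (A * cmod (z - w) ^ n)"
      using B[OF z] by (intro mult_mono) (auto intro: order.trans[OF norm_ge_zero])
    then show "cmod (g z * f z) \<le> (B * A) * cmod (z - w) ^ n" by (simp add: norm_mult mult.assoc)
  qed
qed

context weight_space
begin

section \<open>Half-plane bounds through the majorant\<close>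

lemma wbound_reflect:
  assumes "wbound k M f"
  shows "wbound k M (\<lambda>z. f (- z))"
  unfolding wbound_def
proof (intro conjI allI)
  have "f \<circ> uminus holomorphic_on UNIV"
    by (rule holomorphic_on_compose_gen[of _ _ _ UNIV])
      (use assms in \<open>auto simp: wbound_def intro!: holomorphic_intros\<close>)
  then show "(\<lambda>z. f (- z)) holomorphic_on UNIV" by (simp add: o_def)
  show "cmod (f (- z)) \<le> M * exp (r k * \<omega> (cmod z) + c k * \<bar>Im z\<bar>)" for z
    using wboundD(2)[OF assms, of "- z"] by simp
qed

lemma wbound_upper_half_plane:
  assumes f: "wbound k M f" and z: "Im z \<ge> 0"
  shows "cmod (f z) \<le> M * exp (\<omega> 1) * exp (Re (majorant z) + c k * Im z)"
proof -
  have "r k * \<omega> (cmod z) \<le> 1 * \<omega> (cmod z)"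
    using r_less[of k] weight_nonneg[of "cmod z"] by (intro mult_right_mono) auto
  then have "r k * \<omega> (cmod z) + c k * \<bar>Im z\<bar> \<le> \<omega> 1 + (Re (majorant z) + c k * Im z)"
    using Re_majorant(2)[OF z] z by simp
  then have "M * exp (r k * \<omega> (cmod z) + c k * \<bar>Im z\<bar>) \<le> M * exp (\<omega> 1 + (Re (majorant z) + c k * Im z))"
    using wbound_nonneg[OF f] by (intro mult_left_mono) auto
  also have "\<dots> = M * exp (\<omega> 1) * exp (Re (majorant z) + c k * Im z)" by (simp add: exp_add)
  finally show ?thesis using wboundD(2)[OF f, of z] by linarith
qed

lemma wbound_indicator_le: "wbound k M f \<Longrightarrow> indicator_fun f (pi / 2) \<le> ereal (c k)"
proof (rule indicator_fun_upper_leI)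
  fix D assume f: "wbound k M f" and D: "ereal (c k) < ereal D"
  define \<epsilon> where "\<epsilon> = D - c k"
  have "\<epsilon> > 0" using D by (simp add: \<epsilon>_def)
  then obtain C where C: "\<And>z. Im z \<ge> 0 \<Longrightarrow> Re (majorant z) \<le> \<epsilon> * cmod z + C" using Re_majorant_small by blast
  have "cmod (f (of_real t * \<i>)) \<le> M * exp (\<omega> 1) * exp C * exp (D * t)" if t: "t \<ge> 0" for t
  proof -
    have "Re (majorant (of_real t * \<i>)) + c k * t \<le> C + D * t"
      using C[of "of_real t * \<i>"] t by (simp add: norm_mult \<epsilon>_def algebra_simps)
    then have "M * exp (\<omega> 1) * exp (Re (majorant (of_real t * \<i>)) + c k * t) \<le> M * exp (\<omega> 1) * exp (C + D * t)"
      using wbound_nonneg[OF f] by (intro mult_left_mono) auto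
    then show ?thesis using wbound_upper_half_plane[OF f, of "of_real t * \<i>"] t by (simp add: exp_add)
  qed
  then show "\<exists>C. \<forall>t\<ge>0. cmod (f (of_real t * \<i>)) \<le> C * exp (D * t)" by blast
qed

text \<open>The bound does not depend on the individual function: this is what makes the set of functions with
  indicator at most \<open>D\<close> closed.\<close>

lemma wbound_indicator_upper_half_plane:
  assumes f: "wbound k M f" and D: "indicator_fun f (pi / 2) \<le> ereal D" and z: "Im z \<ge> 0"
  shows "cmod (f z) \<le> M * exp (\<omega> 1) * exp (Re (majorant z) + D * Im z)"
proof (cases "M = 0")
  case True
  then show ?thesis using wboundD(2)[OF f, of z] by simp
next
  case False
  then have M: "M > 0" using wbound_nonneg[OF f] by simp
  have key: "cmod (f z) \<le> M * exp (\<omega> 1) * exp (Re (majorant z) + E * Im z)" if E: "E > D" for E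
  proof -
    \<comment> \<open>The factor cancels the majorant and the exponential exactly, leaving on the
      real axis only the bound given by the step.\<close>
    define F where "F z = f z * exp (- majorant z + \<i> * of_real E * z)" for z
    have normF: "cmod (F z) = cmod (f z) * exp (- Re (majorant z) - E * Im z)" for z
      by (simp add: F_def norm_mult norm_exp_eq_Re)
    obtain C where C: "C > 0" "\<And>t. t \<ge> 0 \<Longrightarrow> cmod (f (of_real t * \<i>)) \<le> C * exp (E * t)"
      using indicator_fun_upper_leD[OF D wboundD(1)[OF f], of E] E by auto
    have Fle: "cmod (F z) \<le> M * exp (\<omega> 1) * exp ((c k - E) * Im z)" if "Im z \<ge> 0" for z
    proof -
      have "cmod (F z) \<le> (M * exp (\<omega> 1) * exp (Re (majorant z) + c k * Im z)) * exp (- Re (majorant z) - E * Im z)"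
        unfolding normF by (rule mult_right_mono[OF wbound_upper_half_plane[OF f that]]) simp
      also have "\<dots> = M * exp (\<omega> 1) * exp ((c k - E) * Im z)"
        by (simp add: exp_add[symmetric] mult.assoc algebra_simps)
      finally show ?thesis .
    qed
    \<comment> \<open>The constant \<open>C\<close> on the imaginary axis depends on
      \<open>f\<close>; the half-plane principle needs it to exist but leaves no trace of it in the
      conclusion.\<close>
    have "cmod (F z) \<le> M * exp (\<omega> 1)"
    proof (rule phragmen_lindelof_half_plane[of F "{z. Im z > - 1 / 2}" "M * exp (\<omega> 1)" "\<bar>c k - E\<bar>" _ C])
      show "F holomorphic_on {z. Im z > - 1 / 2}"
        unfolding F_def by (intro holomorphic_intros holomorphic_majorant holomorphic_on_subset[OF wboundD(1)[OF f]]) auto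
      show "open {z. Im z > - 1 / 2}" by (intro open_Collect_less continuous_intros)
      show "cmod (F z) \<le> M * exp (\<omega> 1) * exp (\<bar>c k - E\<bar> * cmod z)" if "Im z \<ge> 0" for z
      proof -
        have "(c k - E) * Im z \<le> \<bar>c k - E\<bar> * cmod z"
          using that abs_Im_le_cmod[of z] by (intro mult_mono) auto
        then have "M * exp (\<omega> 1) * exp ((c k - E) * Im z) \<le> M * exp (\<omega> 1) * exp (\<bar>c k - E\<bar> * cmod z)"
          using M by simp
        then show ?thesis using Fle[OF that] by linarith
      qed
      show "cmod (F (of_real x)) \<le> M * exp (\<omega> 1)" for x using Fle[of "of_real x"] by simp
      show "cmod (F (\<i> * of_real y)) \<le> C" if "y \<ge> 0" for y
      proof -
        have "cmod (F (\<i> * of_real y)) \<le> (C * exp (E * y)) * exp (- E * y)"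
          unfolding normF
        proof (rule mult_mono)
          show "cmod (f (\<i> * of_real y)) \<le> C * exp (E * y)" using C(2)[OF that] by (simp add: mult.commute)
          show "exp (- Re (majorant (\<i> * of_real y)) - E * Im (\<i> * of_real y)) \<le> exp (- E * y)"
            using Re_majorant(1)[of "\<i> * of_real y"] that by simp
        qed (use C(1) in auto)
        then show ?thesis by (simp add: exp_add[symmetric] mult.assoc)
      qed
    qed (use M z in auto)
    then have "cmod (f z) * exp (- (Re (majorant z) + E * Im z)) \<le> M * exp (\<omega> 1)"
      unfolding normF by simp
    then have "cmod (f z) * inverse (exp (Re (majorant z) + E * Im z)) \<le> M * exp (\<omega> 1)"
      unfolding exp_minus .
    then show ?thesis by (simp add: divide_le_eq divide_inverse[symmetric])
  qed
  have "((\<lambda>E. M * exp (\<omega> 1) * exp (Re (majorant z) + E * Im z)) \<longlongrightarrow> M * exp (\<omega> 1) * exp (Re (majorant z) + D * Im z)) (at_right D)"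
    by (intro tendsto_intros)
  then show ?thesis
    by (intro tendsto_lowerbound[OF _ _ trivial_limit_at_right_real])
      (auto intro!: eventually_mono[OF eventually_at_right_less] key)
qed

text \<open>The converse direction: the majorant is negligible against \<open>cmod z\<close>, so it
  does not affect the indicator.\<close>

lemma indicator_fun_upper_leI_half_plane:
  assumes "\<And>z. Im z \<ge> 0 \<Longrightarrow> cmod (f z) \<le> A * exp (Re (majorant z) + D * Im z)"
  shows "indicator_fun f (pi / 2) \<le> ereal D"
proof (rule indicator_fun_upper_leI)
  fix E assume "ereal D < ereal E"
  then have E: "E - D > 0" by simp
  obtain C where C: "\<And>z. Im z \<ge> 0 \<Longrightarrow> Re (majorant z) \<le> (E - D) * cmod z + C" using Re_majorant_small[OF E] by blast
  have A: "A \<ge> 0"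
  proof -
    have "0 \<le> A * exp (Re (majorant 0) + D * Im 0)" by (rule order.trans[OF norm_ge_zero assms]) simp
    then show ?thesis by (simp add: zero_le_mult_iff)
  qed
  have "cmod (f (of_real t * \<i>)) \<le> A * exp C * exp (E * t)" if t: "t \<ge> 0" for t
  proof -
    have "Re (majorant (of_real t * \<i>)) + D * t \<le> C + E * t"
      using C[of "of_real t * \<i>"] t by (simp add: norm_mult algebra_simps)
    then have "A * exp (Re (majorant (of_real t * \<i>)) + D * t) \<le> A * exp (C + E * t)"
      using A by (intro mult_left_mono) auto
    then show ?thesis using assms[of "of_real t * \<i>"] t by (simp add: exp_add)
  qed
  then show "\<exists>C. \<forall>t\<ge>0. cmod (f (of_real t * \<i>)) \<le> C * exp (E * t)" by blast
qed

text \<open>The gap \<open>r m - r k\<close> pays for polynomial factors and for shifts of the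
  argument.\<close>

lemma exists_larger_r: obtains m where "k \<le> m" "r k < r m"
proof -
  have "eventually (\<lambda>m. r k < r m) sequentially"
    by (rule order_tendstoD(1)[OF r_lim r_less])
  then obtain N where "\<And>m. m \<ge> N \<Longrightarrow> r k < r m" unfolding eventually_sequentially by blast
  then show ?thesis using that[of "N + k"] by simp
qed

lemma poly_le_exp_weight:
  fixes p :: "complex poly"
  assumes "\<epsilon> > 0"
  obtains C where "C \<ge> 0" "\<And>z. cmod (poly p z) \<le> C * exp (\<epsilon> * \<omega> (cmod z))"
proof -
  have "\<exists>C. C \<ge> 0 \<and> (\<forall>x\<ge>0. x ^ i \<le> C * exp (\<epsilon> * \<omega> x))" for i
    using power_le_exp_weight[OF assms, of i] by metis
  then obtain C where C: "\<And>i. C i \<ge> 0" "\<And>i x. x \<ge> 0 \<Longrightarrow> x ^ i \<le> C i * exp (\<epsilon> * \<omega> x)" by metis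
  define B where "B = (\<Sum>i\<le>degree p. cmod (coeff p i) * C i)"
  have "cmod (poly p z) \<le> B * exp (\<epsilon> * \<omega> (cmod z))" for z
  proof -
    have "cmod (poly p z) \<le> (\<Sum>i\<le>degree p. cmod (coeff p i * z ^ i))"
      unfolding poly_altdef by (rule norm_sum)
    also have "\<dots> \<le> (\<Sum>i\<le>degree p. cmod (coeff p i) * (C i * exp (\<epsilon> * \<omega> (cmod z))))"
      unfolding norm_mult norm_power by (intro sum_mono mult_left_mono C) auto
    also have "\<dots> = B * exp (\<epsilon> * \<omega> (cmod z))"
      by (simp add: B_def sum_distrib_right mult.assoc)
    finally show ?thesis .
  qed
  moreover have "B \<ge> 0" unfolding B_def by (intro sum_nonneg mult_nonneg_nonneg C) auto
  ultimately show ?thesis using that by blast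
qed

lemma poly_mult_Pa:
  fixes p :: "complex poly"
  assumes "f \<in> Pa \<omega> c r"
  shows "(\<lambda>z. poly p z * f z) \<in> Pa \<omega> c r"
proof -
  obtain k M where f: "wbound k M f" using assms by (auto simp: Pa_iff)
  obtain m where m: "k \<le> m" "r k < r m" using exists_larger_r by blast
  obtain C where C: "C \<ge> 0" "\<And>z. cmod (poly p z) \<le> C * exp ((r m - r k) * \<omega> (cmod z))"
    using poly_le_exp_weight[of "r m - r k" p] m(2) by auto
  have "wbound m (C * M) (\<lambda>z. poly p z * f z)"
    unfolding wbound_def
  proof (intro conjI allI)
    show "(\<lambda>z. poly p z * f z) holomorphic_on UNIV" by (intro holomorphic_intros wboundD(1)[OF f])
    fix z
    have "cmod (poly p z * f z) \<le> (C * exp ((r m - r k) * \<omega> (cmod z))) * (M * exp (r k * \<omega> (cmod z) + c k * \<bar>Im z\<bar>))"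
      unfolding norm_mult using C wboundD(2)[OF f] by (intro mult_mono) auto
    also have "\<dots> = C * M * exp (r m * \<omega> (cmod z) + c k * \<bar>Im z\<bar>)"
    proof -
      have "r m * \<omega> (cmod z) + c k * \<bar>Im z\<bar> = (r m - r k) * \<omega> (cmod z) + (r k * \<omega> (cmod z) + c k * \<bar>Im z\<bar>)"
        by (simp add: algebra_simps)
      then show ?thesis by (simp only: exp_add) simp
    qed
    also have "\<dots> \<le> C * M * exp (r m * \<omega> (cmod z) + c m * \<bar>Im z\<bar>)"
      using C(1) wbound_nonneg[OF f] inc_c m(1) by (intro mult_left_mono) (auto simp: incseq_def mult_right_mono)
    finally show "cmod (poly p z * f z) \<le> C * M * exp (r m * \<omega> (cmod z) + c m * \<bar>Im z\<bar>)" .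
  qed
  then show ?thesis by (auto simp: Pa_iff)
qed

lemma minimal_type_poly: "minimal_type (poly p)"
  unfolding minimal_type_def
proof (intro conjI allI impI)
  show "poly p holomorphic_on UNIV" by (intro holomorphic_intros)
  fix \<epsilon> :: real assume e: "\<epsilon> > 0"
  obtain C where C: "C \<ge> 0" "\<And>z. cmod (poly p z) \<le> C * exp (1 * \<omega> (cmod z))"
    using poly_le_exp_weight[of 1 p] by auto
  obtain B where B: "\<And>x. x \<ge> 0 \<Longrightarrow> \<omega> x \<le> \<epsilon> * x + B" using weight_small[OF e] by blast
  have "cmod (poly p z) \<le> C * exp B * exp (\<epsilon> * cmod z)" for z
  proof -
    have "C * exp (1 * \<omega> (cmod z)) \<le> C * exp (\<epsilon> * cmod z + B)"
      using B[of "cmod z"] C(1) by (intro mult_left_mono) auto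
    then show ?thesis using C(2)[of z] by (simp add: exp_add mult_ac)
  qed
  then show "\<exists>C. \<forall>z. cmod (poly p z) \<le> C * exp (\<epsilon> * cmod z)" by blast
qed

section \<open>Spectral hulls and the direct implication\<close>

text \<open>\<open>e\<close> is the negative of the lower endpoint, so both indicator conditions are
  upper bounds exchanged by reflection. Testing multiplicities with finite \<open>n\<close> gives
  the form in which they pass to limits.\<close>

definition spectral_hull :: "(complex \<Rightarrow> enat) \<Rightarrow> ereal \<Rightarrow> ereal \<Rightarrow> (complex \<Rightarrow> complex) set" where
  "spectral_hull N d e = {f \<in> Pa \<omega> c r. (\<forall>w n. enat n \<le> N w \<longrightarrow> enat n \<le> vanishing_mult f w) \<and>
     indicator_fun f (pi / 2) \<le> d \<and> indicator_fun f (- pi / 2) \<le> e}"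

lemma Pa_holomorphic: "f \<in> Pa \<omega> c r \<Longrightarrow> f holomorphic_on UNIV"
  by (auto simp: Pa_iff dest: wboundD)

lemma Pa_reflect: "f \<in> Pa \<omega> c r \<Longrightarrow> (\<lambda>z. f (- z)) \<in> Pa \<omega> c r"
  using wbound_reflect unfolding Pa_iff by meson

lemma indicator_fun_upper_add:
  assumes "f holomorphic_on UNIV" "g holomorphic_on UNIV" "indicator_fun f (pi / 2) \<le> d" "indicator_fun g (pi / 2) \<le> d"
  shows "indicator_fun (\<lambda>z. f z + g z) (pi / 2) \<le> d"
proof (rule indicator_fun_upper_leI)
  fix D assume D: "d < ereal D"
  obtain A where A: "\<And>t. t \<ge> 0 \<Longrightarrow> cmod (f (of_real t * \<i>)) \<le> A * exp (D * t)"
    using indicator_fun_upper_leD[OF assms(3,1) D] by blast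
  obtain B where B: "\<And>t. t \<ge> 0 \<Longrightarrow> cmod (g (of_real t * \<i>)) \<le> B * exp (D * t)"
    using indicator_fun_upper_leD[OF assms(4,2) D] by blast
  have "cmod (f (of_real t * \<i>) + g (of_real t * \<i>)) \<le> (A + B) * exp (D * t)" if "t \<ge> 0" for t
    using A[OF that] B[OF that] norm_triangle_ineq[of "f (of_real t * \<i>)" "g (of_real t * \<i>)"]
    unfolding distrib_right by linarith
  then show "\<exists>C. \<forall>t\<ge>0. cmod (f (of_real t * \<i>) + g (of_real t * \<i>)) \<le> C * exp (D * t)" by blast
qed

lemma indicator_fun_upper_limit:
  assumes F: "\<And>n. wbound k M (F n)" "\<And>n. indicator_fun (F n) (pi / 2) \<le> d" and lim: "\<And>z. (\<lambda>n. F n z) \<longlonglongrightarrow> f z"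
  shows "indicator_fun f (pi / 2) \<le> d"
proof (rule ccontr)
  assume "\<not> ?thesis"
  \<comment> \<open>\<open>d\<close> may be infinite; the half-plane estimate needs a real number
    above it.\<close>
  then obtain D where D: "d < ereal D" "ereal D < indicator_fun f (pi / 2)"
    using ereal_dense2 by (metis not_le)
  have "indicator_fun f (pi / 2) \<le> ereal D"
  proof (rule indicator_fun_upper_leI_half_plane)
    fix z assume z: "Im z \<ge> 0"
    have "indicator_fun (F n) (pi / 2) \<le> ereal D" for n
      using F(2)[of n] D(1) by (meson less_imp_le order.trans)
    then have "cmod (F n z) \<le> M * exp (\<omega> 1) * exp (Re (majorant z) + D * Im z)" for n
      using wbound_indicator_upper_half_plane[OF F(1) _ z] by blast
    then show "cmod (f z) \<le> (M * exp (\<omega> 1)) * exp (Re (majorant z) + D * Im z)"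
      by (intro LIMSEQ_le_const2[OF tendsto_norm[OF lim]]) auto
  qed
  then show False using D(2) by simp
qed

lemma closed_submodule_spectral_hull: "closed_submodule \<omega> c r (spectral_hull N d e)"
  unfolding closed_submodule_def
proof (intro conjI ballI allI)
  show "(\<lambda>_. 0) \<in> spectral_hull N d e"
  proof -
    have "indicator_fun (\<lambda>_. 0) (pi / 2) \<le> d" for d
      by (rule indicator_fun_upper_leI) (auto intro: exI[of _ 0])
    then show ?thesis
      using complex_subspaceD(1)[OF complex_subspace_Pa]
      unfolding spectral_hull_def indicator_fun_lower by (simp add: vanishing_mult_def)
  qed
  show "(\<lambda>z. f z + g z) \<in> spectral_hull N d e" if f: "f \<in> spectral_hull N d e" and g: "g \<in> spectral_hull N d e" for f g
    using f g complex_subspaceD(2)[OF complex_subspace_Pa, of f g] Pa_holomorphic Pa_holomorphic[OF Pa_reflect]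
    unfolding spectral_hull_def indicator_fun_lower
    by (auto intro!: vanishing_mult_add indicator_fun_upper_add)
  show "(\<lambda>z. poly p z * f z) \<in> spectral_hull N d e" if f: "f \<in> spectral_hull N d e" for f and p :: "complex poly"
  proof -
    have fP: "f \<in> Pa \<omega> c r" using f by (simp add: spectral_hull_def)
    have "indicator_fun (\<lambda>z. poly p z * f z) (pi / 2) \<le> d"
      by (rule minimal_type_mult_indicator[OF minimal_type_poly Pa_holomorphic[OF fP]])
        (use f in \<open>simp add: spectral_hull_def\<close>)
    moreover have "indicator_fun (\<lambda>z. poly p (- z) * f (- z)) (pi / 2) \<le> e"
      by (rule minimal_type_mult_indicator[OF minimal_type_reflect[OF minimal_type_poly] Pa_holomorphic[OF Pa_reflect[OF fP]]])
        (use f in \<open>simp only: spectral_hull_def indicator_fun_lower mem_Collect_eq\<close>)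
    moreover have "enat n \<le> vanishing_mult (\<lambda>z. poly p z * f z) w" if "enat n \<le> N w" for n w
      by (rule vanishing_mult_mult[OF Pa_holomorphic[OF fP]]) (use f that in \<open>auto simp: spectral_hull_def intro!: holomorphic_intros\<close>)
    ultimately show ?thesis
      unfolding spectral_hull_def indicator_fun_lower using poly_mult_Pa[OF fP] by blast
  qed
  show "closedin (Pa_topology \<omega> c r) (spectral_hull N d e)"
  proof (rule closedin_if_bounded_limits)
    show "spectral_hull N d e \<subseteq> Pa \<omega> c r" by (auto simp: spectral_hull_def)
    fix k M F f assume F: "\<And>n. F n \<in> spectral_hull N d e" "\<And>n. wbound k M (F n)" and lim: "\<And>z. (\<lambda>n. F n z) \<longlonglongrightarrow> f z"
    \<comment> \<open>Pointwise convergence alone does not give a holomorphic limit; the ball bound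
      does, by Montel.\<close>
    obtain g s where g: "wbound k M g" "strict_mono (s :: nat \<Rightarrow> nat)" "\<And>z. (\<lambda>n. F (s n) z) \<longlonglongrightarrow> g z"
      using wbound_montel[of k M F] F(2) by blast
    have "f z = g z" for z
      using LIMSEQ_subseq_LIMSEQ[OF lim[of z] g(2)] g(3)[of z] by (auto simp: o_def intro: LIMSEQ_unique)
    then have f: "wbound k M f" using g(1) by presburger
    have "indicator_fun f (pi / 2) \<le> d"
      by (rule indicator_fun_upper_limit[OF F(2) _ lim]) (use F(1) in \<open>simp add: spectral_hull_def\<close>)
    moreover have "indicator_fun (\<lambda>z. f (- z)) (pi / 2) \<le> e"
    proof (rule indicator_fun_upper_limit[where F = "\<lambda>n z. F n (- z)" and M = M and k = k])
      show "indicator_fun (\<lambda>z. F n (- z)) (pi / 2) \<le> e" for n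
        using F(1)[of n] unfolding spectral_hull_def indicator_fun_lower by blast
    qed (use F(2) lim wbound_reflect in auto)
    moreover have "enat n \<le> vanishing_mult f w" if n: "enat n \<le> N w" for n w
    proof (rule le_vanishing_multI[OF wboundD(1)[OF f]])
      \<comment> \<open>A bound on the unit circle about \<open>w\<close> common to all members of
        the sequence.\<close>
      define B where "B = M * exp (r k * \<omega> (cmod w + 1) + c k * (cmod w + 1))"
      have FB: "cmod (F j z) \<le> B" if "cmod (z - w) = 1" for j z
      proof -
        have z: "cmod z \<le> cmod w + 1" using norm_triangle_ineq2[of z w] that by linarith
        have "r k * \<omega> (cmod z) + c k * \<bar>Im z\<bar> \<le> r k * \<omega> (cmod w + 1) + c k * (cmod w + 1)"
          using r_pos[of k] c_pos[of k] order.trans[OF abs_Im_le_cmod z]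
          by (intro add_mono mult_left_mono weight_mono z) auto
        then have "M * exp (r k * \<omega> (cmod z) + c k * \<bar>Im z\<bar>) \<le> B"
          unfolding B_def using wbound_nonneg[OF f] by (intro mult_left_mono) auto
        then show ?thesis using wboundD(2)[OF F(2)[of j], of z] by linarith
      qed
      fix z assume z: "cmod (z - w) \<le> 1"
      have "cmod (F j z) \<le> B * cmod (z - w) ^ n" for j
        by (rule vanishing_mult_bound[OF wboundD(1)[OF F(2)] _ FB z]) (use F(1)[of j] n in \<open>auto simp: spectral_hull_def\<close>)
      then show "cmod (f z) \<le> B * cmod (z - w) ^ n"
        by (intro LIMSEQ_le_const2[OF tendsto_norm[OF lim]]) auto
    qed
    ultimately show "f \<in> spectral_hull N d e"
      using f unfolding spectral_hull_def indicator_fun_lower Pa_iff by blast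
  qed
qed

text \<open>The hull of the data of \<open>J\<close> contains \<open>J\<close> and has exactly the
  same zero set and indicator segment, so maximality identifies the two.\<close>

lemma weakly_localisable_imp:
  assumes J: "weakly_localisable \<omega> c r J" and \<phi>: "\<phi> \<in> J" "\<phi> \<noteq> (\<lambda>_. 0)"
  shows "multiplier_submodule \<omega> c r \<phi> \<subseteq> J"
proof -
  have Jc: "closed_submodule \<omega> c r J" using J by (simp add: weakly_localisable_def)
  have JPa: "J \<subseteq> Pa \<omega> c r" by (rule closed_submodule_subspace(2)[OF Jc])
  define d where "d = (SUP \<phi>\<in>J - {\<lambda>_. 0}. ind_upper \<phi>)"
  define b where "b = (INF \<phi>\<in>J - {\<lambda>_. 0}. ind_lower \<phi>)"
  define H where "H = spectral_hull (zero_set_mult J) d (- b)"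
  have ind: "indicator_fun f (pi / 2) \<le> d" "indicator_fun f (- pi / 2) \<le> - b" if "f \<in> J" "f \<noteq> (\<lambda>_. 0)" for f
  proof -
    show "indicator_fun f (pi / 2) \<le> d"
      unfolding d_def using that by (auto intro!: SUP_upper simp flip: ind_upper_def)
    have "b \<le> ind_lower f" unfolding b_def using that by (auto intro!: INF_lower)
    then show "indicator_fun f (- pi / 2) \<le> - b"
      unfolding ind_lower_def using ereal_minus_le_minus ereal_uminus_uminus by metis
  qed
  have zero: "(\<lambda>_. 0) \<in> H" using closed_submodule_spectral_hull[of "zero_set_mult J" d "- b"] unfolding H_def closed_submodule_def by blast
  have vm: "zero_set_mult J w \<le> vanishing_mult f w" if "f \<in> J" for f w
    unfolding zero_set_mult_def using that by (rule INF_lower)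
  have JH: "J \<subseteq> H"
  proof
    fix f assume f: "f \<in> J"
    show "f \<in> H"
    proof (cases "f = (\<lambda>_. 0)")
      case False
      then show ?thesis using f JPa ind[OF f False] vm[OF f] unfolding H_def spectral_hull_def by (auto intro: order.trans)
    qed (use zero in simp)
  qed
  have "H = J"
  proof -
    have "H \<noteq> {\<lambda>_. 0}" using JH \<phi> by blast
    moreover have "zero_set_mult H = zero_set_mult J"
    proof
      fix w
      have "zero_set_mult J w \<le> vanishing_mult f w" if f: "f \<in> H" for f
      proof -
        have *: "enat n \<le> vanishing_mult f w" if "enat n \<le> zero_set_mult J w" for n
          using f that by (simp add: H_def spectral_hull_def)
        show ?thesis
        proof (cases "zero_set_mult J w")
          \<comment> \<open>A nonzero \<open>\<phi>\<close> has finite multiplicity, which excludes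
            this case.\<close>
          case infinity
          then show ?thesis using vm[OF \<phi>(1), of w] \<phi>(2) by (simp add: vanishing_mult_def)
        qed (use * in simp)
      qed
      then have "zero_set_mult J w \<le> zero_set_mult H w"
        unfolding zero_set_mult_def[of H] by (intro INF_greatest)
      moreover have "zero_set_mult H w \<le> zero_set_mult J w"
        unfolding zero_set_mult_def by (rule INF_superset_mono[OF JH]) simp
      ultimately show "zero_set_mult H w = zero_set_mult J w" by simp
    qed
    moreover have "indicator_segment H = indicator_segment J"
    proof -
      have "(SUP \<phi>\<in>H - {\<lambda>_. 0}. ind_upper \<phi>) = d"
      proof (rule antisym)
        show "(SUP \<phi>\<in>H - {\<lambda>_. 0}. ind_upper \<phi>) \<le> d"
          by (rule SUP_least) (simp add: ind_upper_def H_def spectral_hull_def)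
        show "d \<le> (SUP \<phi>\<in>H - {\<lambda>_. 0}. ind_upper \<phi>)"
          unfolding d_def by (rule SUP_subset_mono) (use JH in auto)
      qed
      moreover have "(INF \<phi>\<in>H - {\<lambda>_. 0}. ind_lower \<phi>) = b"
      proof (rule antisym)
        show "b \<le> (INF \<phi>\<in>H - {\<lambda>_. 0}. ind_lower \<phi>)"
        proof (rule INF_greatest)
          fix f assume "f \<in> H - {\<lambda>_. 0}"
          then have "indicator_fun f (- pi / 2) \<le> - b" by (simp add: H_def spectral_hull_def)
          then show "b \<le> ind_lower f" unfolding ind_lower_def using ereal_minus_le_minus ereal_uminus_uminus by metis
        qed
        show "(INF \<phi>\<in>H - {\<lambda>_. 0}. ind_lower \<phi>) \<le> b"
          unfolding b_def by (rule INF_superset_mono) (use JH in auto)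
      qed
      ultimately show ?thesis by (simp add: indicator_segment_def d_def b_def)
    qed
    ultimately show ?thesis
      using J JH closed_submodule_spectral_hull unfolding weakly_localisable_def H_def by blast
  qed
  moreover have "multiplier_submodule \<omega> c r \<phi> \<subseteq> H"
  proof
    fix \<psi> assume "\<psi> \<in> multiplier_submodule \<omega> c r \<phi>"
    then obtain \<rho> where \<rho>: "\<psi> \<in> Pa \<omega> c r" "minimal_type \<rho>" "\<psi> = (\<lambda>z. \<rho> z * \<phi> z)"
      by (auto simp: multiplier_submodule_def)
    have \<phi>P: "\<phi> \<in> Pa \<omega> c r" using \<phi> JPa by blast
    have \<phi>H: "\<phi> \<in> H" using \<phi> JH by blast
    have "indicator_fun \<psi> (pi / 2) \<le> d"
      unfolding \<rho>(3) by (rule minimal_type_mult_indicator[OF \<rho>(2) Pa_holomorphic[OF \<phi>P] ind(1)[OF \<phi>]])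
    moreover have "indicator_fun \<psi> (- pi / 2) \<le> - b"
      unfolding \<rho>(3) indicator_fun_lower
      by (rule minimal_type_mult_indicator[OF minimal_type_reflect[OF \<rho>(2)] Pa_holomorphic[OF Pa_reflect[OF \<phi>P]]])
        (use ind(2)[OF \<phi>] in \<open>simp only: indicator_fun_lower\<close>)
    moreover have "enat n \<le> vanishing_mult \<psi> w" if "enat n \<le> zero_set_mult J w" for n w
      unfolding \<rho>(3)
      by (rule vanishing_mult_mult[OF Pa_holomorphic[OF \<phi>P]])
        (use \<rho>(2) \<phi>H that in \<open>auto simp: H_def spectral_hull_def minimal_type_def\<close>)
    ultimately show "\<psi> \<in> H" using \<rho>(1) by (simp add: H_def spectral_hull_def)
  qed
  ultimately show ?thesis by simp
qed

end

section \<open>Entire functions\<close>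

lemma holomorphic_divide_zero:
  assumes "f holomorphic_on UNIV" "f w = 0"
  shows "divide_zero f w holomorphic_on UNIV"
  by (rule pole_theorem_open_0[OF assms(1) open_UNIV, of w]) (use assms(2) in \<open>auto simp: divide_zero_def\<close>)

lemma mult_divide_zero: "f w = 0 \<Longrightarrow> f z = (z - w) * divide_zero f w z"
  by (simp add: divide_zero_def)

lemma divide_zero_linear:
  assumes "f holomorphic_on UNIV" "g holomorphic_on UNIV"
  shows "divide_zero (\<lambda>z. a * f z + b * g z) w z = a * divide_zero f w z + b * divide_zero g w z"
proof (cases "z = w")
  case True
  have "(f has_field_derivative deriv f w) (at w)" "(g has_field_derivative deriv g w) (at w)"
    using assms by (auto intro: holomorphic_derivI)
  then have "((\<lambda>z. a * f z + b * g z) has_field_derivative a * deriv f w + b * deriv g w) (at w)"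
    by (auto intro!: derivative_eq_intros)
  then show ?thesis using True by (simp add: divide_zero_def DERIV_imp_deriv)
qed (simp add: divide_zero_def add_divide_distrib)

lemma divide_zero_shift:
  assumes "f holomorphic_on UNIV"
  shows "divide_zero (\<lambda>z. z * f z) w z = f z + w * divide_zero f w z"
proof (cases "z = w")
  case True
  have "(f has_field_derivative deriv f w) (at w)" using assms by (auto intro: holomorphic_derivI)
  then have "((\<lambda>z. z * f z) has_field_derivative f w + w * deriv f w) (at w)"
    by (auto intro!: derivative_eq_intros)
  then show ?thesis using True by (simp add: divide_zero_def DERIV_imp_deriv)
next
  case False
  then have "z * f z / (z - w) = f z + w * (f z / (z - w))" by (simp add: field_simps)
  then show ?thesis using False by (simp add: divide_zero_def)
qed

lemma maximum_modulus_cball: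
  assumes "f holomorphic_on UNIV" "R > 0" "\<And>z. cmod z = R \<Longrightarrow> cmod (f z) \<le> B" "cmod z \<le> R"
  shows "cmod (f z) \<le> B"
proof (rule maximum_modulus_frontier[of f "cball 0 R"])
  show "continuous_on (closure (cball 0 R)) f"
    by (intro holomorphic_on_imp_continuous_on holomorphic_on_subset[OF assms(1)]) auto
qed (use assms in \<open>auto intro: holomorphic_on_subset[OF assms(1)]\<close>)

section \<open>Differentiability from difference quotients\<close>

text \<open>Two divided differences, each estimated by the maximum principle on the circle of radius
  2. The result is linear in \<open>B\<close>, so it holds with the weight of a step inserted for
  \<open>B\<close>.\<close>

lemma difference_quotient_lipschitz:
  assumes u: "u holomorphic_on UNIV" and B: "\<And>h. cmod h \<le> 2 \<Longrightarrow> cmod (u h) \<le> B"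
    and h: "cmod h \<le> 1" "h \<noteq> 0" "cmod h' \<le> 1" "h' \<noteq> 0"
  shows "cmod ((u h - u 0) / h - (u h' - u 0) / h') \<le> 2 * B * cmod (h - h')"
proof -
  define q where "q = divide_zero (\<lambda>h. u h - u 0) 0"
  have q: "q holomorphic_on UNIV" unfolding q_def by (intro holomorphic_divide_zero holomorphic_intros u) simp
  have qB: "cmod (q h) \<le> B" if "cmod h \<le> 2" for h
  proof (rule maximum_modulus_cball[OF q _ _ that])
    fix z :: complex assume z: "cmod z = 2"
    have "cmod (u z - u 0) \<le> B + B" using norm_triangle_ineq4[of "u z" "u 0"] B[of z] B[of 0] z by simp
    then show "cmod (q z) \<le> B" using z by (auto simp: q_def divide_zero_def norm_divide)
  qed simp
  define p where "p = divide_zero (\<lambda>h. q h - q h') h'"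
  have p: "p holomorphic_on UNIV" unfolding p_def by (intro holomorphic_divide_zero holomorphic_intros q) simp
  have pB: "cmod (p h) \<le> 2 * B"
  proof (rule maximum_modulus_cball[OF p, of 2])
    fix z :: complex assume z: "cmod z = 2"
    have d: "cmod (z - h') \<ge> 1" using norm_triangle_ineq2[of z h'] z h by simp
    then have "z \<noteq> h'" by auto
    have "cmod (q z - q h') \<le> 2 * B" using norm_triangle_ineq4[of "q z" "q h'"] qB[of z] qB[of h'] z h by simp
    then have "cmod (q z - q h') / cmod (z - h') \<le> 2 * B / 1"
      using d order.trans[OF norm_ge_zero B[of 0]] by (intro frac_le) auto
    then show "cmod (p z) \<le> 2 * B" using \<open>z \<noteq> h'\<close> by (simp add: p_def divide_zero_def norm_divide)
  qed (use h in auto)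
  have "q h - q h' = (h - h') * p h" unfolding p_def by (rule mult_divide_zero) simp
  then have "cmod (q h - q h') \<le> 2 * B * cmod (h - h')"
    using mult_right_mono[OF pB, of "cmod (h - h')"] by (simp add: norm_mult mult.commute)
  then show ?thesis using h by (simp add: q_def divide_zero_def)
qed

text \<open>Lipschitz quotients are Cauchy along \<open>1 / Suc n\<close>, and the same estimate
  compares every other increment with that limit. Thus the derivative need not be guessed in
  advance.\<close>

lemma has_field_derivative_if_lipschitz_quotient:
  fixes g :: "complex \<Rightarrow> complex"
  assumes lip: "\<And>h h'. cmod h \<le> 1 \<Longrightarrow> h \<noteq> 0 \<Longrightarrow> cmod h' \<le> 1 \<Longrightarrow> h' \<noteq> 0 \<Longrightarrow>
     cmod ((g (x + h) - g x) / h - (g (x + h') - g x) / h') \<le> L * cmod (h - h')"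
  obtains D where "(g has_field_derivative D) (at x)"
proof -
  define s where "s h = (g (x + h) - g x) / h" for h
  define e where "e n = (of_real (1 / real (Suc n)) :: complex)" for n
  have e: "cmod (e n) \<le> 1" "e n \<noteq> 0" for n unfolding e_def norm_of_real of_real_eq_0_iff by auto
  have e0: "e \<longlonglongrightarrow> 0"
    unfolding e_def using tendsto_of_real[OF LIMSEQ_inverse_real_of_nat, where 'a = complex]
    by (simp add: inverse_eq_divide)
  have "Cauchy (\<lambda>n. s (e n))"
  proof (rule CauchyI)
    fix \<epsilon> :: real assume \<epsilon>: "\<epsilon> > 0"
    have "Cauchy e" by (rule LIMSEQ_imp_Cauchy[OF e0])
    then obtain N where N: "\<And>m n. m \<ge> N \<Longrightarrow> n \<ge> N \<Longrightarrow> cmod (e m - e n) < \<epsilon> / (\<bar>L\<bar> + 1)"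
      using CauchyD[of e "\<epsilon> / (\<bar>L\<bar> + 1)"] \<epsilon> by auto
    have "cmod (s (e m) - s (e n)) < \<epsilon>" if "m \<ge> N" "n \<ge> N" for m n
    proof -
      have "cmod (s (e m) - s (e n)) \<le> L * cmod (e m - e n)" unfolding s_def by (intro lip e)
      also have "\<dots> \<le> (\<bar>L\<bar> + 1) * cmod (e m - e n)" by (intro mult_right_mono) auto
      also have "\<dots> < \<epsilon>" using N[OF that] by (simp add: field_simps add_pos_nonneg)
      finally show ?thesis .
    qed
    then show "\<exists>M. \<forall>m\<ge>M. \<forall>n\<ge>M. norm (s (e m) - s (e n)) < \<epsilon>" by blast
  qed
  then obtain D where D: "(\<lambda>n. s (e n)) \<longlonglongrightarrow> D" using Cauchy_convergent convergent_def by blast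
  have bnd: "cmod (s h - D) \<le> L * cmod h" if "cmod h \<le> 1" "h \<noteq> 0" for h
  proof -
    have "(\<lambda>n. L * cmod (h - e n)) \<longlonglongrightarrow> L * cmod (h - 0)" by (intro tendsto_intros e0)
    moreover have "(\<lambda>n. cmod (s h - s (e n))) \<longlonglongrightarrow> cmod (s h - D)" by (intro tendsto_intros D)
    moreover have "\<forall>n. cmod (s h - s (e n)) \<le> L * cmod (h - e n)"
      unfolding s_def by (intro allI lip that e)
    ultimately have "cmod (s h - D) \<le> L * cmod (h - 0)"
      by (intro tendsto_le[OF sequentially_bot _ _ always_eventually])
    then show ?thesis by simp
  qed
  have "((\<lambda>h. s h - D) \<longlongrightarrow> 0) (at 0)"
  proof (rule Lim_null_comparison)
    show "eventually (\<lambda>h. norm (s h - D) \<le> L * cmod h) (at 0)"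
      unfolding eventually_at by (rule exI[of _ 1]) (auto intro!: bnd)
    have "((\<lambda>h. L * cmod h) \<longlongrightarrow> L * cmod 0) (at 0)" by (intro tendsto_intros)
    then show "((\<lambda>h. L * cmod h) \<longlongrightarrow> 0) (at 0)" by simp
  qed
  then have "(s \<longlongrightarrow> D) (at 0)" by (simp add: LIM_zero_iff)
  then have "(g has_field_derivative D) (at x)" by (simp add: DERIV_def s_def[abs_def])
  then show ?thesis using that by blast
qed

section \<open>Entire quotients\<close>

lemma entire_mult_eq_zero:
  assumes "f holomorphic_on UNIV" "g holomorphic_on UNIV" "\<And>z. f z * g z = 0" "g \<noteq> (\<lambda>_. 0)"
  shows "f z = 0"
proof -
  obtain z0 where z0: "g z0 \<noteq> 0" using assms(4) by auto
  have "open {z. g z \<noteq> 0}"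
    by (intro open_Collect_neq continuous_intros holomorphic_on_imp_continuous_on assms)
  then show ?thesis
    by (rule analytic_continuation_open[of "{z. g z \<noteq> 0}" UNIV f "\<lambda>_. 0"]) (use assms z0 in auto)
qed

lemma eventually_nonzero:
  assumes "f holomorphic_on UNIV" "f \<noteq> (\<lambda>_. 0)"
  shows "eventually (\<lambda>z. f z \<noteq> 0) (at w)"
proof -
  obtain z0 where "f z0 \<noteq> 0" using assms(2) by auto
  then have "eventually (\<lambda>z. f z \<noteq> 0 \<and> z \<in> UNIV) (at w)"
    by (intro non_zero_neighbour_alt[OF assms(1)]) auto
  then show ?thesis by simp
qed

lemma power_factor_le:
  fixes u v :: "complex \<Rightarrow> complex"
  assumes "\<And>z. (z - w) ^ a * u z = (z - w) ^ b * v z" "u w \<noteq> 0" "isCont u w" "isCont v w"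
  shows "b \<le> a"
proof (rule ccontr)
  assume "\<not> b \<le> a"
  then have b: "b = a + (b - a)" "b - a > 0" by auto
  have "u z = (z - w) ^ (b - a) * v z" if "z \<noteq> w" for z
  proof -
    have "(z - w) ^ a * u z = (z - w) ^ a * ((z - w) ^ (b - a) * v z)"
      using assms(1)[of z] b(1) by (metis mult.assoc power_add)
    then show ?thesis using that by simp
  qed
  then have "eventually (\<lambda>z. (z - w) ^ (b - a) * v z = u z) (at w)"
    by (auto simp: eventually_at_filter)
  moreover have "((\<lambda>z. (z - w) ^ (b - a) * v z) \<longlongrightarrow> (w - w) ^ (b - a) * v w) (at w)"
    using assms(4) by (intro tendsto_intros) (simp add: isCont_def)
  ultimately have "(u \<longlongrightarrow> 0) (at w)"
    using b(2) by (auto simp: power_0_left elim: Lim_transform_eventually[rotated])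
  moreover have "(u \<longlongrightarrow> u w) (at w)" using assms(3) by (simp add: isCont_def)
  ultimately show False using assms(2) LIM_unique by blast
qed

lemma vanishing_mult_power:
  assumes f: "f holomorphic_on UNIV" and n: "enat n \<le> vanishing_mult f w"
  obtains g where "g holomorphic_on UNIV" "\<And>z. f z = (z - w) ^ n * g z"
proof (cases "f = (\<lambda>_. 0)")
  case True
  then show ?thesis using that[of "\<lambda>_. 0"] by auto
next
  case False
  obtain h where h: "h holomorphic_on UNIV"
    "\<And>z. f z = (z - w) ^ nat (zorder f w) * h z" "vanishing_mult f w = enat (nat (zorder f w))"
    using vanishing_mult_factor[OF f False] by metis
  define m where "m = nat (zorder f w)"
  have "n \<le> m" using n h(3) by (simp add: m_def)
  then have "f z = (z - w) ^ n * ((z - w) ^ (m - n) * h z)" for z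
    unfolding h(2) m_def[symmetric] by (simp add: power_add[symmetric] mult.assoc[symmetric])
  then show ?thesis by (intro that[of "\<lambda>z. (z - w) ^ (m - n) * h z"]) (auto intro!: holomorphic_intros h)
qed

lemma zero_if_vanishing_mult:
  assumes "f holomorphic_on UNIV" "1 \<le> vanishing_mult f w"
  shows "f w = 0"
proof -
  have "enat 1 \<le> vanishing_mult f w" using assms(2) by (simp add: one_enat_def)
  then obtain g where "\<And>z. f z = (z - w) ^ 1 * g z" using vanishing_mult_power[OF assms(1)] by blast
  then show ?thesis by simp
qed

lemma vanishing_mult_pos:
  assumes "f holomorphic_on UNIV" "f w = 0"
  shows "vanishing_mult f w > 0"
proof (cases "f = (\<lambda>_. 0)")
  case False
  obtain h where "h w \<noteq> 0"
    "\<And>z. f z = (z - w) ^ nat (zorder f w) * h z" "vanishing_mult f w = enat (nat (zorder f w))"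
    using vanishing_mult_factor[OF assms(1) False] by metis
  then show ?thesis using assms(2) by (cases "nat (zorder f w) = 0") (auto simp: zero_enat_def)
qed (simp add: vanishing_mult_def)

lemma entire_quotient:
  assumes P: "P holomorphic_on UNIV" and f: "f holomorphic_on UNIV" "f \<noteq> (\<lambda>_. 0)"
    and le: "\<And>w. vanishing_mult f w \<le> vanishing_mult P w"
  obtains E where "E holomorphic_on UNIV" "\<And>z. P z = E z * f z"
proof -
  \<comment> \<open>Defining \<open>E\<close> as a limit gives one formula at zeros of
    \<open>f\<close> and elsewhere; locally it equals a quotient with nonvanishing
    denominator.\<close>
  define E where "E z = Lim (at z) (\<lambda>u. P u / f u)" for z
  have main: "E field_differentiable at w \<and> P w = E w * f w" for w
  proof -
    obtain h where h: "h holomorphic_on UNIV" "h w \<noteq> 0"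
      "\<And>z. f z = (z - w) ^ nat (zorder f w) * h z" "vanishing_mult f w = enat (nat (zorder f w))"
      using vanishing_mult_factor[OF f] by blast
    define n where "n = nat (zorder f w)"
    have "enat n \<le> vanishing_mult P w" using le[of w] h(4) by (simp add: n_def)
    then obtain g where g: "g holomorphic_on UNIV" "\<And>z. P z = (z - w) ^ n * g z"
      using vanishing_mult_power[OF P] by blast
    define U where "U = {z. h z \<noteq> 0}"
    have U: "open U" unfolding U_def
      by (intro open_Collect_neq continuous_intros holomorphic_on_imp_continuous_on h)
    have wU: "w \<in> U" using h(2) by (simp add: U_def)
    have E_eq: "E z = g z / h z" if z: "z \<in> U" for z
    proof -
      have "eventually (\<lambda>u. u \<noteq> w) (at z)"
        using eventually_neq_at_within[of w z UNIV] by simp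
      then have ev: "eventually (\<lambda>u. g u / h u = P u / f u) (at z)"
        by eventually_elim (simp add: g(2) h(3) n_def[symmetric])
      have "isCont g z" "isCont h z"
        using holomorphic_on_imp_continuous_on[OF g(1)] holomorphic_on_imp_continuous_on[OF h(1)]
        by (auto simp: continuous_on_eq_continuous_at)
      then have "((\<lambda>u. g u / h u) \<longlongrightarrow> g z / h z) (at z)"
        using z by (intro tendsto_intros) (auto simp: isCont_def U_def)
      then have "((\<lambda>u. P u / f u) \<longlongrightarrow> g z / h z) (at z)"
        using ev by (rule Lim_transform_eventually)
      then show ?thesis unfolding E_def by (intro tendsto_Lim) auto
    qed
    have "(\<lambda>z. g z / h z) holomorphic_on U"
      by (intro holomorphic_intros holomorphic_on_subset[OF g(1)] holomorphic_on_subset[OF h(1)]) (auto simp: U_def)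
    then have "E holomorphic_on U" by (rule holomorphic_transform) (simp add: E_eq)
    then have "E field_differentiable at w" using U wU by (simp add: holomorphic_on_imp_differentiable_at)
    moreover have "P w = E w * f w"
      using E_eq[OF wU] h(2) by (simp add: g(2) h(3) n_def[symmetric])
    ultimately show ?thesis by blast
  qed
  then have "E holomorphic_on UNIV" by (auto simp: holomorphic_on_def)
  with main that show ?thesis by blast
qed

section \<open>Growth estimates for entire functions\<close>

text \<open>On the boundary rays \<open>cmod z = sqrt 2 * Re z\<close>, so the factor
  \<open>exp (- sqrt 2 * s * z)\<close> brings the bound down to \<open>M\<close> there, and the
  sector principle carries it inside.\<close>

lemma sector_extension:
  assumes f: "f holomorphic_on UNIV" and growth: "\<And>z. cmod (f z) \<le> A * exp (B * cmod z)"
    and M: "M > 0" and bnd: "\<And>z. \<bar>Re z\<bar> \<le> \<bar>Im z\<bar> \<Longrightarrow> cmod (f z) \<le> M * exp (s * cmod z)"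
    and z: "\<bar>Im z\<bar> \<le> \<bar>Re z\<bar>"
  shows "cmod (f z) \<le> M * exp (sqrt 2 * s * \<bar>Re z\<bar>)"
proof -
  have right: "cmod (f z) \<le> M * exp (sqrt 2 * s * Re z)"
    if f: "f holomorphic_on UNIV" and growth: "\<And>z. cmod (f z) \<le> A * exp (B * cmod z)"
      and bnd: "\<And>z. \<bar>Re z\<bar> \<le> \<bar>Im z\<bar> \<Longrightarrow> cmod (f z) \<le> M * exp (s * cmod z)"
      and z: "\<bar>Im z\<bar> \<le> Re z" for f z
  proof -
    define F where "F z = f z * exp (- of_real (sqrt 2 * s) * z)" for z
    have normF: "cmod (F z) = cmod (f z) * exp (- (sqrt 2 * s * Re z))" for z
      by (simp add: F_def norm_mult norm_exp_eq_Re)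
    have A: "A \<ge> 0" using order.trans[OF norm_ge_zero growth[of 0]] by simp
    have "cmod (F z) \<le> M"
    proof (rule phragmen_lindelof_sector[of F UNIV A "B + sqrt 2 * \<bar>s\<bar>"])
      show "F holomorphic_on UNIV" unfolding F_def by (intro holomorphic_intros f)
      fix z :: complex
      show "cmod (F z) \<le> A * exp ((B + sqrt 2 * \<bar>s\<bar>) * cmod z)"
      proof -
        have "\<bar>sqrt 2 * s * Re z\<bar> \<le> sqrt 2 * \<bar>s\<bar> * cmod z"
          unfolding abs_mult by (intro mult_mono abs_Re_le_cmod) auto
        then have "exp (- (sqrt 2 * s * Re z)) \<le> exp (sqrt 2 * \<bar>s\<bar> * cmod z)" by simp
        then have "cmod (F z) \<le> A * exp (B * cmod z) * exp (sqrt 2 * \<bar>s\<bar> * cmod z)"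
          unfolding normF using A by (intro mult_mono growth) auto
        then show ?thesis by (simp add: exp_add distrib_right mult.assoc)
      qed
      assume eq: "\<bar>Im z\<bar> = Re z"
      then have "(cmod z)\<^sup>2 = (sqrt 2 * Re z)\<^sup>2"
        unfolding cmod_power2 by (simp add: power_mult_distrib flip: eq)
      then have "cmod z = sqrt 2 * Re z" using eq by (simp add: power2_eq_iff_nonneg)
      then have "cmod (f z) \<le> M * exp (sqrt 2 * s * Re z)" using bnd[of z] eq by (simp add: mult_ac)
      then have "cmod (F z) \<le> M * exp (sqrt 2 * s * Re z) * exp (- (sqrt 2 * s * Re z))"
        unfolding normF by (intro mult_right_mono) auto
      then show "cmod (F z) \<le> M" by (simp add: exp_minus mult.assoc)
    qed (use M z in auto)
    then show ?thesis unfolding normF by (simp add: exp_minus field_simps)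
  qed
  show ?thesis
  proof (cases "Re z \<ge> 0")
    case True
    then show ?thesis using right[OF f growth bnd, of z] z by simp
  next
    case False
    have "f \<circ> uminus holomorphic_on UNIV"
      by (rule holomorphic_on_compose_gen[OF _ f]) (auto intro!: holomorphic_intros)
    then have "(\<lambda>z. f (- z)) holomorphic_on UNIV" by (simp add: o_def)
    moreover have "cmod (f (- z)) \<le> A * exp (B * cmod z)" for z using growth[of "- z"] by simp
    moreover have "cmod (f (- z)) \<le> M * exp (s * cmod z)" if "\<bar>Re z\<bar> \<le> \<bar>Im z\<bar>" for z using bnd[of "- z"] that by simp
    ultimately have "cmod (f (- (- z))) \<le> M * exp (sqrt 2 * s * Re (- z))"
      by (rule right) (use z False in auto)
    then show ?thesis using False by simp
  qed
qed

text \<open>Harnack in a disc about a point \<open>z0\<close> where \<open>g\<close> is not zero,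
  with radius just over twice the distance to \<open>z\<close>: the exponent is then at most 3, and
  tripling a bound of type \<open>B\<close> over twice the distance gives
  \<open>6 * B\<close>.\<close>

lemma exponential_type_quotient:
  assumes E: "E holomorphic_on UNIV" and g: "g holomorphic_on UNIV" "g \<noteq> (\<lambda>_. 0)"
    and M: "M > 0" and B: "B \<ge> 0"
    and gle: "\<And>z. cmod (g z) \<le> M * exp (B * cmod z)" and Egle: "\<And>z. cmod (E z * g z) \<le> M * exp (B * cmod z)"
  obtains A where "\<And>z. cmod (E z) \<le> A * exp (6 * B * cmod z)"
proof -
  obtain z0 where z0: "g z0 \<noteq> 0" using g(2) by auto
  have "cmod (E z) \<le> (M / cmod (g z0)) ^ 3 * exp (3 * B * (3 * cmod z0 + 1)) * exp (6 * B * cmod z)" for z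
  proof -
    define d where "d = cmod (z - z0)"
    define R where "R = 2 * d + 1"
    have d: "d \<ge> 0" "d \<le> cmod z + cmod z0" by (auto simp: d_def norm_triangle_ineq4)
    define N where "N = M * exp (B * (cmod z0 + R))"
    have N: "N > 0" using M by (simp add: N_def)
    define G where "G u = g u / of_real N" for u
    have le_N: "M * exp (B * cmod u) \<le> N" if "cmod (u - z0) \<le> R" for u
    proof -
      have "cmod u \<le> cmod z0 + R" using norm_triangle_ineq2[of u z0] that by linarith
      then show ?thesis unfolding N_def using M B by (simp add: mult_left_mono)
    qed
    have G1: "cmod (G u) \<le> 1" if "cmod (u - z0) \<le> R" for u
      using order.trans[OF gle le_N[OF that]] N by (simp add: G_def norm_divide)
    have "cmod (E z) \<le> (1 / cmod (G z0)) powr ((R + cmod (z - z0)) / (R - cmod (z - z0)))"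
    proof (rule harnack_quotient_disc[OF E])
      show "G holomorphic_on UNIV" unfolding G_def by (intro holomorphic_intros g) (use N in auto)
      show "cmod (G u) \<le> 1" if "cmod (u - z0) = R" for u using G1 that by simp
      show "cmod (E u * G u) \<le> 1" if "cmod (u - z0) = R" for u
        using order.trans[OF Egle le_N[of u]] N that by (simp add: G_def norm_divide norm_mult)
    qed (use d z0 N in \<open>auto simp: R_def G_def d_def[symmetric]\<close>)
    also have "\<dots> \<le> (1 / cmod (G z0)) powr 3"
    proof (rule powr_mono)
      show "(R + cmod (z - z0)) / (R - cmod (z - z0)) \<le> 3"
        unfolding d_def[symmetric] R_def using d by (simp add: field_simps)
      show "1 \<le> 1 / cmod (G z0)" using G1[of z0] z0 N d by (simp add: G_def R_def norm_divide)
    qed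
    also have "\<dots> = (1 / cmod (G z0)) ^ 3"
      using z0 N by (simp add: powr_numeral G_def norm_divide)
    also have "cmod (G z0) = cmod (g z0) / N"
      using N by (simp add: G_def norm_divide)
    also have "(1 / (cmod (g z0) / N)) ^ 3 = (M / cmod (g z0)) ^ 3 * exp (B * (cmod z0 + R)) ^ 3"
      unfolding N_def by (simp add: power_mult_distrib power_divide)
    also have "exp (B * (cmod z0 + R)) ^ 3 = exp (3 * (B * (cmod z0 + R)))"
      by (simp add: exp_of_nat_mult[symmetric])
    also have "\<dots> \<le> exp (3 * B * (3 * cmod z0 + 1) + 6 * B * cmod z)"
    proof -
      have "3 * B * (cmod z0 + R) \<le> 3 * B * (3 * cmod z0 + 1 + 2 * cmod z)"
        using d B by (intro mult_left_mono) (auto simp: R_def)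
      then show ?thesis by (simp add: algebra_simps)
    qed
    finally show ?thesis using M by (simp add: exp_add mult.assoc mult_left_mono)
  qed
  then show ?thesis using that by blast
qed

lemma minimal_type_mult:
  assumes "minimal_type f" "minimal_type g"
  shows "minimal_type (\<lambda>z. f z * g z)"
  unfolding minimal_type_def
proof (intro conjI allI impI)
  show "(\<lambda>z. f z * g z) holomorphic_on UNIV"
    using assms by (auto simp: minimal_type_def intro!: holomorphic_intros)
  fix \<epsilon> :: real assume "\<epsilon> > 0"
  then have "\<epsilon> / 2 > 0" by simp
  then obtain A B where A: "\<And>z. cmod (f z) \<le> A * exp (\<epsilon> / 2 * cmod z)" and B: "\<And>z. cmod (g z) \<le> B * exp (\<epsilon> / 2 * cmod z)"
    using assms unfolding minimal_type_def by meson
  have "cmod (f z * g z) \<le> A * B * exp (\<epsilon> * cmod z)" for z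
  proof -
    have "cmod (f z * g z) \<le> (A * exp (\<epsilon> / 2 * cmod z)) * (B * exp (\<epsilon> / 2 * cmod z))"
      unfolding norm_mult using A[of z] B[of z] by (intro mult_mono) (auto intro: order.trans[OF norm_ge_zero])
    also have "\<dots> = A * B * (exp (\<epsilon> / 2 * cmod z) * exp (\<epsilon> / 2 * cmod z))" by simp
    also have "\<dots> = A * B * exp (\<epsilon> * cmod z)" by (simp add: exp_add[symmetric])
    finally show ?thesis .
  qed
  then show "\<exists>C. \<forall>z. cmod (f z * g z) \<le> C * exp (\<epsilon> * cmod z)" by blast
qed

lemma minimal_type_power:
  assumes "minimal_type f"
  shows "minimal_type (\<lambda>z. f z ^ n)"
proof (induction n)
  case 0
  have "\<exists>C. \<forall>z. 1 \<le> C * exp (\<epsilon> * cmod z)" if "\<epsilon> > 0" for \<epsilon>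
    using that by (intro exI[of _ 1]) simp
  then show ?case by (simp add: minimal_type_def)
next
  case (Suc n)
  then show ?case using minimal_type_mult[OF assms Suc] by simp
qed

lemma le_if_power_growth:
  fixes a b x y :: real
  assumes "\<And>n. a ^ n * x \<le> b ^ n * y" "x > 0" "b \<ge> 0"
  shows "a \<le> b"
proof (rule ccontr)
  assume "\<not> a \<le> b"
  then have a: "a > 0" "b / a < 1" using assms(3) by auto
  have "x \<le> (b / a) ^ n * y" for n
    using assms(1)[of n] a by (simp add: power_divide field_simps)
  moreover have "(\<lambda>n. (b / a) ^ n * y) \<longlonglongrightarrow> 0 * y"
    by (intro tendsto_intros LIMSEQ_realpow_zero) (use a assms(3) in auto)
  ultimately have "x \<le> 0 * y" by (intro LIMSEQ_le_const) auto
  then show False using assms(2) by simp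
qed

section \<open>Quotients of minimal type\<close>

context weight_space
begin

lemma Pa_common_bound:
  assumes "f \<in> Pa \<omega> c r" "g \<in> Pa \<omega> c r"
  obtains k M N where "wbound k M f" "wbound k N g"
proof -
  obtain k1 M k2 N where "wbound k1 M f" "wbound k2 N g" using assms unfolding Pa_iff by blast
  then show ?thesis
    using that[of "max k1 k2" M N] wbound_mono[of k1 M f "max k1 k2" M] wbound_mono[of k2 N g "max k1 k2" N] by simp
qed

text \<open>If the endpoints were in the wrong order, a suitable exponential factor would make
  \<open>f\<close> decay exponentially in both vertical directions. Phragmen-Lindelof in the
  horizontal sectors and Liouville then leave a constant, which the decay forces to be 0.\<close>

lemma wbound_segment_nonempty:
  assumes f: "wbound k M f" "f \<noteq> (\<lambda>_. 0)"
  shows "ind_lower f \<le> ind_upper f"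
proof (rule ccontr)
  assume "\<not> ?thesis"
  then obtain b where b: "ind_upper f < ereal b" "ereal b < ind_lower f"
    using ereal_dense2 by (metis not_le)
  then obtain a where a: "ind_upper f < ereal a" "ereal a < ereal b" using ereal_dense2 by blast
  have up: "indicator_fun f (pi / 2) \<le> ereal a" using a by (simp add: ind_upper_def)
  have "ereal b \<le> - indicator_fun f (- pi / 2)" using b(2) by (simp add: ind_lower_def)
  then have low: "indicator_fun (\<lambda>z. f (- z)) (pi / 2) \<le> ereal (- b)"
    unfolding indicator_fun_lower by (cases "indicator_fun (\<lambda>z. f (- z)) (pi / 2)") auto
  \<comment> \<open>Midpoint and half-length: multiplying by \<open>exp (\<i> * \<eta> * z)\<close>
    makes the decay symmetric with rate \<open>\<kappa>\<close>.\<close>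
  define \<eta> \<kappa> where "\<eta> = (a + b) / 2" and "\<kappa> = (b - a) / 2"
  have \<kappa>: "\<kappa> > 0" using a by (simp add: \<kappa>_def)
  define N where "N = M * exp (\<omega> 1)"
  \<comment> \<open>In the vertical sectors \<open>cmod z \<le> 2 * \<bar>Im z\<bar>\<close>, so the
    share \<open>\<kappa> / 4\<close> uses up at most half of the decay.\<close>
  obtain C where C: "\<And>z. Im z \<ge> 0 \<Longrightarrow> Re (majorant z) \<le> (\<kappa> / 4) * cmod z + C"
    using Re_majorant_small[of "\<kappa> / 4"] \<kappa> by auto
  define A where "A = N * exp C"
  have Mpos: "M > 0"
  proof -
    have "M \<noteq> 0"
    proof
      assume "M = 0"
      then have "f = (\<lambda>_. 0)" using wboundD(2)[OF f(1)] by auto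
      then show False using f(2) by simp
    qed
    then show ?thesis using wbound_nonneg[OF f(1)] by simp
  qed
  have A: "A > 0" using Mpos by (simp add: A_def N_def)
  define F where "F z = f z * exp (\<i> * of_real \<eta> * z)" for z
  have holF: "F holomorphic_on UNIV" unfolding F_def by (intro holomorphic_intros wboundD(1)[OF f(1)])
  have normF: "cmod (F z) = cmod (f z) * exp (- (\<eta> * Im z))" for z
    by (simp add: F_def norm_mult norm_exp_eq_Re)
  have Fle: "cmod (F z) \<le> A * exp (\<kappa> / 4 * cmod z - \<kappa> * \<bar>Im z\<bar>)" for z
  proof (cases "Im z \<ge> 0")
    case True
    have "cmod (F z) \<le> N * exp (Re (majorant z) + a * Im z) * exp (- (\<eta> * Im z))"
      unfolding normF N_def by (intro mult_right_mono wbound_indicator_upper_half_plane[OF f(1) up True]) simp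
    also have "\<dots> = N * exp (Re (majorant z) + a * Im z - \<eta> * Im z)" by (simp add: exp_diff exp_minus divide_inverse)
    also have "\<dots> \<le> N * exp (C + (\<kappa> / 4 * cmod z - \<kappa> * \<bar>Im z\<bar>))"
      using C[OF True] Mpos True by (simp add: N_def \<eta>_def \<kappa>_def field_simps)
    finally show ?thesis by (simp add: A_def exp_add mult.assoc)
  next
    case False
    then have z: "Im (- z) \<ge> 0" by simp
    have "cmod (f z) \<le> N * exp (Re (majorant (- z)) + (- b) * Im (- z))"
      using wbound_indicator_upper_half_plane[OF wbound_reflect[OF f(1)] low z] by (simp add: N_def)
    then have "cmod (F z) \<le> N * exp (Re (majorant (- z)) + (- b) * Im (- z)) * exp (- (\<eta> * Im z))"
      unfolding normF by (intro mult_right_mono) auto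
    also have "\<dots> = N * exp (Re (majorant (- z)) + b * Im z - \<eta> * Im z)" by (simp add: exp_diff exp_minus divide_inverse)
    also have "\<dots> \<le> N * exp (C + (\<kappa> / 4 * cmod z - \<kappa> * \<bar>Im z\<bar>))"
      using C[OF z] Mpos False by (simp add: N_def \<eta>_def \<kappa>_def field_simps)
    finally show ?thesis by (simp add: A_def exp_add mult.assoc)
  qed
  have "cmod (F z) \<le> A" for z
  proof (cases "\<bar>Re z\<bar> \<le> \<bar>Im z\<bar>")
    case True
    then have "cmod z \<le> 2 * \<bar>Im z\<bar>" using cmod_le[of z] by linarith
    then have "A * exp (\<kappa> / 4 * cmod z - \<kappa> * \<bar>Im z\<bar>) \<le> A * exp 0"
      using A \<kappa> mult_left_mono[of "cmod z" "2 * \<bar>Im z\<bar>" "\<kappa> / 4"] by (intro mult_left_mono) auto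
    then show ?thesis using Fle[of z] by simp
  next
    case False
    have "cmod (F z) \<le> A * exp (sqrt 2 * 0 * \<bar>Re z\<bar>)"
    proof (rule sector_extension[OF holF _ A, of A "\<kappa> / 4"])
      show "cmod (F z) \<le> A * exp (\<kappa> / 4 * cmod z)" for z
      proof -
        have "A * exp (\<kappa> / 4 * cmod z - \<kappa> * \<bar>Im z\<bar>) \<le> A * exp (\<kappa> / 4 * cmod z)"
          using A \<kappa> by (intro mult_left_mono) auto
        then show ?thesis using Fle[of z] by linarith
      qed
      show "cmod (F z) \<le> A * exp (0 * cmod z)" if "\<bar>Re z\<bar> \<le> \<bar>Im z\<bar>" for z
      proof -
        have "cmod z \<le> 2 * \<bar>Im z\<bar>" using cmod_le[of z] that by linarith
        then have "A * exp (\<kappa> / 4 * cmod z - \<kappa> * \<bar>Im z\<bar>) \<le> A * exp 0"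
          using A \<kappa> mult_left_mono[of "cmod z" "2 * \<bar>Im z\<bar>" "\<kappa> / 4"] by (intro mult_left_mono) auto
        then show ?thesis using Fle[of z] by simp
      qed
    qed (use False in auto)
    then show ?thesis by simp
  qed
  then have "bounded (range F)" by (auto simp: bounded_iff)
  then obtain K where K: "\<And>z. F z = K" using Liouville_theorem[OF holF] by (auto simp: constant_on_def)
  have Kt: "cmod K \<le> A * exp (- (\<kappa> / 2 * t))" if "t \<ge> 0" for t
  proof -
    have "cmod K \<le> A * exp (\<kappa> / 4 * t - \<kappa> * t)"
      using Fle[of "\<i> * of_real t"] K that by (simp add: norm_mult)
    also have "\<dots> \<le> A * exp (- (\<kappa> / 2 * t))" using A \<kappa> that by (intro mult_left_mono) auto
    finally show ?thesis .
  qed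
  have ev: "eventually (\<lambda>t. cmod K \<le> A * exp (- (\<kappa> / 2 * t))) at_top"
    by (rule eventually_mono[OF eventually_ge_at_top[of 0] Kt])
  have "((\<lambda>t. A * exp (- (\<kappa> / 2 * t))) \<longlongrightarrow> A * 0) at_top"
  proof (intro tendsto_intros filterlim_compose[OF exp_at_bot])
    have "filterlim (\<lambda>t. \<kappa> / 2 * t) at_top at_top"
      by (rule filterlim_tendsto_pos_mult_at_top[OF tendsto_const _ filterlim_ident]) (use \<kappa> in simp)
    then show "filterlim (\<lambda>t. - (\<kappa> / 2 * t)) at_bot at_top" by (simp add: filterlim_uminus_at_top)
  qed
  then have "cmod K \<le> A * 0" by (rule tendsto_lowerbound[OF _ ev]) simp
  then have "f = (\<lambda>_. 0)" using K by (auto simp: F_def)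
  then show False using f(2) by simp
qed

text \<open>If \<open>\<phi>\<close> has almost the same indicator as \<open>\<psi>\<close>, then \<open>\<bar>\<phi>\<bar>\<close> is, at some height \<open>y\<close>, almost as large as the
  growth of \<open>\<phi>\<close> and \<open>\<psi>\<close> permits; Harnack's inequality centred at \<open>\<i> y\<close> transports this to the half-plane.\<close>

lemma quotient_growth_upper:
  assumes E: "E holomorphic_on UNIV" and \<phi>: "wbound k M \<phi>" and \<psi>: "wbound k M \<psi>"
    and D: "indicator_fun \<phi> (pi / 2) \<le> ereal D" "indicator_fun \<psi> (pi / 2) \<le> ereal D"
    and \<epsilon>: "\<epsilon> > 0" "ereal (D - \<epsilon>) < indicator_fun \<phi> (pi / 2)"
    and C: "\<And>z. cmod (E z * \<phi> z) \<le> C * (cmod (\<phi> z) + cmod (\<psi> z))"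
  obtains A where "A > 0" "\<And>z. \<bar>Re z\<bar> \<le> Im z \<Longrightarrow> cmod (E z) \<le> A * exp (48 * \<epsilon> * cmod z)"
proof -
  define N where "N = (M + 1) * exp (\<omega> 1)"
  \<comment> \<open>One normalisation that makes both \<open>g\<close> and \<open>E * g\<close>
    bounded by 1.\<close>
  define N' where "N' = N * max 1 (2 * C)"
  have N: "N > 0" using wbound_nonneg[OF \<phi>] by (simp add: N_def add_nonneg_pos)
  have N': "N' > 0" "N \<le> N'" "2 * C * N \<le> N'" using N by (auto simp: N'_def)
  have bound: "cmod (f z) \<le> N * exp (Re (majorant z) + D * Im z)"
    if f: "wbound k M f" "indicator_fun f (pi / 2) \<le> ereal D" and z: "Im z \<ge> 0" for f z
  proof -
    have "M * exp (\<omega> 1) * exp (Re (majorant z) + D * Im z) \<le> N * exp (Re (majorant z) + D * Im z)"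
      unfolding N_def by (intro mult_right_mono) auto
    then show ?thesis using wbound_indicator_upper_half_plane[OF f z] by linarith
  qed
  define g where "g z = \<phi> z * exp (- majorant z + \<i> * of_real D * z) / of_real N'" for z
  have normg: "cmod (g z) = cmod (\<phi> z) * exp (- (Re (majorant z) + D * Im z)) / N'" for z
    using N' by (simp add: g_def norm_mult norm_divide norm_exp_eq_Re algebra_simps)
  have scaled: "cmod (f z) * exp (- (Re (majorant z) + D * Im z)) \<le> N"
    if "wbound k M f" "indicator_fun f (pi / 2) \<le> ereal D" "Im z \<ge> 0" for f z
  proof -
    have "cmod (f z) * exp (- (Re (majorant z) + D * Im z)) \<le> N * exp (Re (majorant z) + D * Im z) * exp (- (Re (majorant z) + D * Im z))"
      by (intro mult_right_mono bound that) simp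
    then show ?thesis by (simp add: mult.assoc exp_add[symmetric])
  qed
  obtain C0 where C0: "C0 \<ge> 0" "\<And>z. Im z \<ge> 0 \<Longrightarrow> Re (majorant z) \<le> \<epsilon> * cmod z + C0"
    using Re_majorant_small[OF \<epsilon>(1)] by blast
  \<comment> \<open>Beyond this height the constants \<open>ln N'\<close> and \<open>C0\<close>
    together amount to at most \<open>\<epsilon> * y\<close>.\<close>
  define Y where "Y = max 1 ((\<bar>ln N'\<bar> + C0) / \<epsilon>)"
  obtain y where y: "y \<ge> Y" "cmod (\<phi> (of_real y * \<i>)) > exp ((D - \<epsilon>) * y)"
  proof -
    have "\<not> indicator_fun \<phi> (pi / 2) \<le> ereal (D - \<epsilon>)" using \<epsilon>(2) by simp
    then obtain D' where D': "D - \<epsilon> < D'" "\<not> eventually (\<lambda>t. cmod (\<phi> (of_real t * \<i>)) \<le> exp (D' * t)) at_top"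
      unfolding indicator_fun_upper_le_iff by auto
    then obtain y where y: "y \<ge> Y" "\<not> cmod (\<phi> (of_real y * \<i>)) \<le> exp (D' * y)"
      unfolding eventually_at_top_linorder by blast
    have "y \<ge> 0" using y(1) by (simp add: Y_def)
    then have "exp ((D - \<epsilon>) * y) \<le> exp (D' * y)" using D'(1) by (simp add: mult_right_mono)
    then show ?thesis using y that[of y] by linarith
  qed
  have y0: "y > 0" and yY: "\<bar>ln N'\<bar> + C0 \<le> \<epsilon> * y"
    using y(1) \<epsilon>(1) by (auto simp: Y_def field_simps)
  \<comment> \<open>One \<open>\<epsilon> * y\<close> each for the gap to \<open>D\<close>, for the
    majorant, and for the constants.\<close>
  have g_lower: "cmod (g (\<i> * of_real y)) \<ge> exp (- (3 * \<epsilon> * y))"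
  proof -
    have "exp (- (3 * \<epsilon> * y)) \<le> exp ((D - \<epsilon>) * y - (Re (majorant (\<i> * of_real y)) + D * y) - ln N')"
      using C0(2)[of "\<i> * of_real y"] y0 yY by (simp add: norm_mult algebra_simps)
    also have "\<dots> = exp ((D - \<epsilon>) * y) * exp (- (Re (majorant (\<i> * of_real y)) + D * y)) / N'"
      using N' by (simp add: exp_add exp_diff exp_minus divide_inverse)
    also have "\<dots> \<le> cmod (\<phi> (\<i> * of_real y)) * exp (- (Re (majorant (\<i> * of_real y)) + D * y)) / N'"
      using y(2) N' by (intro divide_right_mono mult_right_mono) (auto simp: mult.commute)
    finally show ?thesis unfolding normg by simp
  qed
  have gpos: "cmod (g (\<i> * of_real y)) > 0" using g_lower exp_gt_zero less_le_trans by blast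
  have hol: "g holomorphic_on {z. Im z > 0}"
    unfolding g_def using N'
    by (intro holomorphic_intros holomorphic_on_subset[OF wboundD(1)[OF \<phi>]] holomorphic_on_subset[OF holomorphic_majorant]) auto
  have main: "cmod (E z) \<le> exp (6 * \<epsilon> * (cmod (z + \<i> * of_real y))\<^sup>2 / Im z)" if z: "Im z > 0" for z
  proof -
    have "cmod (E z) \<le> (1 / cmod (g (\<i> * of_real y))) powr (2 * (cmod (z + \<i> * of_real y))\<^sup>2 / (y * Im z))"
    proof (rule harnack_quotient_half_plane[OF holomorphic_on_subset[OF E] hol _ _ y0 _ z])
      fix w assume w: "0 < Im w"
      have "cmod (g w) \<le> N / N'" unfolding normg using scaled[OF \<phi> D(1), of w] w N' by (intro divide_right_mono) auto
      also have "\<dots> \<le> 1" using N' by simp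
      finally show "cmod (g w) \<le> 1" .
      have C_nonneg: "C \<ge> 0"
      proof (rule ccontr)
        assume "\<not> C \<ge> 0"
        moreover have "cmod (\<phi> (\<i> * of_real y)) > 0" using gpos by (auto simp: g_def)
        ultimately have "C * (cmod (\<phi> (\<i> * of_real y)) + cmod (\<psi> (\<i> * of_real y))) < 0"
          by (intro mult_neg_pos) (auto simp: add_pos_nonneg)
        then show False using C[of "\<i> * of_real y"] norm_ge_zero[of "E (\<i> * of_real y) * \<phi> (\<i> * of_real y)"] by linarith
      qed
      have "cmod (E w * g w) = cmod (E w * \<phi> w) * exp (- (Re (majorant w) + D * Im w)) / N'"
        unfolding norm_mult normg by simp
      also have "\<dots> \<le> C * (cmod (\<phi> w) + cmod (\<psi> w)) * exp (- (Re (majorant w) + D * Im w)) / N'"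
        using N' by (intro divide_right_mono mult_right_mono C) auto
      also have "\<dots> = C * (cmod (\<phi> w) * exp (- (Re (majorant w) + D * Im w)) + cmod (\<psi> w) * exp (- (Re (majorant w) + D * Im w))) / N'"
        by (simp add: algebra_simps)
      also have "\<dots> \<le> C * (N + N) / N'"
        using N' C_nonneg w by (intro divide_right_mono mult_left_mono add_mono scaled \<phi> \<psi> D) auto
      also have "\<dots> \<le> 1" using N' by simp
      finally show "cmod (E w * g w) \<le> 1" .
    qed (use gpos in auto)
    also have "\<dots> \<le> exp (3 * \<epsilon> * y) powr (2 * (cmod (z + \<i> * of_real y))\<^sup>2 / (y * Im z))"
    proof (rule powr_mono2)
      have "1 / cmod (g (\<i> * of_real y)) \<le> 1 / exp (- (3 * \<epsilon> * y))"
        using g_lower gpos by (intro divide_left_mono) auto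
      then show "1 / cmod (g (\<i> * of_real y)) \<le> exp (3 * \<epsilon> * y)" by (simp add: exp_minus inverse_eq_divide)
    qed (use y0 z in auto)
    \<comment> \<open>The height \<open>y\<close> cancels between the lower bound for
      \<open>g\<close> and the Harnack exponent; this keeps the growth rate proportional to
      \<open>\<epsilon>\<close> however large \<open>y\<close> has to be.\<close>
    also have "\<dots> = exp (6 * \<epsilon> * (cmod (z + \<i> * of_real y))\<^sup>2 / Im z)"
      using y0 z by (simp add: powr_def field_simps)
    finally show ?thesis .
  qed
  have "bounded (E ` cball 0 y)"
    by (intro compact_imp_bounded compact_continuous_image continuous_on_subset[OF holomorphic_on_imp_continuous_on[OF E]]) auto
  then obtain B where B: "\<forall>x\<in>E ` cball 0 y. cmod x \<le> B" unfolding bounded_iff by blast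
  have "cmod (E z) \<le> max B 1 * exp (48 * \<epsilon> * cmod z)" if z: "\<bar>Re z\<bar> \<le> Im z" for z
  proof (cases "cmod z \<le> y")
    case True
    then have "cmod (E z) \<le> max B 1 * 1" using B by (auto simp: le_max_iff_disj)
    also have "\<dots> \<le> max B 1 * exp (48 * \<epsilon> * cmod z)" using \<epsilon>(1) by (intro mult_left_mono) auto
    finally show ?thesis .
  next
    \<comment> \<open>Here \<open>cmod (z + \<i> y) \<le> 2 * cmod z\<close> and
      \<open>cmod z \<le> 2 * Im z\<close>, which turns the factor 6 into 48.\<close>
    case False
    have z2: "cmod z \<le> 2 * Im z" using cmod_le[of z] z by linarith
    then have Im: "Im z > 0" using False y0 by linarith
    have "cmod (z + \<i> * of_real y) \<le> cmod z + y" using norm_triangle_ineq[of z "\<i> * of_real y"] y0 by (simp add: norm_mult)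
    then have "(cmod (z + \<i> * of_real y))\<^sup>2 \<le> (2 * cmod z)\<^sup>2" using False by (intro power_mono) auto
    also have "\<dots> = 4 * cmod z * cmod z" by (simp add: power2_eq_square)
    also have "\<dots> \<le> 4 * cmod z * (2 * Im z)" using z2 by (intro mult_left_mono) auto
    finally have "(cmod (z + \<i> * of_real y))\<^sup>2 / Im z \<le> 8 * cmod z" using Im by (simp add: field_simps)
    then have "6 * \<epsilon> * ((cmod (z + \<i> * of_real y))\<^sup>2 / Im z) \<le> 6 * \<epsilon> * (8 * cmod z)"
      using \<epsilon>(1) by (intro mult_left_mono) auto
    then have "exp (6 * \<epsilon> * (cmod (z + \<i> * of_real y))\<^sup>2 / Im z) \<le> 1 * exp (48 * \<epsilon> * cmod z)" by simp
    also have "\<dots> \<le> max B 1 * exp (48 * \<epsilon> * cmod z)" by (intro mult_right_mono) auto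
    finally show ?thesis using main[OF Im] by linarith
  qed
  then show ?thesis using that[of "max B 1"] by simp
qed

lemma indicator_fun_upper_real:
  assumes "wbound k M f" "f \<noteq> (\<lambda>_. 0)"
  obtains u where "indicator_fun f (pi / 2) = ereal u"
proof -
  have up: "indicator_fun f (pi / 2) \<le> ereal (c k)" "indicator_fun (\<lambda>z. f (- z)) (pi / 2) \<le> ereal (c k)"
    using wbound_indicator_le assms(1) wbound_reflect by blast+
  have "- ereal (c k) \<le> ind_lower f"
    unfolding ind_lower_def indicator_fun_lower using up(2) by (simp only: ereal_minus_le_minus)
  then have "- ereal (c k) \<le> indicator_fun f (pi / 2)"
    using wbound_segment_nonempty[OF assms] unfolding ind_upper_def by (rule order.trans)
  then show ?thesis using up(1) that by (cases "indicator_fun f (pi / 2)") auto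
qed

lemma quotient_growth_upper_all:
  assumes E: "E holomorphic_on UNIV" and \<psi>: "\<psi> \<in> Pa \<omega> c r" "\<psi> \<noteq> (\<lambda>_. 0)" and \<epsilon>: "\<epsilon> > 0"
    and \<phi>: "\<phi> \<in> Pa \<omega> c r" "\<phi> \<noteq> (\<lambda>_. 0)" "indicator_fun \<psi> (pi / 2) < indicator_fun \<phi> (pi / 2) + ereal \<epsilon>"
    and C: "\<And>z. cmod (E z * \<phi> z) \<le> C * (cmod (\<phi> z) + cmod (\<psi> z))"
  obtains A where "A > 0" "\<And>z. \<bar>Re z\<bar> \<le> Im z \<Longrightarrow> cmod (E z) \<le> A * exp (48 * \<epsilon> * cmod z)"
proof -
  obtain k M1 M2 where "wbound k M1 \<phi>" "wbound k M2 \<psi>"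
    using Pa_common_bound[OF \<phi>(1) \<psi>(1)] .
  then have b: "wbound k (max M1 M2) \<phi>" "wbound k (max M1 M2) \<psi>"
    by (auto elim!: wbound_mono)
  obtain v where v: "indicator_fun \<phi> (pi / 2) = ereal v" using indicator_fun_upper_real[OF b(1) \<phi>(2)] by blast
  obtain u where u: "indicator_fun \<psi> (pi / 2) = ereal u" using indicator_fun_upper_real[OF b(2) \<psi>(2)] by blast
  have uv: "u < v + \<epsilon>" using \<phi>(3) by (simp add: u v)
  show ?thesis
    by (rule quotient_growth_upper[OF E b, of "max u v" \<epsilon> C]) (use u v uv \<epsilon> C that in auto)
qed

text \<open>One element of \<open>J\<close> near the upper end of the segment controls the upper
  vertical sector, another near the lower end the lower one. The a priori exponential type then lets
  the sector principle fill in the horizontal sectors.\<close>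

lemma quotient_minimal_type:
  assumes E: "E holomorphic_on UNIV" and \<psi>: "\<psi> \<in> Pa \<omega> c r" "\<psi> \<noteq> (\<lambda>_. 0)"
    and JP: "J \<subseteq> Pa \<omega> c r"
    and up: "\<And>\<epsilon>. \<epsilon> > 0 \<Longrightarrow> \<exists>\<phi>\<in>J - {\<lambda>_. 0}. ind_upper \<psi> < ind_upper \<phi> + ereal \<epsilon>"
    and low: "\<And>\<epsilon>. \<epsilon> > 0 \<Longrightarrow> \<exists>\<phi>\<in>J - {\<lambda>_. 0}. ind_lower \<phi> < ind_lower \<psi> + ereal \<epsilon>"
    and C: "\<And>\<phi>. \<phi> \<in> J \<Longrightarrow> \<exists>C. \<forall>z. cmod (E z * \<phi> z) \<le> C * (cmod (\<phi> z) + cmod (\<psi> z))"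
  shows "minimal_type E"
  unfolding minimal_type_def
proof (intro conjI E allI impI)
  fix \<delta> :: real assume \<delta>: "\<delta> > 0"
  \<comment> \<open>96 is 48 from the vertical estimate times 2, which bounds the
    \<open>sqrt 2\<close> of the sector extension.\<close>
  define \<epsilon> where "\<epsilon> = \<delta> / 96"
  have \<epsilon>: "\<epsilon> > 0" using \<delta> by (simp add: \<epsilon>_def)
  obtain \<phi> where \<phi>: "\<phi> \<in> J" "\<phi> \<noteq> (\<lambda>_. 0)" "ind_upper \<psi> < ind_upper \<phi> + ereal \<epsilon>" using up[OF \<epsilon>] by blast
  obtain C1 where C1: "\<And>z. cmod (E z * \<phi> z) \<le> C1 * (cmod (\<phi> z) + cmod (\<psi> z))" using C[OF \<phi>(1)] by blast
  obtain A1 where A1: "A1 > 0" "\<And>z. \<bar>Re z\<bar> \<le> Im z \<Longrightarrow> cmod (E z) \<le> A1 * exp (48 * \<epsilon> * cmod z)"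
    by (rule quotient_growth_upper_all[OF E \<psi> \<epsilon> _ \<phi>(2) _ C1]) (use \<phi> JP in \<open>auto simp: ind_upper_def\<close>)
  have reflect: "(\<lambda>z. f (- z)) holomorphic_on UNIV" if "f holomorphic_on UNIV" for f :: "complex \<Rightarrow> complex"
  proof -
    have "f \<circ> uminus holomorphic_on UNIV"
      by (rule holomorphic_on_compose_gen[OF _ that]) (auto intro!: holomorphic_intros)
    then show ?thesis by (simp add: o_def)
  qed
  have reflect_nz: "(\<lambda>z. f (- z)) \<noteq> (\<lambda>_. 0)" if "f \<noteq> (\<lambda>_. 0)" for f :: "complex \<Rightarrow> complex"
  proof
    assume *: "(\<lambda>z. f (- z)) = (\<lambda>_. 0)"
    have "f z = 0" for z using fun_cong[OF *, of "- z"] by simp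
    then show False using that by auto
  qed
  obtain \<tau> where \<tau>: "\<tau> \<in> J" "\<tau> \<noteq> (\<lambda>_. 0)" "ind_lower \<tau> < ind_lower \<psi> + ereal \<epsilon>" using low[OF \<epsilon>] by blast
  obtain C2 where C2: "\<And>z. cmod (E z * \<tau> z) \<le> C2 * (cmod (\<tau> z) + cmod (\<psi> z))" using C[OF \<tau>(1)] by blast
  obtain A2 where A2: "A2 > 0" "\<And>z. \<bar>Re z\<bar> \<le> Im z \<Longrightarrow> cmod (E (- z)) \<le> A2 * exp (48 * \<epsilon> * cmod z)"
  proof (rule quotient_growth_upper_all[OF reflect[OF E] Pa_reflect[OF \<psi>(1)] reflect_nz[OF \<psi>(2)] \<epsilon>, of "\<lambda>z. \<tau> (- z)" C2])
    show "(\<lambda>z. \<tau> (- z)) \<in> Pa \<omega> c r" using \<tau>(1) JP Pa_reflect by blast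
    have "- indicator_fun (\<lambda>z. \<tau> (- z)) (pi / 2) < - indicator_fun (\<lambda>z. \<psi> (- z)) (pi / 2) + ereal \<epsilon>"
      using \<tau>(3) unfolding ind_lower_def indicator_fun_lower .
    then show "indicator_fun (\<lambda>z. \<psi> (- z)) (pi / 2) < indicator_fun (\<lambda>z. \<tau> (- z)) (pi / 2) + ereal \<epsilon>"
      by (cases "indicator_fun (\<lambda>z. \<psi> (- z)) (pi / 2)"; cases "indicator_fun (\<lambda>z. \<tau> (- z)) (pi / 2)") auto
  qed (use reflect_nz[OF \<tau>(2)] C2 in auto)
  define A where "A = max A1 A2"
  have A: "A > 0" using A1(1) by (simp add: A_def)
  have vert: "cmod (E z) \<le> A * exp (48 * \<epsilon> * cmod z)" if "\<bar>Re z\<bar> \<le> \<bar>Im z\<bar>" for z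
  proof (cases "Im z \<ge> 0")
    case True
    then have "cmod (E z) \<le> A1 * exp (48 * \<epsilon> * cmod z)" using A1(2)[of z] that by simp
    also have "\<dots> \<le> A * exp (48 * \<epsilon> * cmod z)" by (intro mult_right_mono) (auto simp: A_def)
    finally show ?thesis .
  next
    case False
    then have "cmod (E z) \<le> A2 * exp (48 * \<epsilon> * cmod z)" using A2(2)[of "- z"] that by simp
    also have "\<dots> \<le> A * exp (48 * \<epsilon> * cmod z)" by (intro mult_right_mono) (auto simp: A_def)
    finally show ?thesis .
  qed
  obtain k M1 M2 where "wbound k M1 \<phi>" "wbound k M2 \<psi>"
    using Pa_common_bound[OF subsetD[OF JP \<phi>(1)] \<psi>(1)] .
  then have b: "wbound k (max M1 M2) \<phi>" "wbound k (max M1 M2) \<psi>"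
    by (auto elim!: wbound_mono)
  define M where "M = max M1 M2"
  obtain W where W: "W \<ge> 0" "\<And>x. x \<ge> 0 \<Longrightarrow> \<omega> x \<le> 1 * x + W" using weight_small[of 1] by auto
  have exp_type: "cmod (f z) \<le> M * exp W * exp ((1 + c k) * cmod z)" if f: "wbound k M f" for f z
  proof -
    have "r k * \<omega> (cmod z) \<le> 1 * \<omega> (cmod z)" using r_less[of k] weight_nonneg[of "cmod z"] by (intro mult_right_mono) auto
    moreover have "c k * \<bar>Im z\<bar> \<le> c k * cmod z" using c_pos[of k] abs_Im_le_cmod by (intro mult_left_mono) auto
    ultimately have "r k * \<omega> (cmod z) + c k * \<bar>Im z\<bar> \<le> W + (1 + c k) * cmod z"
      using W(2)[of "cmod z"] by (simp add: distrib_right)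
    then have "M * exp (r k * \<omega> (cmod z) + c k * \<bar>Im z\<bar>) \<le> M * exp (W + (1 + c k) * cmod z)"
      using wbound_nonneg[OF f] by (intro mult_left_mono) auto
    then show ?thesis using wboundD(2)[OF f, of z] by (simp add: exp_add)
  qed
  define N where "N = M * exp W * (1 + 2 * \<bar>C1\<bar>) + 1"
  have M0: "M \<ge> 0" using wbound_nonneg[OF b(1)] by (simp add: M_def)
  have N: "N > 0" unfolding N_def using M0 by (simp add: add_nonneg_pos)
  obtain A3 where A3: "\<And>z. cmod (E z) \<le> A3 * exp (6 * (1 + c k) * cmod z)"
  proof (rule exponential_type_quotient[OF E wboundD(1)[OF b(1)] \<phi>(2) N])
    show "1 + c k \<ge> 0" using c_pos[of k] by simp
    have NM: "M * exp W \<le> N" "2 * \<bar>C1\<bar> * (M * exp W) \<le> N"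
      unfolding N_def using M0 by (auto simp: algebra_simps)
    show "cmod (\<phi> z) \<le> N * exp ((1 + c k) * cmod z)" for z
      by (rule order.trans[OF exp_type[OF b(1)[folded M_def]] mult_right_mono[OF NM(1)]]) simp
    show "cmod (E z * \<phi> z) \<le> N * exp ((1 + c k) * cmod z)" for z
    proof -
      let ?e = "M * exp W * exp ((1 + c k) * cmod z)"
      have "cmod (E z * \<phi> z) \<le> \<bar>C1\<bar> * (cmod (\<phi> z) + cmod (\<psi> z))"
        by (rule order.trans[OF C1]) (intro mult_right_mono, auto)
      also have "\<dots> \<le> \<bar>C1\<bar> * (?e + ?e)"
        using b by (intro mult_left_mono add_mono exp_type) (auto simp: M_def)
      also have "\<dots> = 2 * \<bar>C1\<bar> * (M * exp W) * exp ((1 + c k) * cmod z)" by simp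
      also have "\<dots> \<le> N * exp ((1 + c k) * cmod z)" by (intro mult_right_mono NM) simp
      finally show ?thesis .
    qed
  qed blast
  have "cmod (E z) \<le> A * exp (\<delta> * cmod z)" for z
  proof (cases "\<bar>Re z\<bar> \<le> \<bar>Im z\<bar>")
    case True
    have "A * exp (48 * \<epsilon> * cmod z) \<le> A * exp (\<delta> * cmod z)"
      using A \<delta> by (intro mult_left_mono) (auto simp: \<epsilon>_def)
    then show ?thesis using vert[OF True] by linarith
  next
    case False
    have "cmod (E z) \<le> A * exp (sqrt 2 * (48 * \<epsilon>) * \<bar>Re z\<bar>)"
      by (rule sector_extension[OF E A3 A vert]) (use False in auto)
    moreover have "sqrt 2 * (48 * \<epsilon>) * \<bar>Re z\<bar> \<le> 2 * (48 * \<epsilon>) * cmod z"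
      using \<epsilon> real_sqrt_le_iff[of 2 4] abs_Re_le_cmod[of z] by (intro mult_mono) auto
    then have "A * exp (sqrt 2 * (48 * \<epsilon>) * \<bar>Re z\<bar>) \<le> A * exp (\<delta> * cmod z)"
      using A by (intro mult_left_mono) (auto simp: \<epsilon>_def)
    ultimately show ?thesis by linarith
  qed
  then show "\<exists>C. \<forall>z. cmod (E z) \<le> C * exp (\<delta> * cmod z)" by blast
qed

end

section \<open>The transform of an annihilating functional\<close>

text \<open>\<open>(\<psi>(z) \<phi>(\<lambda>) - \<psi>(\<lambda>) \<phi>(z)) / (z - \<lambda>)\<close>, written so that linearity in \<open>\<psi>\<close> and \<open>\<phi>\<close> is visible.\<close>

definition bezoutian :: "(complex \<Rightarrow> complex) \<Rightarrow> (complex \<Rightarrow> complex) \<Rightarrow> complex \<Rightarrow> complex \<Rightarrow> complex" where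
  "bezoutian \<psi> \<phi> l z = \<phi> l * divide_zero \<psi> l z - \<psi> l * divide_zero \<phi> l z"

lemma bezoutian_eq:
  assumes "\<psi> holomorphic_on UNIV" "\<phi> holomorphic_on UNIV"
  shows "bezoutian \<psi> \<phi> l = divide_zero (\<lambda>z. \<phi> l * \<psi> z + (- \<psi> l) * \<phi> z) l"
  unfolding bezoutian_def by (rule ext) (simp only: divide_zero_linear[OF assms], simp)

text \<open>Symmetry yields holomorphy in the parameter \<open>l\<close> from holomorphy in
  \<open>z\<close>.\<close>

lemma bezoutian_commute: "bezoutian \<psi> \<phi> l z = bezoutian \<psi> \<phi> z l"
proof (cases "z = l")
  case False
  then have "z - l \<noteq> 0" by simp
  moreover have "l - z = - (z - l)" by simp
  ultimately show ?thesis
    using False by (simp only: bezoutian_def divide_zero_def if_False times_divide_eq_right divide_minus_right)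
      (auto simp: field_simps)
qed simp

lemma bezoutian_shift:
  assumes "\<psi> holomorphic_on UNIV"
  shows "bezoutian (\<lambda>z. z * \<psi> z) \<phi> l z = \<phi> l * \<psi> z + l * bezoutian \<psi> \<phi> l z"
  using divide_zero_shift[OF assms, of l z] by (simp add: bezoutian_def algebra_simps)

context weight_space
begin

text \<open>The essential point is that \<open>C\<close> and \<open>m\<close> depend neither on
  \<open>f\<close> nor on the zero \<open>w\<close>.\<close>

lemma wbound_divide_zero:
  obtains m C where "k \<le> m" "C \<ge> 0"
    "\<And>A f w. wbound k A f \<Longrightarrow> f w = 0 \<Longrightarrow> wbound m (C * A) (divide_zero f w)"
proof -
  obtain m where m: "k \<le> m" "r k < r m" using exists_larger_r by blast
  \<comment> \<open>With this ratio, near-subadditivity of the weight shifts the argument by 2 at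
    the cost of passing from \<open>r k\<close> to \<open>r m\<close>. The shift is 2 because near
    \<open>w\<close> the value at \<open>z\<close> is estimated on the unit circle about
    \<open>w\<close>.\<close>
  define \<sigma> where "\<sigma> = r m / r k"
  have \<sigma>: "\<sigma> > 1" "r k * \<sigma> = r m" using m r_pos[of k] by (auto simp: \<sigma>_def)
  obtain C1 where C1: "C1 > 0" "\<And>x y. x \<ge> 0 \<Longrightarrow> y \<ge> 0 \<Longrightarrow> \<omega> (x + y) \<le> \<sigma> * (\<omega> x + \<omega> y) + C1"
    using weight_subadd[OF \<sigma>(1)] by blast
  define L where "L = r k * (\<sigma> * \<omega> 2 + C1) + 2 * c k"
  have L: "L \<ge> 0"
    unfolding L_def using r_pos[of k] c_pos[of k] \<sigma>(1) C1(1) weight_nonneg[of 2] by (intro add_nonneg_nonneg mult_nonneg_nonneg) auto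
  have "wbound m (exp L * A) (divide_zero f w)" if f: "wbound k A f" and fw: "f w = 0" for A f w
    unfolding wbound_def
  proof (intro conjI allI)
    have A: "A \<ge> 0" by (rule wbound_nonneg[OF f])
    show hol: "divide_zero f w holomorphic_on UNIV" by (rule holomorphic_divide_zero[OF wboundD(1)[OF f] fw])
    fix z
    have Ile: "r k * \<omega> (cmod u) + c k * \<bar>Im u\<bar> \<le> L + (r m * \<omega> (cmod z) + c m * \<bar>Im z\<bar>)" if u: "cmod (u - z) \<le> 2" for u
    proof -
      have "cmod u \<le> cmod z + 2" using norm_triangle_ineq2[of u z] u by linarith
      then have "\<omega> (cmod u) \<le> \<omega> (cmod z + 2)" by (intro weight_mono) auto
      also have "\<dots> \<le> \<sigma> * (\<omega> (cmod z) + \<omega> 2) + C1" by (intro C1) auto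
      finally have "r k * \<omega> (cmod u) \<le> r k * (\<sigma> * (\<omega> (cmod z) + \<omega> 2) + C1)"
        using r_pos[of k] by (intro mult_left_mono) auto
      also have "\<dots> = r m * \<omega> (cmod z) + r k * (\<sigma> * \<omega> 2 + C1)"
        unfolding \<sigma>(2)[symmetric] by (simp add: algebra_simps)
      finally have 1: "r k * \<omega> (cmod u) \<le> r m * \<omega> (cmod z) + r k * (\<sigma> * \<omega> 2 + C1)" .
      have "\<bar>Im u\<bar> \<le> \<bar>Im z\<bar> + 2" using abs_Im_le_cmod[of "u - z"] u by (auto simp: abs_le_iff)
      then have "c k * \<bar>Im u\<bar> \<le> c k * (\<bar>Im z\<bar> + 2)" using c_pos[of k] by (intro mult_left_mono) auto
      also have "\<dots> \<le> c m * \<bar>Im z\<bar> + 2 * c k"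
        using inc_c m(1) by (simp add: incseq_def distrib_left mult_right_mono)
      finally show ?thesis using 1 by (simp add: L_def)
    qed
    have fle: "cmod (f u) \<le> exp L * A * exp (r m * \<omega> (cmod z) + c m * \<bar>Im z\<bar>)" if u: "cmod (u - z) \<le> 2" for u
    proof -
      have "A * exp (r k * \<omega> (cmod u) + c k * \<bar>Im u\<bar>) \<le> A * exp (L + (r m * \<omega> (cmod z) + c m * \<bar>Im z\<bar>))"
        using A Ile[OF u] by (intro mult_left_mono) auto
      then show ?thesis using wboundD(2)[OF f, of u] by (simp add: exp_add mult_ac)
    qed
    show "cmod (divide_zero f w z) \<le> exp L * A * exp (r m * \<omega> (cmod z) + c m * \<bar>Im z\<bar>)"
    proof (cases "cmod (z - w) \<le> 1")
      case True
      show ?thesis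
      proof (rule maximum_modulus_unit_ball[OF hol _ True])
        fix u assume u: "cmod (u - w) = 1"
        then have "u \<noteq> w" by auto
        then have "cmod (divide_zero f w u) = cmod (f u)" using u by (simp add: divide_zero_def norm_divide)
        also have "\<dots> \<le> exp L * A * exp (r m * \<omega> (cmod z) + c m * \<bar>Im z\<bar>)"
          by (rule fle) (use norm_triangle_ineq4[of "u - w" "z - w"] u True in simp)
        finally show "cmod (divide_zero f w u) \<le> exp L * A * exp (r m * \<omega> (cmod z) + c m * \<bar>Im z\<bar>)" .
      qed
    next
      case False
      then have "z \<noteq> w" by auto
      then have "cmod (divide_zero f w z) = cmod (f z) / cmod (z - w)" by (simp add: divide_zero_def norm_divide)
      also have "\<dots> \<le> cmod (f z) / 1" using False by (intro divide_left_mono) auto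
      finally show ?thesis using fle[of z] by simp
    qed
  qed
  then show ?thesis using that[OF m(1), of "exp L"] by simp
qed

text \<open>The Lipschitz estimate for difference quotients holds pointwise with the weight as a
  factor, hence in the norm of step \<open>m\<close>, and the functional transfers it to
  scalars.\<close>

lemma functional_holomorphic:
  assumes add: "\<And>f g. f \<in> Pa \<omega> c r \<Longrightarrow> g \<in> Pa \<omega> c r \<Longrightarrow> S (\<lambda>z. f z + g z) = S f + S g"
    and scale: "\<And>f \<alpha>. f \<in> Pa \<omega> c r \<Longrightarrow> S (\<lambda>z. \<alpha> * f z) = \<alpha> * S f"
    and bound: "\<And>M f. wbound m M f \<Longrightarrow> cmod (S f) \<le> K * M"
    and hol: "\<And>z. (\<lambda>l. f l z) holomorphic_on UNIV"
    and loc: "\<And>R. \<exists>M. \<forall>l. cmod l \<le> R \<longrightarrow> wbound m M (f l)"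
  shows "(\<lambda>l. S (f l)) holomorphic_on UNIV"
proof -
  have fP: "f l \<in> Pa \<omega> c r" for l using loc[of "cmod l"] unfolding Pa_iff by blast
  note Vs = complex_subspaceD[OF complex_subspace_Pa]
  have diff: "S (\<lambda>z. u z - v z) = S u - S v" if "u \<in> Pa \<omega> c r" "v \<in> Pa \<omega> c r" for u v
    using add[OF that(1) Vs(3)[OF that(2), of "- 1"]] scale[OF that(2), of "- 1"] by simp
  have "\<exists>D. ((\<lambda>l. S (f l)) has_field_derivative D) (at x)" for x
  proof -
    obtain M where M: "\<And>l. cmod l \<le> cmod x + 2 \<Longrightarrow> wbound m M (f l)" using loc by blast
    have Mx: "wbound m M (f (x + h))" if "cmod h \<le> 2" for h
      by (rule M) (use norm_triangle_ineq[of x h] that in linarith)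
    have "cmod ((S (f (x + h)) - S (f x)) / h - (S (f (x + h')) - S (f x)) / h') \<le> (K * (2 * M)) * cmod (h - h')"
      if h: "cmod h \<le> 1" "h \<noteq> 0" "cmod h' \<le> 1" "h' \<noteq> 0" for h h'
    proof -
      define q where "q h z = (1 / h) * (f (x + h) z - f x z)" for h z
      have dP: "(\<lambda>z. f (x + h) z - f x z) \<in> Pa \<omega> c r" for h
        using Vs(2)[OF fP[of "x + h"] Vs(4)[OF fP[of x]]] by simp
      have qP: "q h \<in> Pa \<omega> c r" for h
        using Vs(3)[OF dP[of h], of "1 / h"] by (simp add: q_def[abs_def])
      have Sq: "S (q h) = (S (f (x + h)) - S (f x)) / h" for h
        unfolding q_def[abs_def] scale[OF dP] diff[OF fP fP] by simp
      have "wbound m (2 * M * cmod (h - h')) (\<lambda>z. q h z - q h' z)"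
        unfolding wbound_def
      proof (intro conjI allI)
        have "f l holomorphic_on UNIV" for l by (rule Pa_holomorphic[OF fP])
        then show "(\<lambda>z. q h z - q h' z) holomorphic_on UNIV"
          unfolding q_def by (intro holomorphic_intros)
        fix z
        define W where "W = exp (r m * \<omega> (cmod z) + c m * \<bar>Im z\<bar>)"
        have "cmod ((f (x + h) z - f (x + 0) z) / h - (f (x + h') z - f (x + 0) z) / h') \<le> 2 * (M * W) * cmod (h - h')"
        proof (rule difference_quotient_lipschitz[OF _ _ h])
          have "(\<lambda>l. f l z) \<circ> (\<lambda>h. x + h) holomorphic_on UNIV"
            by (rule holomorphic_on_compose_gen[OF _ hol]) (auto intro!: holomorphic_intros)
          then show "(\<lambda>h. f (x + h) z) holomorphic_on UNIV" by (simp add: o_def)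
          show "cmod (f (x + h) z) \<le> M * W" if "cmod h \<le> 2" for h
            using wboundD(2)[OF Mx[OF that]] by (simp add: W_def)
        qed
        then show "cmod (q h z - q h' z) \<le> 2 * M * cmod (h - h') * exp (r m * \<omega> (cmod z) + c m * \<bar>Im z\<bar>)"
          by (simp add: q_def W_def mult_ac)
      qed
      then have "cmod (S (\<lambda>z. q h z - q h' z)) \<le> K * (2 * M * cmod (h - h'))" by (rule bound)
      then show ?thesis unfolding diff[OF qP qP] Sq by (simp add: mult_ac)
    qed
    then show ?thesis using has_field_derivative_if_lipschitz_quotient[of "\<lambda>l. S (f l)" x "K * (2 * M)"] by blast
  qed
  then show ?thesis by (auto simp: holomorphic_on_def field_differentiable_def)
qed

text \<open>The functional is estimated on a larger step, but only its bound there enters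
  \<open>C\<close>; the resulting inequality mentions norms of step \<open>k\<close> alone and can
  be iterated.\<close>

lemma transform_exists:
  assumes J: "closed_submodule \<omega> c r J" "stable J" and \<phi>: "\<phi> \<in> J" "\<phi> \<noteq> (\<lambda>_. 0)"
    and add: "\<And>f g. f \<in> Pa \<omega> c r \<Longrightarrow> g \<in> Pa \<omega> c r \<Longrightarrow> S (\<lambda>z. f z + g z) = S f + S g"
    and scale: "\<And>f \<alpha>. f \<in> Pa \<omega> c r \<Longrightarrow> S (\<lambda>z. \<alpha> * f z) = \<alpha> * S f"
    and SJ: "\<And>f. f \<in> J \<Longrightarrow> S f = 0"
    and bound: "\<And>k. \<exists>C\<ge>0. \<forall>M f. wbound k M f \<longrightarrow> cmod (S f) \<le> C * M"
    and \<psi>: "\<psi> \<in> Pa \<omega> c r" "\<And>w. zero_set_mult J w \<le> vanishing_mult \<psi> w"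
  obtains E where "E holomorphic_on UNIV" "\<And>\<tau> l. \<tau> \<in> J \<Longrightarrow> E l * \<tau> l = S (bezoutian \<psi> \<tau> l)"
    "\<And>k. \<exists>C\<ge>0. \<forall>\<tau>\<in>J. \<forall>M N. wbound k M \<tau> \<longrightarrow> wbound k N \<psi> \<longrightarrow>
       (\<forall>l. cmod (E l * \<tau> l) \<le> C * (cmod (\<tau> l) * N + cmod (\<psi> l) * M))"
proof -
  note Js = complex_subspaceD[OF closed_submodule_subspace(1)[OF J(1)]]
  note JP = closed_submodule_subspace(2)[OF J(1)]
  note Vs = complex_subspaceD[OF complex_subspace_Pa]
  have holJ: "\<tau> holomorphic_on UNIV" if "\<tau> \<in> J" for \<tau> using that JP Pa_holomorphic by blast
  have hol\<psi>: "\<psi> holomorphic_on UNIV" by (rule Pa_holomorphic[OF \<psi>(1)])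
  define \<Phi> where "\<Phi> \<tau> l = S (bezoutian \<psi> \<tau> l)" for \<tau> l
  have bez: "\<exists>m C. C \<ge> 0 \<and> (\<forall>\<tau> M N l. wbound k M \<tau> \<longrightarrow> wbound k N \<psi> \<longrightarrow>
      wbound m (C * (cmod (\<tau> l) * N + cmod (\<psi> l) * M)) (bezoutian \<psi> \<tau> l))" for k
  proof -
    obtain m C where mC: "C \<ge> 0" "\<And>A f w. wbound k A f \<Longrightarrow> f w = 0 \<Longrightarrow> wbound m (C * A) (divide_zero f w)"
      using wbound_divide_zero[of k] by metis
    have "wbound m (C * (cmod (\<tau> l) * N + cmod (\<psi> l) * M)) (bezoutian \<psi> \<tau> l)"
      if "wbound k M \<tau>" "wbound k N \<psi>" for \<tau> M N l
    proof -
      have "wbound k (cmod (\<tau> l) * N + cmod (- \<psi> l) * M) (\<lambda>z. \<tau> l * \<psi> z + (- \<psi> l) * \<tau> z)"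
        by (intro wbound_add wbound_scale that)
      then have "wbound m (C * (cmod (\<tau> l) * N + cmod (- \<psi> l) * M)) (divide_zero (\<lambda>z. \<tau> l * \<psi> z + (- \<psi> l) * \<tau> z) l)"
        by (rule mC(2)) simp
      then show ?thesis by (simp only: bezoutian_eq[OF hol\<psi> wboundD(1)[OF that(1)]] norm_minus_cancel)
    qed
    then show ?thesis using mC(1) by blast
  qed
  have common: "\<exists>k M N. wbound k M \<tau> \<and> wbound k N \<psi>" if "\<tau> \<in> J" for \<tau>
    using Pa_common_bound[OF subsetD[OF JP that] \<psi>(1)] by metis
  have bezP: "bezoutian \<psi> \<tau> l \<in> Pa \<omega> c r" if \<tau>: "\<tau> \<in> J" for \<tau> l
  proof -
    obtain k M N where "wbound k M \<tau>" "wbound k N \<psi>" using common[OF \<tau>] by blast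
    then show ?thesis using bez[of k] unfolding Pa_iff by blast
  qed
  have \<Phi>_bound: "\<exists>C\<ge>0. \<forall>\<tau> M N. wbound k M \<tau> \<longrightarrow> wbound k N \<psi> \<longrightarrow>
       (\<forall>l. cmod (\<Phi> \<tau> l) \<le> C * (cmod (\<tau> l) * N + cmod (\<psi> l) * M))" for k
  proof -
    obtain m C where C: "C \<ge> 0" "\<And>\<tau> M N l. wbound k M \<tau> \<Longrightarrow> wbound k N \<psi> \<Longrightarrow>
      wbound m (C * (cmod (\<tau> l) * N + cmod (\<psi> l) * M)) (bezoutian \<psi> \<tau> l)" using bez[of k] by blast
    obtain K where K: "K \<ge> 0" "\<And>M f. wbound m M f \<Longrightarrow> cmod (S f) \<le> K * M" using bound[of m] by blast
    have "cmod (\<Phi> \<tau> l) \<le> (K * C) * (cmod (\<tau> l) * N + cmod (\<psi> l) * M)"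
      if "wbound k M \<tau>" "wbound k N \<psi>" for \<tau> M N l
      using K(2)[OF C(2)[OF that, of l]] by (simp add: \<Phi>_def mult.assoc)
    then show ?thesis using K(1) C(1) by (intro exI[of _ "K * C"]) auto
  qed
  have hol\<Phi>: "\<Phi> \<tau> holomorphic_on UNIV" if \<tau>: "\<tau> \<in> J" for \<tau>
  proof -
    obtain k M N where kMN: "wbound k M \<tau>" "wbound k N \<psi>" using common[OF \<tau>] by blast
    obtain m C where C: "C \<ge> 0" "\<And>l. wbound m (C * (cmod (\<tau> l) * N + cmod (\<psi> l) * M)) (bezoutian \<psi> \<tau> l)"
      using bez[of k] kMN by blast
    obtain K where K: "\<And>M f. wbound m M f \<Longrightarrow> cmod (S f) \<le> K * M" using bound[of m] by blast
    show ?thesis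
      unfolding \<Phi>_def[abs_def]
    proof (rule functional_holomorphic[OF add scale K])
      show "(\<lambda>l. bezoutian \<psi> \<tau> l z) holomorphic_on UNIV" for z
      proof -
        have "(\<lambda>l. bezoutian \<psi> \<tau> l z) = bezoutian \<psi> \<tau> z" by (rule ext) (rule bezoutian_commute)
        then show ?thesis using Pa_holomorphic[OF bezP[OF \<tau>]] by simp
      qed
      fix R :: real
      have "bounded ((\<lambda>l. C * (cmod (\<tau> l) * N + cmod (\<psi> l) * M)) ` cball 0 R)"
        by (intro compact_imp_bounded compact_continuous_image continuous_intros
          continuous_on_subset[OF holomorphic_on_imp_continuous_on[OF holJ[OF \<tau>]]]
          continuous_on_subset[OF holomorphic_on_imp_continuous_on[OF hol\<psi>]]) auto
      then obtain B where B: "\<forall>x\<in>(\<lambda>l. C * (cmod (\<tau> l) * N + cmod (\<psi> l) * M)) ` cball 0 R. norm x \<le> B"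
        unfolding bounded_iff by blast
      have "wbound m B (bezoutian \<psi> \<tau> l)" if "cmod l \<le> R" for l
      proof (rule wbound_mono[OF C(2)[of l]])
        have "l \<in> cball 0 R" using that by simp
        then have "norm (C * (cmod (\<tau> l) * N + cmod (\<psi> l) * M)) \<le> B" using B by blast
        then show "C * (cmod (\<tau> l) * N + cmod (\<psi> l) * M) \<le> B" unfolding real_norm_def by linarith
      qed simp
      then show "\<exists>M. \<forall>l. cmod l \<le> R \<longrightarrow> wbound m M (bezoutian \<psi> \<tau> l)" by blast
    qed
  qed
  \<comment> \<open>At a common zero of \<open>J\<close> both sides vanish. Elsewhere the minimal
    multiplicity is 0, so stability puts the divided combination of \<open>\<tau>\<close> and
    \<open>\<upsilon>\<close> into \<open>J\<close>, where \<open>S\<close> vanishes.\<close>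
  have swap: "\<Phi> \<tau> l * \<upsilon> l = \<Phi> \<upsilon> l * \<tau> l" if \<tau>: "\<tau> \<in> J" and \<upsilon>: "\<upsilon> \<in> J" for \<tau> \<upsilon> l
  proof (cases "zero_set_mult J l = 0")
    case False
    then have "1 \<le> zero_set_mult J l" by (simp add: ileI1 one_eSuc)
    then have "1 \<le> vanishing_mult f l" if "f \<in> J" for f
      using that unfolding zero_set_mult_def by (rule order.trans[OF _ INF_lower])
    then have "\<tau> l = 0" "\<upsilon> l = 0" using zero_if_vanishing_mult holJ \<tau> \<upsilon> by blast+
    then show ?thesis by simp
  next
    case True
    define N where "N = (\<lambda>z. \<upsilon> l * \<tau> z + (- \<tau> l) * \<upsilon> z)"
    have NJ: "N \<in> J" unfolding N_def by (intro Js \<tau> \<upsilon>)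
    have "vanishing_mult N l > 0" by (rule vanishing_mult_pos[OF holJ[OF NJ]]) (simp add: N_def)
    then have DJ: "divide_zero N l \<in> J"
      using J(2) NJ True unfolding stable_def stable_at_def by simp
    have eq: "(\<lambda>z. \<upsilon> l * bezoutian \<psi> \<tau> l z + (- \<tau> l) * bezoutian \<psi> \<upsilon> l z) = (\<lambda>z. (- \<psi> l) * divide_zero N l z)"
      unfolding N_def bezoutian_def
      by (rule ext) (simp only: divide_zero_linear[OF holJ[OF \<tau>] holJ[OF \<upsilon>]], simp add: algebra_simps)
    have "\<upsilon> l * \<Phi> \<tau> l + (- \<tau> l) * \<Phi> \<upsilon> l = S (\<lambda>z. \<upsilon> l * bezoutian \<psi> \<tau> l z + (- \<tau> l) * bezoutian \<psi> \<upsilon> l z)"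
      unfolding \<Phi>_def add[OF Vs(3)[OF bezP[OF \<tau>]] Vs(3)[OF bezP[OF \<upsilon>]]] scale[OF bezP[OF \<tau>]] scale[OF bezP[OF \<upsilon>]] ..
    also have "\<dots> = (- \<psi> l) * S (divide_zero N l)" unfolding eq by (rule scale) (use DJ JP in auto)
    also have "\<dots> = 0" using SJ[OF DJ] by simp
    finally show ?thesis by (simp add: algebra_simps)
  qed
  \<comment> \<open>An element \<open>\<tau>\<close> of least multiplicity \<open>n\<close> at
    \<open>w\<close> is used: the norm bound makes \<open>\<Phi> \<tau>\<close> vanish to order
    \<open>n\<close>, and comparing orders in
    \<open>\<Phi> \<phi> * \<tau> = \<Phi> \<tau> * \<phi>\<close> cancels \<open>n\<close>.\<close>
  have ord: "vanishing_mult \<phi> w \<le> vanishing_mult (\<Phi> \<phi>) w" for w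
  proof (cases "\<Phi> \<phi> = (\<lambda>_. 0)")
    case True
    then show ?thesis by (simp add: vanishing_mult_def)
  next
    case False
    \<comment> \<open>The infimum is attained because \<open>enat\<close> is well-ordered.\<close>
    have "zero_set_mult J w \<in> (\<lambda>f. vanishing_mult f w) ` J"
    proof -
      let ?A = "(\<lambda>f. vanishing_mult f w) ` J"
      have "vanishing_mult \<phi> w \<in> ?A" using \<phi>(1) by blast
      then have "(LEAST x. x \<in> ?A) \<in> ?A" by (rule LeastI)
      moreover have "?A \<noteq> {}" using \<phi>(1) by blast
      ultimately show ?thesis unfolding zero_set_mult_def Inf_enat_def by (simp only: if_False)
    qed
    then obtain \<tau> where \<tau>: "\<tau> \<in> J" "vanishing_mult \<tau> w = zero_set_mult J w" by auto
    have \<tau>nz: "\<tau> \<noteq> (\<lambda>_. 0)"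
    proof
      assume "\<tau> = (\<lambda>_. 0)"
      then have "zero_set_mult J w = \<infinity>" using \<tau>(2) by (simp add: vanishing_mult_def)
      moreover have "zero_set_mult J w \<le> vanishing_mult \<phi> w"
        unfolding zero_set_mult_def using \<phi>(1) by (rule INF_lower)
      ultimately show False using \<phi>(2) by (simp add: vanishing_mult_def)
    qed
    obtain h1 where h1: "h1 holomorphic_on UNIV" "h1 w \<noteq> 0" "\<And>z. \<phi> z = (z - w) ^ nat (zorder \<phi> w) * h1 z"
      "vanishing_mult \<phi> w = enat (nat (zorder \<phi> w))" using vanishing_mult_factor[OF holJ[OF \<phi>(1)] \<phi>(2)] by blast
    obtain h2 where h2: "h2 holomorphic_on UNIV" "h2 w \<noteq> 0" "\<And>z. \<tau> z = (z - w) ^ nat (zorder \<tau> w) * h2 z"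
      "vanishing_mult \<tau> w = enat (nat (zorder \<tau> w))" using vanishing_mult_factor[OF holJ[OF \<tau>(1)] \<tau>nz] by blast
    obtain q where q: "q holomorphic_on UNIV" "q w \<noteq> 0" "\<And>z. \<Phi> \<phi> z = (z - w) ^ nat (zorder (\<Phi> \<phi>) w) * q z"
      "vanishing_mult (\<Phi> \<phi>) w = enat (nat (zorder (\<Phi> \<phi>) w))" using vanishing_mult_factor[OF hol\<Phi>[OF \<phi>(1)] False] by blast
    define m n p where "m = nat (zorder \<phi> w)" and "n = nat (zorder \<tau> w)" and "p = nat (zorder (\<Phi> \<phi>) w)"
    have "enat n \<le> vanishing_mult (\<Phi> \<tau>) w"
    proof -
      obtain k M N where kMN: "wbound k M \<tau>" "wbound k N \<psi>" using common[OF \<tau>(1)] by blast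
      obtain C where C: "C \<ge> 0" "\<And>l. cmod (\<Phi> \<tau> l) \<le> C * (cmod (\<tau> l) * N + cmod (\<psi> l) * M)"
        using \<Phi>_bound[of k] kMN by blast
      obtain B1 where B1: "\<And>z. cmod (z - w) \<le> 1 \<Longrightarrow> cmod (\<tau> z) \<le> B1" using holomorphic_bounded_sphere[OF holJ[OF \<tau>(1)]] by blast
      obtain B2 where B2: "\<And>z. cmod (z - w) \<le> 1 \<Longrightarrow> cmod (\<psi> z) \<le> B2" using holomorphic_bounded_sphere[OF hol\<psi>] by blast
      have "enat n \<le> vanishing_mult \<psi> w" using \<psi>(2)[of w] \<tau>(2) h2(4) by (simp add: n_def)
      show ?thesis
      proof (rule le_vanishing_multI[OF hol\<Phi>[OF \<tau>(1)]])
        fix z assume z: "cmod (z - w) \<le> 1"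
        have "cmod (\<tau> z) \<le> B1 * cmod (z - w) ^ n"
          by (rule vanishing_mult_bound[OF holJ[OF \<tau>(1)] _ _ z]) (use B1 h2(4) in \<open>auto simp: n_def\<close>)
        moreover have "cmod (\<psi> z) \<le> B2 * cmod (z - w) ^ n"
          by (rule vanishing_mult_bound[OF hol\<psi> \<open>enat n \<le> vanishing_mult \<psi> w\<close> _ z]) (use B2 in auto)
        ultimately have "C * (cmod (\<tau> z) * N + cmod (\<psi> z) * M) \<le> C * (B1 * cmod (z - w) ^ n * N + B2 * cmod (z - w) ^ n * M)"
          using C(1) wbound_nonneg[OF kMN(1)] wbound_nonneg[OF kMN(2)] by (intro mult_left_mono add_mono mult_right_mono)
        then show "cmod (\<Phi> \<tau> z) \<le> (C * (B1 * N + B2 * M)) * cmod (z - w) ^ n"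
          using C(2)[of z] by (simp add: algebra_simps)
      qed
    qed
    then obtain g where g: "g holomorphic_on UNIV" "\<And>z. \<Phi> \<tau> z = (z - w) ^ n * g z"
      using vanishing_mult_power[OF hol\<Phi>[OF \<tau>(1)]] by blast
    have "n + m \<le> p + n"
    proof (rule power_factor_le)
      show "(z - w) ^ (p + n) * (q z * h2 z) = (z - w) ^ (n + m) * (g z * h1 z)" for z
      proof -
        have "(z - w) ^ p * q z * ((z - w) ^ n * h2 z) = (z - w) ^ n * g z * ((z - w) ^ m * h1 z)"
          using swap[OF \<phi>(1) \<tau>(1), of z] unfolding q(3) h2(3) g(2) h1(3)[symmetric] p_def[symmetric] n_def[symmetric]
          by (simp add: h1(3) m_def[symmetric])
        then show ?thesis by (simp add: power_add mult_ac)
      qed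
      show "q w * h2 w \<noteq> 0" using q h2 by simp
      have cont: "isCont f w" if "f holomorphic_on UNIV" for f :: "complex \<Rightarrow> complex"
        using holomorphic_on_imp_continuous_on[OF that] by (simp add: continuous_on_eq_continuous_at)
      show "isCont (\<lambda>z. q z * h2 z) w" "isCont (\<lambda>z. g z * h1 z) w"
        by (intro cont holomorphic_intros q h2 g h1)+
    qed
    then show ?thesis using h1(4) q(4) by (simp add: m_def p_def)
  qed
  obtain E where E: "E holomorphic_on UNIV" "\<And>z. \<Phi> \<phi> z = E z * \<phi> z"
    using entire_quotient[OF hol\<Phi>[OF \<phi>(1)] holJ[OF \<phi>(1)] \<phi>(2) ord] by blast
  \<comment> \<open>The exchange relation gives this off the zeros of \<open>\<phi>\<close>, and the
    identity theorem extends it.\<close>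
  have E\<tau>: "E l * \<tau> l = \<Phi> \<tau> l" if \<tau>: "\<tau> \<in> J" for \<tau> l
  proof -
    have "(\<lambda>l. E l * \<tau> l - \<Phi> \<tau> l) l = 0"
    proof (rule entire_mult_eq_zero[of "\<lambda>l. E l * \<tau> l - \<Phi> \<tau> l", OF _ holJ[OF \<phi>(1)] _ \<phi>(2)])
      show "(\<lambda>l. E l * \<tau> l - \<Phi> \<tau> l) holomorphic_on UNIV" by (intro holomorphic_intros E holJ hol\<Phi> \<tau>)
      show "(E z * \<tau> z - \<Phi> \<tau> z) * \<phi> z = 0" for z
        using swap[OF \<phi>(1) \<tau>, of z] E(2)[of z] by (simp add: algebra_simps)
    qed
    then show ?thesis by simp
  qed
  show ?thesis
  proof (rule that[OF E(1)])
    show "E l * \<tau> l = S (bezoutian \<psi> \<tau> l)" if "\<tau> \<in> J" for \<tau> l using E\<tau>[OF that] by (simp add: \<Phi>_def)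
    show "\<exists>C\<ge>0. \<forall>\<tau>\<in>J. \<forall>M N. wbound k M \<tau> \<longrightarrow> wbound k N \<psi> \<longrightarrow>
       (\<forall>l. cmod (E l * \<tau> l) \<le> C * (cmod (\<tau> l) * N + cmod (\<psi> l) * M))" for k
    proof -
      obtain C where "C \<ge> 0" "\<And>\<tau> M N l. wbound k M \<tau> \<Longrightarrow> wbound k N \<psi> \<Longrightarrow>
         cmod (\<Phi> \<tau> l) \<le> C * (cmod (\<tau> l) * N + cmod (\<psi> l) * M)"
        using \<Phi>_bound[of k] by blast
      then show ?thesis using E\<tau> by (intro exI[of _ C]) simp
    qed
  qed
qed

section \<open>Constancy of the transform and the converse implication\<close>

text \<open>Multiplication by \<open>E\<close> maps the iterates back into the same step with a
  fixed factor \<open>B\<close>, while minimal type of the powers keeps them in \<open>J\<close>,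
  where the bound applies again. Taking n-th roots leaves \<open>cmod (E z) \<le> B\<close>.\<close>

lemma transform_constant:
  assumes \<phi>: "\<phi> \<in> J" "\<phi> \<noteq> (\<lambda>_. 0)" "multiplier_submodule \<omega> c r \<phi> \<subseteq> J" and JP: "J \<subseteq> Pa \<omega> c r"
    and \<psi>: "\<psi> \<in> Pa \<omega> c r" and E: "minimal_type E"
    and bnd: "\<And>k. \<exists>C\<ge>0. \<forall>\<tau>\<in>J. \<forall>M N. wbound k M \<tau> \<longrightarrow> wbound k N \<psi> \<longrightarrow>
       (\<forall>l. cmod (E l * \<tau> l) \<le> C * (cmod (\<tau> l) * N + cmod (\<psi> l) * M))"
  obtains e where "\<And>z. E z = e"
proof -
  have holE: "E holomorphic_on UNIV" using E by (simp add: minimal_type_def)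
  obtain k M N where kM: "wbound k M \<phi>" and kN: "wbound k N \<psi>"
    using Pa_common_bound[OF subsetD[OF JP \<phi>(1)] \<psi>] .
  obtain C where C: "C \<ge> 0" "\<And>\<tau> M N l. \<tau> \<in> J \<Longrightarrow> wbound k M \<tau> \<Longrightarrow> wbound k N \<psi> \<Longrightarrow>
       cmod (E l * \<tau> l) \<le> C * (cmod (\<tau> l) * N + cmod (\<psi> l) * M)" using bnd[of k] by blast
  \<comment> \<open>Both summands of the bound contribute \<open>C * N\<close> times the norm of the
    current iterate.\<close>
  define B where "B = 2 * C * N"
  have N0: "N \<ge> 0" by (rule wbound_nonneg[OF kN])
  have B0: "B \<ge> 0" using C(1) N0 by (simp add: B_def)
  have iter: "(\<lambda>z. E z ^ n * \<phi> z) \<in> J \<and> wbound k (B ^ n * M) (\<lambda>z. E z ^ n * \<phi> z)" for n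
  proof (induction n)
    case 0
    then show ?case using \<phi>(1) kM by simp
  next
    case (Suc n)
    define \<tau> where "\<tau> = (\<lambda>z. E z ^ n * \<phi> z)"
    define K where "K = B ^ n * M"
    have \<tau>: "\<tau> \<in> J" "wbound k K \<tau>" using Suc by (auto simp: \<tau>_def K_def)
    have "wbound k (B * K) (\<lambda>z. E z * \<tau> z)"
      unfolding wbound_def
    proof (intro conjI allI)
      show "(\<lambda>z. E z * \<tau> z) holomorphic_on UNIV" by (intro holomorphic_intros holE wboundD(1)[OF \<tau>(2)])
      fix z
      let ?W = "exp (r k * \<omega> (cmod z) + c k * \<bar>Im z\<bar>)"
      have "cmod (E z * \<tau> z) \<le> C * (cmod (\<tau> z) * N + cmod (\<psi> z) * K)" by (rule C(2)[OF \<tau> kN])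
      also have "\<dots> \<le> C * ((K * ?W) * N + (N * ?W) * K)"
        using C(1) N0 wbound_nonneg[OF \<tau>(2)]
        by (intro mult_left_mono add_mono mult_right_mono wboundD(2)[OF \<tau>(2)] wboundD(2)[OF kN]) auto
      also have "\<dots> = B * K * ?W" by (simp add: B_def algebra_simps)
      finally show "cmod (E z * \<tau> z) \<le> B * K * ?W" .
    qed
    then have wb: "wbound k (B ^ Suc n * M) (\<lambda>z. E z ^ Suc n * \<phi> z)" by (simp add: \<tau>_def K_def mult.assoc)
    have "(\<lambda>z. E z ^ Suc n * \<phi> z) \<in> multiplier_submodule \<omega> c r \<phi>"
      unfolding multiplier_submodule_def
    proof (intro CollectI conjI exI)
      show "(\<lambda>z. E z ^ Suc n * \<phi> z) \<in> Pa \<omega> c r" unfolding Pa_iff using wb by blast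
      show "minimal_type (\<lambda>z. E z ^ Suc n)" by (rule minimal_type_power[OF E])
    qed (rule refl)
    then show ?case using wb \<phi>(3) by blast
  qed
  have off: "cmod (E z) \<le> B" if "\<phi> z \<noteq> 0" for z
  proof (rule le_if_power_growth)
    show "cmod (E z) ^ n * cmod (\<phi> z) \<le> B ^ n * (M * exp (r k * \<omega> (cmod z) + c k * \<bar>Im z\<bar>))" for n
      using wboundD(2)[OF conjunct2[OF iter[of n]], of z] by (simp add: norm_mult norm_power mult.assoc)
  qed (use that B0 in auto)
  have "cmod (E z) \<le> B" for z
  proof -
    \<comment> \<open>Zeros of \<open>\<phi>\<close> are isolated, so continuity extends the bound
      to them.\<close>
    have "eventually (\<lambda>u. \<phi> u \<noteq> 0) (at z)" by (rule eventually_nonzero[OF wboundD(1)[OF kM] \<phi>(2)])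
    then have "eventually (\<lambda>u. cmod (E u) \<le> B) (at z)" by eventually_elim (rule off)
    moreover have "((\<lambda>u. cmod (E u)) \<longlongrightarrow> cmod (E z)) (at z)"
      using holomorphic_on_imp_continuous_on[OF holE] by (intro tendsto_intros) (simp add: continuous_on_def)
    ultimately show ?thesis by (intro tendsto_upperbound) auto
  qed
  then have "bounded (range E)" by (auto simp: bounded_iff)
  then show ?thesis using Liouville_theorem[OF holE] that by (auto simp: constant_on_def)
qed

lemma weakly_localisable_if_multiplier_submodule:
  assumes J: "closed_submodule \<omega> c r J" "stable J"
    and \<phi>: "\<phi> \<in> J" "\<phi> \<noteq> (\<lambda>_. 0)" "multiplier_submodule \<omega> c r \<phi> \<subseteq> J"
    and J': "closed_submodule \<omega> c r J'" "J \<subseteq> J'" "zero_set_mult J' = zero_set_mult J"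
      "indicator_segment J' = indicator_segment J"
  shows "J' \<subseteq> J"
proof (rule subsetI, rule ccontr)
  fix \<psi> assume \<psi>: "\<psi> \<in> J'" "\<psi> \<notin> J"
  note JP = closed_submodule_subspace(2)[OF J(1)]
  note J'P = closed_submodule_subspace(2)[OF J'(1)]
  have \<psi>P: "\<psi> \<in> Pa \<omega> c r" using \<psi>(1) J'P by blast
  obtain S where S: "\<And>f g. f \<in> Pa \<omega> c r \<Longrightarrow> g \<in> Pa \<omega> c r \<Longrightarrow> S (\<lambda>z. f z + g z) = S f + S g"
    "\<And>f \<alpha>. f \<in> Pa \<omega> c r \<Longrightarrow> S (\<lambda>z. \<alpha> * f z) = \<alpha> * S f"
    "\<And>f. f \<in> J \<Longrightarrow> S f = 0" "S \<psi> \<noteq> 0"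
    "\<And>k. \<exists>C\<ge>0. \<forall>M f. wbound k M f \<longrightarrow> cmod (S f) \<le> C * M"
    using closed_submodule_separation[OF J(1) \<psi>P \<psi>(2)] by blast
  \<comment> \<open>Equal intervals have equal endpoints only if they are nonempty, which any
    nonzero element of \<open>J\<close> guarantees.\<close>
  have seg: "(INF f\<in>J' - {\<lambda>_. 0}. ind_lower f) = (INF f\<in>J - {\<lambda>_. 0}. ind_lower f)"
    "(SUP f\<in>J' - {\<lambda>_. 0}. ind_upper f) = (SUP f\<in>J - {\<lambda>_. 0}. ind_upper f)"
  proof -
    obtain k M where "wbound k M \<phi>" using subsetD[OF JP \<phi>(1)] unfolding Pa_iff by blast
    then have "ind_lower \<phi> \<le> ind_upper \<phi>" by (rule wbound_segment_nonempty[OF _ \<phi>(2)])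
    moreover have "(INF f\<in>J - {\<lambda>_. 0}. ind_lower f) \<le> ind_lower \<phi>" using \<phi> by (intro INF_lower) auto
    moreover have "ind_upper \<phi> \<le> (SUP f\<in>J - {\<lambda>_. 0}. ind_upper f)" using \<phi> by (intro SUP_upper) auto
    ultimately have "(INF f\<in>J - {\<lambda>_. 0}. ind_lower f) \<le> (SUP f\<in>J - {\<lambda>_. 0}. ind_upper f)" by (meson order.trans)
    then show "(INF f\<in>J' - {\<lambda>_. 0}. ind_lower f) = (INF f\<in>J - {\<lambda>_. 0}. ind_lower f)"
      "(SUP f\<in>J' - {\<lambda>_. 0}. ind_upper f) = (SUP f\<in>J - {\<lambda>_. 0}. ind_upper f)"
      using J'(4) unfolding indicator_segment_def by (auto simp: Icc_eq_Icc)
  qed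
  \<comment> \<open>Stated for all of \<open>J'\<close>, since it is applied to multiples of
    \<open>\<psi>\<close> by powers of \<open>z\<close> as well.\<close>
  have const: "\<exists>e. \<forall>l. e * \<phi> l = S (bezoutian \<tau> \<phi> l)" if \<tau>: "\<tau> \<in> J'" for \<tau>
  proof (cases "\<tau> = (\<lambda>_. 0)")
    case True
    have "S (\<lambda>_. 0) = 0" using S(2)[OF \<psi>P, of 0] by simp
    moreover have "bezoutian \<tau> \<phi> l = (\<lambda>_. 0)" for l
      unfolding True by (rule ext) (auto simp: bezoutian_def divide_zero_def)
    ultimately have "0 * \<phi> l = S (bezoutian \<tau> \<phi> l)" for l by simp
    then show ?thesis by blast
  next
    case False
    have \<tau>P: "\<tau> \<in> Pa \<omega> c r" using \<tau> J'P by blast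
    have "zero_set_mult J w \<le> vanishing_mult \<tau> w" for w
      unfolding J'(3)[symmetric] zero_set_mult_def using \<tau> by (rule INF_lower)
    then obtain E where E: "E holomorphic_on UNIV" "\<And>\<upsilon> l. \<upsilon> \<in> J \<Longrightarrow> E l * \<upsilon> l = S (bezoutian \<tau> \<upsilon> l)"
      "\<And>k. \<exists>C\<ge>0. \<forall>\<upsilon>\<in>J. \<forall>M N. wbound k M \<upsilon> \<longrightarrow> wbound k N \<tau> \<longrightarrow>
         (\<forall>l. cmod (E l * \<upsilon> l) \<le> C * (cmod (\<upsilon> l) * N + cmod (\<tau> l) * M))"
      using transform_exists[OF J \<phi>(1,2) S(1,2,3,5) \<tau>P] by blast
    obtain k M where kM: "wbound k M \<tau>" using \<tau>P unfolding Pa_iff by blast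
    have fin: "\<bar>ind_upper \<tau>\<bar> \<noteq> \<infinity>" "\<bar>ind_lower \<tau>\<bar> \<noteq> \<infinity>"
    proof -
      obtain u where "indicator_fun \<tau> (pi / 2) = ereal u" using indicator_fun_upper_real[OF kM False] by blast
      then show "\<bar>ind_upper \<tau>\<bar> \<noteq> \<infinity>" by (simp add: ind_upper_def)
      have "(\<lambda>z. \<tau> (- z)) \<noteq> (\<lambda>_. 0)"
      proof
        assume *: "(\<lambda>z. \<tau> (- z)) = (\<lambda>_. 0)"
        have "\<tau> z = 0" for z using fun_cong[OF *, of "- z"] by simp
        then show False using False by auto
      qed
      then obtain v where "indicator_fun (\<lambda>z. \<tau> (- z)) (pi / 2) = ereal v"
        using indicator_fun_upper_real[OF wbound_reflect[OF kM]] by blast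
      then show "\<bar>ind_lower \<tau>\<bar> \<noteq> \<infinity>" unfolding ind_lower_def indicator_fun_lower by simp
    qed
    have "minimal_type E"
    proof (rule quotient_minimal_type[OF E(1) \<tau>P False JP])
      fix \<epsilon> :: real assume \<epsilon>: "\<epsilon> > 0"
      have "ind_upper \<tau> \<le> (SUP f\<in>J - {\<lambda>_. 0}. ind_upper f)"
        unfolding seg(2)[symmetric] using \<tau> False by (intro SUP_upper) auto
      moreover have "ind_upper \<tau> - ereal \<epsilon> < ind_upper \<tau>" using fin(1) \<epsilon> by (cases "ind_upper \<tau>") auto
      ultimately have "ind_upper \<tau> - ereal \<epsilon> < (SUP f\<in>J - {\<lambda>_. 0}. ind_upper f)" by (rule less_le_trans[rotated])
      then obtain f where f: "f \<in> J - {\<lambda>_. 0}" "ind_upper \<tau> - ereal \<epsilon> < ind_upper f" unfolding less_SUP_iff by blast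
      have "ind_upper \<tau> < ind_upper f + ereal \<epsilon>"
        using f(2) by (cases "ind_upper \<tau>"; cases "ind_upper f") auto
      with f(1) show "\<exists>f\<in>J - {\<lambda>_. 0}. ind_upper \<tau> < ind_upper f + ereal \<epsilon>" by blast
    next
      fix \<epsilon> :: real assume \<epsilon>: "\<epsilon> > 0"
      have "(INF f\<in>J - {\<lambda>_. 0}. ind_lower f) \<le> ind_lower \<tau>"
        unfolding seg(1)[symmetric] using \<tau> False by (intro INF_lower) auto
      moreover have "ind_lower \<tau> < ind_lower \<tau> + ereal \<epsilon>" using fin(2) \<epsilon> by (cases "ind_lower \<tau>") auto
      ultimately have "(INF f\<in>J - {\<lambda>_. 0}. ind_lower f) < ind_lower \<tau> + ereal \<epsilon>" by (rule le_less_trans)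
      then show "\<exists>f\<in>J - {\<lambda>_. 0}. ind_lower f < ind_lower \<tau> + ereal \<epsilon>" unfolding INF_less_iff .
    next
      fix \<upsilon> assume \<upsilon>: "\<upsilon> \<in> J"
      obtain k M N where kM: "wbound k M \<upsilon>" and kN: "wbound k N \<tau>"
        using Pa_common_bound[OF subsetD[OF JP \<upsilon>] \<tau>P] .
      obtain C where C: "C \<ge> 0" "\<And>l. cmod (E l * \<upsilon> l) \<le> C * (cmod (\<upsilon> l) * N + cmod (\<tau> l) * M)"
        using E(3)[of k] \<upsilon> kM kN by blast
      have "cmod (E l * \<upsilon> l) \<le> (C * (N + M)) * (cmod (\<upsilon> l) + cmod (\<tau> l))" for l
      proof -
        have "C * (cmod (\<upsilon> l) * N + cmod (\<tau> l) * M) \<le> C * (cmod (\<upsilon> l) * (N + M) + cmod (\<tau> l) * (N + M))"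
          using C(1) wbound_nonneg[OF kM] wbound_nonneg[OF kN] by (intro mult_left_mono add_mono) auto
        then show ?thesis using C(2)[of l] by (simp add: algebra_simps)
      qed
      then show "\<exists>C. \<forall>z. cmod (E z * \<upsilon> z) \<le> C * (cmod (\<upsilon> z) + cmod (\<tau> z))" by blast
    qed
    then obtain e where "\<And>z. E z = e" using transform_constant[OF \<phi> JP \<tau>P _ E(3)] by blast
    then show ?thesis using E(2)[OF \<phi>(1)] by metis
  qed
  \<comment> \<open>The shift rule gives \<open>e' = S \<tau> + l * e\<close> wherever
    \<open>\<phi> l\<close> is nonzero; two such points \<open>l\<close> force
    \<open>e = 0\<close>.\<close>
  have shift: "e' = S \<tau> \<and> e = 0"
    if \<tau>: "\<tau> \<in> J'" and e: "\<And>l. e * \<phi> l = S (bezoutian \<tau> \<phi> l)" and e': "\<And>l. e' * \<phi> l = S (bezoutian (\<lambda>z. z * \<tau> z) \<phi> l)"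
    for \<tau> e e'
  proof -
    have \<tau>P: "\<tau> \<in> Pa \<omega> c r" using \<tau> J'P by blast
    note Vs = complex_subspaceD[OF complex_subspace_Pa]
    have \<phi>P: "\<phi> \<in> Pa \<omega> c r" using \<phi>(1) JP by blast
    have eq: "e' = S \<tau> + l * e" if l: "\<phi> l \<noteq> 0" for l
    proof -
      have bP: "bezoutian \<tau> \<phi> l \<in> Pa \<omega> c r"
      proof -
        obtain k M N where *: "wbound k M \<tau>" "wbound k N \<phi>" using Pa_common_bound[OF \<tau>P \<phi>P] .
        obtain m C where "\<And>A f w. wbound k A f \<Longrightarrow> f w = 0 \<Longrightarrow> wbound m (C * A) (divide_zero f w)"
          using wbound_divide_zero[of k] by metis
        from this[OF wbound_add[OF wbound_scale[OF *(1)] wbound_scale[OF *(2)]], of "\<phi> l" l "- \<tau> l"]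
        have "wbound m (C * (cmod (\<phi> l) * M + cmod (- \<tau> l) * N)) (divide_zero (\<lambda>z. \<phi> l * \<tau> z + (- \<tau> l) * \<phi> z) l)"
          by simp
        then show ?thesis unfolding bezoutian_eq[OF wboundD(1)[OF *(1)] wboundD(1)[OF *(2)]] Pa_iff by blast
      qed
      have "e' * \<phi> l = S (\<lambda>z. \<phi> l * \<tau> z + l * bezoutian \<tau> \<phi> l z)"
        unfolding e' bezoutian_shift[OF Pa_holomorphic[OF \<tau>P]] ..
      also have "\<dots> = \<phi> l * S \<tau> + l * S (bezoutian \<tau> \<phi> l)"
        unfolding S(1)[OF Vs(3)[OF \<tau>P] Vs(3)[OF bP]] S(2)[OF \<tau>P] S(2)[OF bP] ..
      also have "S (bezoutian \<tau> \<phi> l) = e * \<phi> l" by (rule e[symmetric])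
      finally have "\<phi> l * e' = \<phi> l * (S \<tau> + l * e)" by (simp add: algebra_simps)
      then show ?thesis using l by simp
    qed
    obtain l1 where l1: "\<phi> l1 \<noteq> 0" using \<phi>(2) by auto
    have "eventually (\<lambda>l. \<phi> l \<noteq> 0 \<and> l \<noteq> l1) (at l1)"
      using eventually_nonzero[OF Pa_holomorphic[OF \<phi>P] \<phi>(2), of l1] eventually_neq_at_within[of l1 l1 UNIV]
      by eventually_elim auto
    then have "\<exists>l. \<phi> l \<noteq> 0 \<and> l \<noteq> l1" by (rule eventually_happens'[rotated]) simp
    then obtain l2 where l2: "\<phi> l2 \<noteq> 0" "l2 \<noteq> l1" by blast
    have "l1 * e = l2 * e" using eq[OF l1] eq[OF l2(1)] add_left_cancel by metis
    then have "e = 0" using l2(2) by simp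
    then show ?thesis using eq[OF l1] by simp
  qed
  have mult_z: "(\<lambda>z. z * \<tau> z) \<in> J'" if "\<tau> \<in> J'" for \<tau>
  proof -
    have "(\<lambda>z. poly [:0, 1:] z * \<tau> z) \<in> J'" using J'(1) that unfolding closed_submodule_def by blast
    then show ?thesis by simp
  qed
  define \<psi>1 where "\<psi>1 = (\<lambda>z. z * \<psi> z)"
  have \<psi>1: "\<psi>1 \<in> J'" unfolding \<psi>1_def by (rule mult_z[OF \<psi>(1)])
  obtain e0 where e0: "\<And>l. e0 * \<phi> l = S (bezoutian \<psi> \<phi> l)" using const[OF \<psi>(1)] by blast
  obtain e1 where e1: "\<And>l. e1 * \<phi> l = S (bezoutian \<psi>1 \<phi> l)" using const[OF \<psi>1] by blast
  obtain e2 where e2: "\<And>l. e2 * \<phi> l = S (bezoutian (\<lambda>z. z * \<psi>1 z) \<phi> l)" using const[OF mult_z[OF \<psi>1]] by blast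
  \<comment> \<open>\<open>e1\<close> plays both roles: it is the shifted constant for
    \<open>\<psi>\<close> and the unshifted one for \<open>\<psi>1\<close>.\<close>
  have "e1 = S \<psi>" using shift[OF \<psi>(1) e0 e1[unfolded \<psi>1_def]] by blast
  moreover have "e1 = 0" using shift[OF \<psi>1 e1 e2] by blast
  ultimately show False using S(4) by simp
qed

end

theorem theorem3p1:
  fixes \<omega> :: "real \<Rightarrow> real" and a :: ereal and c r :: "nat \<Rightarrow> real"
    and J :: "(complex \<Rightarrow> complex) set"
  assumes "admissible_weight \<omega>"
    and "0 < a"
    and "incseq c" and "\<forall>k. 0 < c k \<and> ereal (c k) < a" and "(\<lambda>k. ereal (c k)) \<longlonglongrightarrow> a"
    and "incseq r" and "\<forall>k. 0 < r k \<and> r k < 1" and "r \<longlonglongrightarrow> 1"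
    and "closed_submodule \<omega> c r J" and "J \<noteq> {\<lambda>_. 0}" and "stable J"
  shows "weakly_localisable \<omega> c r J \<longleftrightarrow>
         (\<exists>\<phi>\<in>J. \<phi> \<noteq> (\<lambda>_. 0) \<and> multiplier_submodule \<omega> c r \<phi> \<subseteq> J)"
proof -
  interpret weight_space \<omega> c r
    by unfold_locales (use assms in auto)
  show ?thesis
  proof
    assume wl: "weakly_localisable \<omega> c r J"
    \<comment> \<open>Any nonzero element serves as the witness.\<close>
    obtain \<phi> where "\<phi> \<in> J" "\<phi> \<noteq> (\<lambda>_. 0)"
      using assms(9,10) unfolding closed_submodule_def by blast
    then show "\<exists>\<phi>\<in>J. \<phi> \<noteq> (\<lambda>_. 0) \<and> multiplier_submodule \<omega> c r \<phi> \<subseteq> J"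
      using weakly_localisable_imp[OF wl] by blast
  next
    assume "\<exists>\<phi>\<in>J. \<phi> \<noteq> (\<lambda>_. 0) \<and> multiplier_submodule \<omega> c r \<phi> \<subseteq> J"
    then obtain \<phi> where "\<phi> \<in> J" "\<phi> \<noteq> (\<lambda>_. 0)" "multiplier_submodule \<omega> c r \<phi> \<subseteq> J" by blast
    then show "weakly_localisable \<omega> c r J"
      unfolding weakly_localisable_def
      using weakly_localisable_if_multiplier_submodule[OF assms(9,11)] assms(9,10) by blast
  qed
qed

end
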